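(* Let $p$ be a prime and let $G$ be a finite $p$-group in which every non-normal subgroup has exactly $p$ conjugates. Then $$[G:Z(G)] \le \begin{cases} 16 & \text{if } p=2,\\ p^3 & \text{if } p>2.\end{cases}$$
   Context: $Z(G)$ denotes the center of $G$. The number of conjugates of a subgroup $H\le G$ is $[G:N_G(H)]$. *)

theory Defs
  imports "HOL-Algebra.Algebra" "HOL-Computational_Algebra.Primes"
begin

definition center :: "('a, 'b) monoid_scheme \<Rightarrow> 'a set" where
  "center G = {z \<in> carrier G. \<forall>x \<in> carrier G. z \<otimes>\<^bsub>G\<^esub> x = x \<otimes>\<^bsub>G\<^esub> z}"

definition conjugates :: "('a, 'b) monoid_scheme \<Rightarrow> 'a set \<Rightarrow> 'a set set" where
  "conjugates G H = {g <#\<^bsub>G\<^esub> H #>\<^bsub>G\<^esub> inv\<^bsub>G\<^esub> g | g. g \<in> carrier G}"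

text \<open>In a finite group, the number of conjugates of a subgroup is the index of its normalizer.\<close>

lemma (in group) card_conjugates:
  assumes "finite (carrier G)" and H: "subgroup H G"
  shows "card (conjugates G H) = card (rcosets\<^bsub>G\<^esub> (normalizer G H))"
proof -
  define \<phi> where "\<phi> = (\<lambda>g. \<lambda>H \<in> {H. subgroup H G}. g <# H #> (inv g))"
  interpret group_action G "{H. subgroup H G}" \<phi>
    unfolding \<phi>_def by (rule action_by_conjugation_on_subgroups_set)
  have sub: "H \<subseteq> carrier G"
    using H by (rule subgroup.subset)
  have orb: "orbit G \<phi> H = conjugates G H"
    using H by (auto simp: orbit_def conjugates_def \<phi>_def)
  have stab: "stabilizer G \<phi> H = normalizer G H"
    using H sub by (auto simp: stabilizer_def normalizer_def \<phi>_def)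
  have ord: "card (rcosets (stabilizer G \<phi> H)) = card (orbit G \<phi> H)"
    using H bij_betw_same_card[OF orbit_stab_fun_is_bij] by blast
  show ?thesis
    using ord unfolding orb stab by simp
qed

end

theory Submission
  imports Defs "HOL-Combinatorics.Perm" "HOL-Number_Theory.Residues"
begin

text \<open>
  On elements the hypothesis says that \<open>p\<close>-th powers and commutators normalise every subgroup and
  that normalisers have index at most \<open>p\<close>. These conditions pass to quotients, so in a minimal
  counterexample every central \<open>z\<close> of order \<open>p\<close> admits a noncentral \<open>g\<close> with
  \<open>[g, G] \<subseteq> \<langle>z\<rangle>\<close>.

  If all elements of order \<open>p\<close> are central, choose such a \<open>g\<close> for every \<open>z\<close> among the powers of
  an element \<open>a\<close> depending only on \<open>\<langle>z\<rangle>\<close>. Counting \<open>p\<close>-th powers shows that these \<open>g\<close>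
  and the centre form an abelian group whose \<open>p\<close>-th powers fill the centre, and all the \<open>a\<close> have
  the same centraliser \<open>C\<close>. For odd \<open>p\<close> an element outside \<open>C\<close> can then be corrected to a noncentral
  element of order \<open>p\<close>, a contradiction; for \<open>p = 2\<close> the index 16 splits as 2, 2 and 4.

  Otherwise there is a noncentral \<open>h\<close> of order \<open>p\<close> with a central commutator \<open>z = [h, t]\<close>, and
  every subgroup of \<open>C = C(h)\<close> that avoids \<open>z\<close> is normalised by \<open>C\<close>. If \<open>C\<close> is abelian, the bound
  \<open>p\<^sup>3\<close> follows by commuting with \<open>t\<close>. If not, then \<open>p = 2\<close>, and noncommuting elements of \<open>C\<close>
  behave as in the quaternion group: their commutator \<open>w\<close> has order 2 and their squares lie in
  \<open>{z, w}\<close>. Squares of elements outside \<open>C\<close> then lead to the bound 16.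
\<close>

section \<open>Groups as a type class\<close>

text \<open>A \<open>p\<close>-group permuting \<open>p\<close> conjugates acts through a subgroup
  of order at most \<open>p\<close> of the symmetric group of degree \<open>p\<close>; this is why
  \<open>p\<close>-th powers and commutators fix every conjugate. Stated for single elements, the
  hypothesis can be tested on preimages of subgroups, which is how quotients inherit it.

  Passing to quotients changes the carrier, so groups form a type class and a quotient is realised
  as a group of permutations of cosets. Indices are bounded by covers with translates, which compose
  along chains of subgroups and lift from quotients.

  The prime 2 is exceptional because of the exponent \<open>p choose 2\<close> in the power formula
  of class two: for odd \<open>p\<close> the commutator term vanishes, so \<open>p\<close>-th powers
  can be cancelled and elements of order \<open>p\<close> appear; for \<open>p = 2\<close> it may
  survive, and quaternion groups satisfy the same constraints. The bound 16 is four steps of index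
  2, two of them sometimes merged into one of index 4 modulo the centre of a quaternion-like group,
  while for odd \<open>p\<close> three steps of index \<open>p\<close> are enough.\<close>

class grp = monoid_mult + inverse +
  assumes left_inv [simp]: "inverse a * a = 1"
begin

lemma left_inv_assoc [simp]: "inverse a * (a * b) = b"
  by (simp flip: mult.assoc)

lemma left_cancel [simp]: "a * b = a * c \<longleftrightarrow> b = c"
  by (metis left_inv_assoc)

lemma right_inv [simp]: "a * inverse a = 1"
proof -
  have "inverse a * (a * inverse a) = inverse a * 1"
    by simp
  then show ?thesis
    by (simp only: left_cancel)
qed

lemma right_inv_assoc [simp]: "a * (inverse a * b) = b"
  by (simp flip: mult.assoc)

lemma right_cancel [simp]: "b * a = c * a \<longleftrightarrow> b = c"
  by (metis mult.assoc mult.right_neutral right_inv)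

lemma inv_unique: "a * b = 1 \<Longrightarrow> inverse a = b"
  by (metis left_inv_assoc mult.right_neutral)

lemma inv_inv [simp]: "inverse (inverse a) = a"
  by (rule inv_unique) simp

lemma inv_one [simp]: "inverse 1 = 1"
  by (rule inv_unique) simp

lemma inv_mult [simp]: "inverse (a * b) = inverse b * inverse a"
  by (rule inv_unique) (simp add: mult.assoc)

lemma inv_eq_iff [simp]: "inverse a = inverse b \<longleftrightarrow> a = b"
  by (metis inv_inv)

lemma inv_power: "inverse (a ^ k) = inverse a ^ k"
  by (induction k) (simp_all add: power_commutes)

lemma conj_power: "(inverse g * a * g) ^ k = inverse g * a ^ k * g"
  by (induction k) (simp_all add: mult.assoc)

lemma commute_power: "a * b = b * a \<Longrightarrow> a ^ k * b = b * a ^ k"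
  by (metis power_commuting_commutes)

lemma commute_power2: "a * b = b * a \<Longrightarrow> a ^ k * b ^ l = b ^ l * a ^ k"
  by (metis commute_power)

lemma commute_inv: "a * b = b * a \<Longrightarrow> inverse a * b = b * inverse a"
  by (metis left_inv_assoc mult.assoc right_inv mult.right_neutral)

lemma commute_mult: "a * c = c * a \<Longrightarrow> b * c = c * b \<Longrightarrow> (a * b) * c = c * (a * b)"
  by (metis mult.assoc)

lemma power_mult_commute:
  assumes "a * b = b * a"
  shows "(a * b) ^ k = a ^ k * b ^ k"
proof (induction k)
  case (Suc k)
  have "a * b * (a ^ k * b ^ k) = a * (b * a ^ k) * b ^ k"
    by (simp add: mult.assoc)
  also have "b * a ^ k = a ^ k * b"
    using commute_power [OF assms, of k] by simp
  finally show ?case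
    using Suc by (simp add: mult.assoc)
qed simp

section \<open>Commutators, subgroups, normalisers and covers by cosets\<close>

definition cm :: "'a \<Rightarrow> 'a \<Rightarrow> 'a" where
  "cm x y = inverse x * inverse y * x * y"

lemma cm_eq_one_iff: "cm x y = 1 \<longleftrightarrow> x * y = y * x"
proof -
  have "cm x y = inverse (y * x) * (x * y)"
    by (simp add: cm_def mult.assoc)
  then show ?thesis
    by (metis left_cancel left_inv)
qed

lemma mult_cm: "y * x * cm x y = x * y"
  by (simp add: cm_def mult.assoc)

lemma conj_eq_cm: "inverse y * x * y = x * cm x y"
  by (simp add: cm_def mult.assoc)

lemma inv_cm: "inverse (cm x y) = cm y x"
  by (simp add: cm_def mult.assoc)

definition sgp :: "'a set \<Rightarrow> bool" where
  "sgp H \<longleftrightarrow> 1 \<in> H \<and> (\<forall>x\<in>H. \<forall>y\<in>H. x * y \<in> H) \<and> (\<forall>x\<in>H. inverse x \<in> H)"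

lemma sgp_one: "sgp H \<Longrightarrow> 1 \<in> H"
  and sgp_mult: "sgp H \<Longrightarrow> x \<in> H \<Longrightarrow> y \<in> H \<Longrightarrow> x * y \<in> H"
  and sgp_inv: "sgp H \<Longrightarrow> x \<in> H \<Longrightarrow> inverse x \<in> H"
  by (auto simp: sgp_def)

lemma sgp_power: "sgp H \<Longrightarrow> x \<in> H \<Longrightarrow> x ^ k \<in> H"
  by (induction k) (auto simp: sgp_one sgp_mult)

lemma sgp_inv_iff: "sgp H \<Longrightarrow> inverse x \<in> H \<longleftrightarrow> x \<in> H"
  by (metis inv_inv sgp_inv)

lemma sgp_mult_left: "sgp H \<Longrightarrow> x \<in> H \<Longrightarrow> x * y \<in> H \<longleftrightarrow> y \<in> H"
  by (metis left_inv_assoc sgp_inv sgp_mult)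

lemma sgp_mult_right: "sgp H \<Longrightarrow> y \<in> H \<Longrightarrow> x * y \<in> H \<longleftrightarrow> x \<in> H"
  by (metis mult.assoc mult.right_neutral right_inv sgp_inv sgp_mult)

lemma sgp_Int: "sgp H \<Longrightarrow> sgp K \<Longrightarrow> sgp (H \<inter> K)"
  by (auto simp: sgp_def)

lemma sgp_cm: "sgp H \<Longrightarrow> x \<in> H \<Longrightarrow> y \<in> H \<Longrightarrow> cm x y \<in> H"
  by (simp add: cm_def sgp_inv sgp_mult)

text \<open>Both inclusions are demanded so that inverses of normalising elements normalise as well,
  whether or not \<open>H\<close> is finite.\<close>

definition nz :: "'a \<Rightarrow> 'a set \<Rightarrow> bool" where
  "nz x H \<longleftrightarrow> (\<forall>h\<in>H. inverse x * h * x \<in> H) \<and> (\<forall>h\<in>H. x * h * inverse x \<in> H)"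

lemma nzD: "nz x H \<Longrightarrow> h \<in> H \<Longrightarrow> inverse x * h * x \<in> H"
  and nzD': "nz x H \<Longrightarrow> h \<in> H \<Longrightarrow> x * h * inverse x \<in> H"
  by (auto simp: nz_def)

lemma nz_one: "nz 1 H"
  by (simp add: nz_def)

lemma nz_inv: "nz x H \<Longrightarrow> nz (inverse x) H"
  by (simp add: nz_def)

lemma nz_mult:
  assumes "nz x H" "nz y H"
  shows "nz (x * y) H"
  unfolding nz_def
proof (intro conjI ballI)
  fix h assume h: "h \<in> H"
  show "inverse (x * y) * h * (x * y) \<in> H"
    using nzD [OF assms(2) nzD [OF assms(1) h]] by (simp add: mult.assoc)
  show "x * y * h * inverse (x * y) \<in> H"
    using nzD' [OF assms(1) nzD' [OF assms(2) h]] by (simp add: mult.assoc)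
qed

lemma sgp_nz: "sgp {x. nz x H}"
  by (simp add: sgp_def nz_one nz_mult nz_inv)

lemma nz_Int: "nz x H \<Longrightarrow> nz x K \<Longrightarrow> nz x (H \<inter> K)"
  by (auto simp: nz_def)

definition centr :: "'a set \<Rightarrow> 'a set" where
  "centr A = {x. \<forall>a\<in>A. x * a = a * x}"

lemma sgp_centr: "sgp (centr A)"
  by (auto simp: sgp_def centr_def commute_mult commute_inv)

lemma centrD: "x \<in> centr A \<Longrightarrow> a \<in> A \<Longrightarrow> x * a = a * x"
  by (simp add: centr_def)

lemma nz_centr: "(\<And>h. h \<in> H \<Longrightarrow> x * h = h * x) \<Longrightarrow> nz x H"
  unfolding nz_def by (metis left_inv_assoc mult.assoc mult.right_neutral right_inv)

text \<open>Natural exponents yield the cyclic subgroup as soon as \<open>x\<close> has finite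
  order; see \<open>sgp_cyc\<close>.\<close>

definition cyc :: "'a \<Rightarrow> 'a set" where
  "cyc x = range (\<lambda>k. x ^ k)"

lemma cyc_self: "x \<in> cyc x"
  unfolding cyc_def by (metis power_one_right rangeI)

lemma power_cyc: "x ^ k \<in> cyc x"
  by (auto simp: cyc_def)

lemma cyc_sub: "sgp H \<Longrightarrow> x \<in> H \<Longrightarrow> cyc x \<subseteq> H"
  by (auto simp: cyc_def sgp_power)

lemma cyc_commute: "a \<in> cyc x \<Longrightarrow> x * y = y * x \<Longrightarrow> a * y = y * a"
  by (auto simp: cyc_def commute_power)

lemma sgp_cyc:
  assumes "x ^ m = 1" "0 < m"
  shows "sgp (cyc x)"
proof -
  have "inverse (x ^ k) \<in> cyc x" for k
  proof -
    have "x ^ k * x ^ (m * k - k) = x ^ (m * k)"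
      using assms(2) by (simp flip: power_add)
    then have "x ^ k * x ^ (m * k - k) = 1"
      using assms(1) by (simp add: power_mult)
    then show ?thesis
      using inv_unique power_cyc by metis
  qed
  moreover have "x ^ k * x ^ l \<in> cyc x" for k l
    by (metis power_add power_cyc)
  moreover have "1 \<in> cyc x"
    using power_cyc [of x 0] by simp
  ultimately show ?thesis
    by (auto simp: sgp_def cyc_def)
qed

text \<open>\<open>cov A B m\<close> bounds the number of cosets of \<open>B\<close> needed to cover \<open>A\<close>.\<close>

definition cov :: "'a set \<Rightarrow> 'a set \<Rightarrow> nat \<Rightarrow> bool" where
  "cov A B m \<longleftrightarrow> (\<exists>F. finite F \<and> card F \<le> m \<and> (\<forall>a\<in>A. \<exists>f\<in>F. f * a \<in> B))"

lemma cov_trans: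
  assumes "cov A B m" "cov B D k"
  shows "cov A D (m * k)"
proof -
  obtain E F where E: "finite E" "card E \<le> m" "\<And>a. a \<in> A \<Longrightarrow> \<exists>f\<in>E. f * a \<in> B"
    and F: "finite F" "card F \<le> k" "\<And>a. a \<in> B \<Longrightarrow> \<exists>f\<in>F. f * a \<in> D"
    using assms unfolding cov_def by blast
  have "card ((\<lambda>(e, f). f * e) ` (E \<times> F)) \<le> card (E \<times> F)"
    using E(1) F(1) by (intro card_image_le) auto
  also have "\<dots> \<le> m * k"
    using E(2) F(2) by (simp add: card_cartesian_product mult_le_mono)
  finally have "card ((\<lambda>(e, f). f * e) ` (E \<times> F)) \<le> m * k" .
  moreover have "\<exists>g\<in>(\<lambda>(e, f). f * e) ` (E \<times> F). g * a \<in> D" if a: "a \<in> A" for a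
  proof -
    obtain e where e: "e \<in> E" "e * a \<in> B"
      using E(3) a by blast
    obtain f where f: "f \<in> F" "f * (e * a) \<in> D"
      using F(3) e(2) by blast
    then have "(f * e) * a \<in> D" "f * e \<in> (\<lambda>(e, f). f * e) ` (E \<times> F)"
      using e(1) by (auto simp: mult.assoc)
    then show ?thesis by blast
  qed
  ultimately show ?thesis
    unfolding cov_def using E(1) F(1)
    by (intro exI [of _ "(\<lambda>(e, f). f * e) ` (E \<times> F)"]) simp
qed

lemma cov_mono: "cov A B m \<Longrightarrow> A' \<subseteq> A \<Longrightarrow> B \<subseteq> B' \<Longrightarrow> m \<le> m' \<Longrightarrow> cov A' B' m'"
  unfolding cov_def by (meson in_mono order_trans)

lemma covI_power: "(\<And>a. a \<in> A \<Longrightarrow> \<exists>i<m. t ^ i * a \<in> B) \<Longrightarrow> cov A B m"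
  unfolding cov_def
  by (rule exI [of _ "(\<lambda>i. t ^ i) ` {..<m}"]) (use card_image_le [of "{..<m}"] in auto)

lemma cov_triv: "A \<subseteq> B \<Longrightarrow> 0 < m \<Longrightarrow> cov A B m"
  unfolding cov_def by (rule exI [of _ "{1}"]) auto

text \<open>Elements with equal values under \<open>\<phi>\<close> lie in one coset of
  \<open>B\<close>, so a chosen preimage of each value represents all cosets, and these can be
  counted in \<open>S\<close>.\<close>

lemma covI_image:
  assumes "sgp A" "finite S" "card S \<le> m" "\<And>a. a \<in> A \<Longrightarrow> \<phi> a \<in> S"
    and "\<And>a b. a \<in> A \<Longrightarrow> b \<in> A \<Longrightarrow> \<phi> a = \<phi> b \<Longrightarrow> inverse b * a \<in> B"
  shows "cov A B m"
proof -
  have fin: "finite (\<phi> ` A)" and le: "card (\<phi> ` A) \<le> card S"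
    using assms(2,4) by (auto intro: finite_subset card_mono)
  define r where "r y = (SOME a. a \<in> A \<and> \<phi> a = y)" for y
  have r: "r y \<in> A \<and> \<phi> (r y) = y" if "y \<in> \<phi> ` A" for y
    unfolding r_def by (rule someI_ex) (use that in auto)
  have "card ((\<lambda>y. inverse (r y)) ` \<phi> ` A) \<le> m"
    using card_image_le [OF fin, of "\<lambda>y. inverse (r y)"] le assms(3) by linarith
  moreover have "\<exists>f\<in>(\<lambda>y. inverse (r y)) ` \<phi> ` A. f * a \<in> B" if "a \<in> A" for a
    using assms(5) [of a "r (\<phi> a)"] r [of "\<phi> a"] that by auto
  ultimately show ?thesis
    unfolding cov_def using fin
    by (intro exI [of _ "(\<lambda>y. inverse (r y)) ` \<phi> ` A"]) simp
qed

end

section \<open>Finite \<open>p\<close>-groups with few conjugates\<close>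

text \<open>This divisibility removes the commutator term from the power formula of class two. Its
  exception, \<open>p = 2\<close> with \<open>m = 1\<close>, is what separates the prime 2 from the
  odd primes later.\<close>

lemma p_dvd_choose_two:
  fixes p m :: nat
  assumes "Factorial_Ring.prime p" "0 < m" "p \<noteq> 2 \<or> 2 \<le> m"
  shows "p dvd (p ^ m choose 2)"
proof (cases "p = 2")
  case True
  then obtain k where "m = Suc (Suc k)"
    using assms(3) by (metis add_2_eq_Suc le_Suc_ex)
  then have "p ^ m choose 2 = 2 * (2 ^ k * (p ^ m - 1))"
    using True by (simp add: choose_two)
  then show ?thesis
    using True by simp
next
  case False
  then have "odd p"
    using assms(1) prime_nat_iff' [of p] primes_dvd_imp_eq two_is_prime_nat by blast
  then have "even (p ^ m - 1)"
    by (simp add: even_diff_nat)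
  then obtain k where k: "p ^ m - 1 = 2 * k"
    by (rule evenE)
  have "p ^ m choose 2 = p ^ m * k"
    using k by (simp add: choose_two)
  then show ?thesis
    using assms(2) by simp
qed

context grp begin

text \<open>Collecting the factors \<open>a\<close> on the left moves each \<open>b\<close> past
  every later \<open>a\<close>; each of these \<open>m choose 2\<close> exchanges releases one
  \<open>c\<close>, which commutes with everything.\<close>

lemma class2_power:
  assumes ba: "b * a = a * b * c" and ca: "c * a = a * c" and cb: "c * b = b * c"
  shows "(a * b) ^ m = a ^ m * b ^ m * c ^ (m choose 2)"
proof (induction m)
  case (Suc m)
  have bm: "b ^ m * a = a * b ^ m * c ^ m" for m
  proof (induction m)
    case (Suc m)
    have "b ^ Suc m * a = b * (a * b ^ m * c ^ m)"
      using Suc by (simp add: mult.assoc)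
    also have "\<dots> = a * b * (c * b ^ m) * c ^ m"
      using ba by (simp flip: mult.assoc)
    also have "c * b ^ m = b ^ m * c"
      using commute_power [of b c m] cb by simp
    finally show ?case by (simp add: mult.assoc)
  qed simp
  have "(a * b) ^ Suc m = a ^ m * b ^ m * c ^ (m choose 2) * (a * b)"
    using Suc by (simp add: power_Suc2 del: power_Suc)
  also have "\<dots> = a ^ m * b ^ m * (c ^ (m choose 2) * (a * b))"
    by (simp add: mult.assoc)
  also have "c ^ (m choose 2) * (a * b) = a * b * c ^ (m choose 2)"
    by (rule commute_power) (metis ca cb mult.assoc)
  also have "a ^ m * b ^ m * (a * b * c ^ (m choose 2)) = a ^ m * (b ^ m * a) * (b * c ^ (m choose 2))"
    by (simp add: mult.assoc)
  also have "\<dots> = a ^ m * a * b ^ m * (c ^ m * b) * c ^ (m choose 2)"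
    by (simp add: bm mult.assoc)
  also have "c ^ m * b = b * c ^ m"
    using commute_power [of c b m] cb by simp
  also have "a ^ m * a * b ^ m * (b * c ^ m) * c ^ (m choose 2)
      = a ^ Suc m * b ^ Suc m * c ^ (Suc m choose 2)"
    by (simp add: power_Suc2 power_add mult.assoc numeral_2_eq_2 del: power_Suc)
  finally show ?case .
qed (simp add: numeral_2_eq_2)

end

text \<open>A common exponent \<open>p ^ n\<close> is required rather than an order, because the
  same \<open>n\<close> then serves for all subgroups and homomorphic images.\<close>

locale pgrp =
  fixes G :: "'a::grp set" and p n :: nat
  assumes prime_p: "Factorial_Ring.prime p"
    and sgp_G: "sgp G"
    and fin_G: "finite G"
    and exp_G: "x \<in> G \<Longrightarrow> x ^ p ^ n = 1"
begin

lemma p_gt_1: "1 < p" and p_pos: "0 < p"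
  using prime_p prime_gt_1_nat prime_gt_0_nat by blast+

lemma pn_pos: "0 < p ^ n"
  using p_pos by simp

lemmas G_mult = sgp_mult [OF sgp_G] and G_inv = sgp_inv [OF sgp_G]
  and G_one = sgp_one [OF sgp_G] and G_power = sgp_power [OF sgp_G] and G_cm = sgp_cm [OF sgp_G]

lemma cyc_G: "x \<in> G \<Longrightarrow> cyc x \<subseteq> G"
  by (rule cyc_sub [OF sgp_G])

lemma sgp_cyc_G: "x \<in> G \<Longrightarrow> sgp (cyc x)"
  using sgp_cyc exp_G pn_pos by blast

text \<open>The order of \<open>x\<close> in \<open>G\<close> is \<open>p ^ ht x\<close>.\<close>

definition ht :: "'a \<Rightarrow> nat" where
  "ht x = (LEAST k. x ^ p ^ k = 1)"

lemma power_ht: "x \<in> G \<Longrightarrow> x ^ p ^ ht x = 1"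
  unfolding ht_def by (rule LeastI) (rule exp_G)

lemma ht_le: "x ^ p ^ k = 1 \<Longrightarrow> ht x \<le> k"
  unfolding ht_def by (rule Least_le)

lemma ht_eq_0: "x \<in> G \<Longrightarrow> ht x = 0 \<longleftrightarrow> x = 1"
  using power_ht [of x] ht_le [of x 0] by auto

text \<open>Bezout turns the two relations into \<open>x ^ gcd (p ^ n) m = 1\<close>, and this gcd
  is itself a power of \<open>p\<close>.\<close>

lemma ht_dvd:
  assumes x: "x \<in> G" and m: "x ^ m = 1"
  shows "p ^ ht x dvd m"
proof -
  obtain u v where "p ^ n * u = m * v + gcd (p ^ n) m"
    using bezout_nat [of "p ^ n" m] pn_pos by auto
  then have "x ^ (p ^ n * u) = x ^ (m * v) * x ^ gcd (p ^ n) m"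
    by (simp flip: power_add)
  then have g: "x ^ gcd (p ^ n) m = 1"
    using exp_G [OF x] m by (simp add: power_mult)
  obtain j where j: "gcd (p ^ n) m = p ^ j"
    using divides_primepow_nat [OF prime_p] by (meson gcd_dvd1)
  have "ht x \<le> j"
    using g j ht_le by metis
  then have "p ^ ht x dvd p ^ j"
    by (rule le_imp_power_dvd)
  then show ?thesis
    using j by (metis dvd_trans gcd_dvd2)
qed

lemma order_p_dvd:
  assumes "x \<in> G" "x \<noteq> 1" "x ^ m = 1"
  shows "p dvd m"
proof -
  have "ht x \<noteq> 0"
    using assms ht_eq_0 by simp
  then have "p dvd p ^ ht x" by simp
  then show ?thesis
    using ht_dvd [OF assms(1,3)] dvd_trans by blast
qed

text \<open>Exponents prime to \<open>p\<close> are invertible modulo \<open>p ^ n\<close>.\<close>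

lemma coprime_root:
  assumes x: "x \<in> G" and k: "\<not> p dvd k"
  obtains j where "(x ^ k) ^ j = x"
proof -
  have "k \<noteq> 0"
    using k by (metis dvd_0_right)
  moreover have "gcd k (p ^ n) = 1"
    using k prime_p by (metis coprime_commute coprime_iff_gcd_eq_1 coprime_power_left_iff prime_imp_coprime)
  ultimately obtain u v where "k * u = p ^ n * v + 1"
    using bezout_nat [of k "p ^ n"] by metis
  then have "x ^ (k * u) = x ^ (p ^ n * v) * x"
    by (simp add: power_add power_commutes)
  then have "(x ^ k) ^ u = x"
    using exp_G [OF x] by (simp add: power_mult)
  then show thesis by (rule that)
qed

lemma coprime_cyc: "x \<in> G \<Longrightarrow> \<not> p dvd k \<Longrightarrow> x \<in> cyc (x ^ k)"
  by (metis coprime_root power_cyc)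

text \<open>A group of order \<open>p\<close>, called a line below, is generated by each of its
  nontrivial elements.\<close>

lemma line_sym:
  assumes "w \<in> G" "w ^ p = 1" "u \<in> cyc w" "u \<noteq> 1"
  shows "w \<in> cyc u"
proof -
  obtain k where k: "u = w ^ k"
    using assms(3) by (auto simp: cyc_def)
  have "\<not> p dvd k"
    using k assms(2,4) by (auto simp: power_mult elim!: dvdE)
  then show ?thesis
    using coprime_cyc assms(1) k by simp
qed

lemma cyc_trans: "x \<in> cyc y \<Longrightarrow> y \<in> cyc z \<Longrightarrow> x \<in> cyc z"
  by (auto simp: cyc_def simp flip: power_mult)

text \<open>A cyclic \<open>p\<close>-group has a single subgroup of order \<open>p\<close>, at its
  bottom. For \<open>x = 1\<close> the truncated exponent \<open>ht x - 1\<close> is 0, which is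
  harmless.\<close>

lemma omega:
  assumes x: "x \<in> G" and u: "u \<in> cyc x" "u ^ p = 1"
  shows "u \<in> cyc (x ^ p ^ (ht x - 1))"
proof (cases "ht x = 0")
  case True
  then show ?thesis
    using x u by (simp add: ht_eq_0 cyc_def)
next
  case False
  obtain k where k: "u = x ^ k"
    using u by (auto simp: cyc_def)
  have "x ^ (k * p) = 1"
    using u(2) k by (simp add: power_mult)
  then have "p ^ ht x dvd k * p"
    using ht_dvd x by blast
  moreover have "p ^ ht x = p ^ (ht x - 1) * p"
    using False by (metis Suc_pred' neq0_conv power_Suc2)
  ultimately have "p ^ (ht x - 1) dvd k"
    using p_pos by simp
  then obtain j where "k = p ^ (ht x - 1) * j" ..
  then show ?thesis
    using k power_cyc by (simp add: power_mult)
qed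

lemma bottom:
  assumes x: "x \<in> G" "x \<noteq> 1"
  shows "x ^ p ^ (ht x - 1) \<noteq> 1" "(x ^ p ^ (ht x - 1)) ^ p = 1"
proof -
  have h: "0 < ht x"
    using x ht_eq_0 by auto
  show "x ^ p ^ (ht x - 1) \<noteq> 1"
    using ht_le [of x "ht x - 1"] h by auto
  have "(x ^ p ^ (ht x - 1)) ^ p = x ^ p ^ ht x"
    using h by (metis Suc_pred' power_Suc2 power_mult)
  then show "(x ^ p ^ (ht x - 1)) ^ p = 1"
    using power_ht x by simp
qed

lemma omega_line:
  assumes x: "x \<in> G" and u: "u \<in> cyc x" "u ^ p = 1" and v: "v \<in> cyc x" "v ^ p = 1" "v \<noteq> 1"
  shows "u \<in> cyc v"
proof -
  have w: "x ^ p ^ (ht x - 1) \<in> cyc v"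
  proof (rule line_sym)
    show "(x ^ p ^ (ht x - 1)) ^ p = 1"
      by (metis bottom(2) power_one x)
  qed (use omega x v G_power in auto)
  show ?thesis
    using cyc_trans [OF omega [OF x u] w] .
qed

lemma ht_power:
  assumes x: "x \<in> G" "x \<noteq> 1"
  shows "ht (x ^ p) < ht x"
proof -
  have "(x ^ p) ^ p ^ (ht x - 1) = 1"
    using bottom(2) [OF x] by (simp add: mult.commute flip: power_mult)
  then have "ht (x ^ p) \<le> ht x - 1"
    by (rule ht_le)
  moreover have "ht x \<noteq> 0"
    using x ht_eq_0 by simp
  ultimately show ?thesis by simp
qed

lemma fermat_iter: "[k ^ p ^ m = k] (mod p)"
proof -
  have 1: "[k ^ p = k] (mod p)" for k :: nat
  proof (cases "p dvd k")
    case True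
    then show ?thesis
      using p_pos by (simp add: cong_def mod_eq_0_iff_dvd dvd_power_iff)
         (meson dvd_power dvd_trans True)
  next
    case False
    then have "[k * k ^ (p - 1) = k * 1] (mod p)"
      using fermat_theorem [OF prime_p] cong_scalar_left by blast
    then show ?thesis
      using p_pos by (metis Suc_pred' mult.right_neutral power_Suc)
  qed
  show ?thesis
  proof (induction m)
    case (Suc m)
    have "[(k ^ p ^ m) ^ p = k ^ p ^ m] (mod p)"
      by (rule 1)
    then show ?case
      using Suc by (metis cong_trans mult.commute power_Suc power_mult)
  qed simp
qed

text \<open>The automorphism group of a group of order \<open>p\<close> has order
  \<open>p - 1\<close>, so an element of \<open>p\<close>-power order acts trivially. Concretely,
  \<open>g\<close> raises \<open>h\<close> to some \<open>k\<close> with \<open>k ^ p ^ n\<close>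
  congruent to 1, and Fermat makes \<open>k\<close> congruent to 1.\<close>

lemma nz_order_p:
  assumes h: "h \<in> G" "h ^ p = 1" and g: "g \<in> G" "nz g (cyc h)"
  shows "g * h = h * g"
proof (cases "h = 1")
  case False
  obtain k where k: "inverse g * h * g = h ^ k"
    using nzD [OF g(2) cyc_self] by (auto simp: cyc_def)
  have it: "inverse g ^ m * h * g ^ m = h ^ k ^ m" for m
  proof (induction m)
    case (Suc m)
    have "inverse g ^ Suc m * h * g ^ Suc m = inverse g * (inverse g ^ m * h * g ^ m) * g"
      by (metis mult.assoc power_Suc power_Suc2)
    also have "\<dots> = (h ^ k) ^ k ^ m"
      using Suc conj_power k by metis
    finally show ?case
      by (simp add: power_mult mult.commute)
  qed simp
  have "h = h ^ k ^ p ^ n"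
    using it [of "p ^ n"] exp_G [OF g(1)] exp_G [OF G_inv [OF g(1)]] by simp
  then have k0: "h ^ (k ^ p ^ n) = h ^ 1" by simp
  have "k \<noteq> 0"
    using k False by (metis left_cancel left_inv mult.right_neutral power_0 right_cancel)
  then have "1 \<le> k ^ p ^ n" by simp
  then have "h ^ (k ^ p ^ n - 1) = 1"
    using k0 by (metis le_add_diff_inverse2 left_cancel mult.right_neutral power_add power_one_right power_commutes power_Suc Suc_eq_plus1)
  then have "p dvd k ^ p ^ n - 1"
    using order_p_dvd h(1) False by blast
  then have "[k ^ p ^ n = 1] (mod p)"
    using \<open>1 \<le> k ^ p ^ n\<close> cong_altdef_nat' cong_altdef_nat by blast
  then have "[k = 1] (mod p)"
    using fermat_iter cong_sym cong_trans by blast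
  then have "p dvd k - 1"
    using \<open>k \<noteq> 0\<close> cong_altdef_nat [of 1 k p] by simp
  then have "h ^ (k - 1) = 1"
    using h(2) by (auto simp: power_mult elim!: dvdE)
  then have "h ^ k = h"
    using \<open>k \<noteq> 0\<close> by (metis mult.right_neutral power_minus_mult neq0_conv mult.left_neutral)
  then show ?thesis
    using k by (metis mult.assoc right_inv_assoc)
qed simp

definition Z :: "'a set" where
  "Z = G \<inter> centr G"

lemma sgp_Z: "sgp Z"
  by (simp add: Z_def sgp_Int sgp_G sgp_centr)

lemma Z_G: "z \<in> Z \<Longrightarrow> z \<in> G"
  and Z_commute: "z \<in> Z \<Longrightarrow> x \<in> G \<Longrightarrow> z * x = x * z"
  and Z_I: "z \<in> G \<Longrightarrow> (\<And>x. x \<in> G \<Longrightarrow> z * x = x * z) \<Longrightarrow> z \<in> Z"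
  by (auto simp: Z_def centr_def)

end

text \<open>An elementwise form of the hypothesis on conjugates that is inherited by quotients.\<close>

locale few_conj = pgrp +
  assumes P1: "sgp H \<Longrightarrow> H \<subseteq> G \<Longrightarrow> x \<in> G \<Longrightarrow> nz (x ^ p) H"
    and P2: "sgp H \<Longrightarrow> H \<subseteq> G \<Longrightarrow> x \<in> G \<Longrightarrow> y \<in> G \<Longrightarrow> nz (cm x y) H"
    and P3: "sgp H \<Longrightarrow> H \<subseteq> G \<Longrightarrow> x \<in> G \<Longrightarrow> y \<in> G \<Longrightarrow> \<not> nz x H \<Longrightarrow> \<exists>i<p. nz (x ^ i * y) H"
begin

text \<open>\<open>P3\<close> bounds the index of a normaliser inside any subgroup \<open>A\<close>:
  a non-normalising \<open>x\<close> taken from \<open>A\<close> keeps all coset representatives in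
  \<open>A\<close>.\<close>

lemma cov_nz:
  assumes "sgp H" "H \<subseteq> G" "sgp A" "A \<subseteq> G"
  shows "cov A (A \<inter> {x. nz x H}) p"
proof (cases "\<exists>x\<in>A. \<not> nz x H")
  case True
  then obtain x where x: "x \<in> A" "\<not> nz x H" by blast
  show ?thesis
  proof (rule covI_power [of _ _ x])
    fix a assume a: "a \<in> A"
    obtain i where "i < p" "nz (x ^ i * a) H"
      using P3 assms x a by blast
    then show "\<exists>i<p. x ^ i * a \<in> A \<inter> {x. nz x H}"
      using sgp_mult sgp_power assms(3) x(1) a by blast
  qed
next
  case False
  then show ?thesis
    by (intro cov_triv) (use p_pos in auto)
qed

end

context grp begin

lemma cm_mult_right: "cm a (x * y) = cm a y * (inverse y * cm a x * y)"
  by (simp add: cm_def mult.assoc)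

lemma cm_mult_left: "cm (a * b) x = (inverse b * cm a x * b) * cm b x"
  by (simp add: cm_def mult.assoc)

lemma cyc_power_one: "c \<in> cyc z \<Longrightarrow> z ^ k = 1 \<Longrightarrow> c ^ k = 1"
  unfolding cyc_def by (metis imageE mult.commute power_mult power_one)

lemma cm_one [simp]: "cm 1 x = 1" "cm x 1 = 1"
  by (simp_all add: cm_def)

lemma conj_of_commute: "c * y = y * c \<Longrightarrow> inverse y * c * y = c"
  by (simp add: mult.assoc)

lemma cm_inverse_eq_imp_commute:
  assumes "cm t (inverse a) = cm t (inverse b)"
  shows "(inverse b * a) * t = t * (inverse b * a)"
proof -
  have "a * t * inverse a = b * t * inverse b"
    using assms by (simp add: cm_def mult.assoc)
  then have "inverse b * (a * t * inverse a) * a = inverse b * (b * t * inverse b) * a"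
    by simp
  then show ?thesis
    by (simp add: mult.assoc)
qed

end

context pgrp begin

lemma card_omega:
  assumes x: "x \<in> G"
  shows "finite {d \<in> cyc x. d ^ p = 1}" "card {d \<in> cyc x. d ^ p = 1} \<le> p"
proof -
  define w where "w = x ^ p ^ (ht x - 1)"
  have w: "w ^ p = 1"
    using bottom(2) [OF x] unfolding w_def by (cases "x = 1") auto
  have "{d \<in> cyc x. d ^ p = 1} \<subseteq> (\<lambda>i. w ^ i) ` {..<p}"
  proof
    fix d assume "d \<in> {d \<in> cyc x. d ^ p = 1}"
    then obtain k where "d = w ^ k"
      using omega [OF x] by (auto simp: w_def cyc_def)
    moreover have "w ^ k = w ^ (p * (k div p)) * w ^ (k mod p)"
      by (simp flip: power_add)
    ultimately have "d = w ^ (k mod p)"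
      using w by (simp add: power_mult)
    then show "d \<in> (\<lambda>i. w ^ i) ` {..<p}"
      using p_pos by auto
  qed
  moreover have "card ((\<lambda>i. w ^ i) ` {..<p}) \<le> p"
    by (metis card_image_le card_lessThan finite_lessThan)
  ultimately show "finite {d \<in> cyc x. d ^ p = 1}" "card {d \<in> cyc x. d ^ p = 1} \<le> p"
    by (auto intro: finite_subset order_trans [OF card_mono])
qed

text \<open>\<open>t\<close> and \<open>C\<close> generate \<open>G\<close>, since every
  \<open>y\<close> enters \<open>C\<close> after multiplication by a power of
  \<open>t\<close>.\<close>

lemma center_by_cover:
  assumes u: "u \<in> G" "u * t = t * u" "\<And>c. c \<in> C \<Longrightarrow> u * c = c * u"
    and cover: "\<And>y. y \<in> G \<Longrightarrow> \<exists>i. t ^ i * y \<in> C"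
  shows "u \<in> Z"
proof (rule Z_I)
  fix y assume "y \<in> G"
  then obtain i where "t ^ i * y \<in> C"
    using cover by blast
  then have "u * (t ^ i * y) = t ^ i * y * u"
    using u by blast
  moreover have "u * t ^ i = t ^ i * u"
    using u(2) commute_power by metis
  ultimately have "t ^ i * (u * y) = t ^ i * (y * u)"
    by (metis mult.assoc)
  then show "u * y = y * u" by simp
qed (fact u(1))

lemma Z_conj: "c \<in> Z \<Longrightarrow> y \<in> G \<Longrightarrow> inverse y * c * y = c"
  by (rule conj_of_commute) (rule Z_commute)

lemma cm_Z_right: "cm a x \<in> Z \<Longrightarrow> y \<in> G \<Longrightarrow> cm a y \<in> G \<Longrightarrow> cm a (x * y) = cm a x * cm a y"
  using Z_commute [of "cm a x" "cm a y"] by (simp add: cm_mult_right Z_conj)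

lemma cm_Z_left: "cm a x \<in> Z \<Longrightarrow> b \<in> G \<Longrightarrow> cm (a * b) x = cm a x * cm b x"
  by (simp add: cm_mult_left Z_conj)

lemma cm_Z_power_right:
  assumes "a \<in> G" "x \<in> G" "cm a x \<in> Z"
  shows "cm a (x ^ k) = cm a x ^ k"
proof (induction k)
  case (Suc k)
  have "cm a (x * x ^ k) = cm a x * cm a (x ^ k)"
    by (rule cm_Z_right) (use assms G_power G_cm in auto)
  then show ?case using Suc by simp
qed simp

lemma cm_Z_power_left:
  assumes "a \<in> G" "x \<in> G" "cm a x \<in> Z"
  shows "cm (a ^ k) x = cm a x ^ k"
proof (induction k)
  case (Suc k)
  have "cm (a * a ^ k) x = cm a x * cm (a ^ k) x"
    by (rule cm_Z_left) (use assms G_power in auto)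
  then show ?case using Suc by simp
qed simp

lemma cyc_Z: "z \<in> Z \<Longrightarrow> cyc z \<subseteq> Z"
  by (rule cyc_sub [OF sgp_Z])

lemma line_eq:
  assumes "z \<in> G" "z ^ p = 1" "z' \<in> G" "z' ^ p = 1" "c \<in> cyc z" "c \<in> cyc z'" "c \<noteq> 1"
  shows "cyc z = cyc z'"
  using line_sym [OF assms(1,2,5,7)] line_sym [OF assms(3,4,6,7)] assms(5,6) cyc_trans by blast

end

context few_conj begin

text \<open>The map sending \<open>c\<close> to \<open>cm t (inverse c)\<close> is constant exactly
  on the left cosets of the centraliser of \<open>t\<close>, and its values on \<open>A\<close> are
  elements of order dividing \<open>p\<close> in one cyclic group, of which there are at most
  \<open>p\<close>.\<close>

lemma cov_commuting:
  assumes A: "sgp A" "A \<subseteq> G" and t: "t \<in> G"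
    and nzt: "\<And>c. c \<in> A \<Longrightarrow> nz c (cyc t)"
    and ord: "\<And>c. c \<in> A \<Longrightarrow> cm t c \<in> cyc t \<Longrightarrow> cm t c ^ p = 1"
    and Z: "\<And>c. c \<in> A \<Longrightarrow> c * t = t * c \<Longrightarrow> c \<in> Z"
  shows "cov A Z p"
proof (rule covI_image [of _ "{d \<in> cyc t. d ^ p = 1}" _ "\<lambda>a. cm t (inverse a)"])
  fix c' assume "c' \<in> A"
  define c where "c = inverse c'"
  have c: "c \<in> A"
    using A(1) \<open>c' \<in> A\<close> sgp_inv unfolding c_def by blast
  have "inverse c * t * c \<in> cyc t"
    using nzD [OF nzt [OF c] cyc_self] .
  then have "inverse t * (inverse c * t * c) \<in> cyc t"
    using sgp_cyc_G [OF t] cyc_self sgp_inv sgp_mult by blast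
  then have "cm t c \<in> cyc t"
    by (simp add: cm_def mult.assoc)
  then show "cm t (inverse c') \<in> {d \<in> cyc t. d ^ p = 1}"
    using ord c unfolding c_def by blast
next
  fix a b assume ab: "a \<in> A" "b \<in> A" "cm t (inverse a) = cm t (inverse b)"
  then have "inverse b * a \<in> A"
    using A sgp_mult sgp_inv by blast
  then show "inverse b * a \<in> Z"
    using Z cm_inverse_eq_imp_commute [OF ab(3)] by blast
qed (use A card_omega [OF t] in auto)

text \<open>Three steps of index at most \<open>p\<close> lead from \<open>G\<close> to
  \<open>C\<close>, to the normaliser of \<open>cyc t\<close> in \<open>C\<close>, and to
  \<open>Z\<close>; elements of the abelian \<open>C\<close> that commute with \<open>t\<close> are
  central.\<close>

lemma abelian_index:
  assumes C: "sgp C" "C \<subseteq> G" "\<And>a b. a \<in> C \<Longrightarrow> b \<in> C \<Longrightarrow> a * b = b * a"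
    and t: "t \<in> G" "t ^ p \<in> C" "nz t C" "\<And>y. y \<in> G \<Longrightarrow> \<exists>i<p. t ^ i * y \<in> C"
  shows "cov G Z (p ^ 3)"
proof -
  define N where "N = C \<inter> {x. nz x (cyc t)}"
  have 1: "cov G C p"
    by (rule covI_power) (rule t(4))
  have 2: "cov C N p"
    unfolding N_def by (rule cov_nz) (use C t cyc_G sgp_cyc_G in auto)
  have 3: "cov N Z p"
  proof (rule cov_commuting [of _ t])
    show "sgp N"
      unfolding N_def by (rule sgp_Int [OF C(1) sgp_nz])
    fix c assume "c \<in> N"
    then have c: "c \<in> C" "c \<in> G"
      using C N_def by auto
    \<comment> \<open>Conjugation by \<open>c\<close> sends \<open>t\<close> to
      \<open>t * cm t c\<close> but fixes \<open>t ^ p\<close>, which lies in the abelian group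
      \<open>C\<close>; as \<open>t\<close> commutes with its power \<open>cm t c\<close>, the two
      \<open>p\<close>-th powers can be compared.\<close>
    show "cm t c ^ p = 1" if "cm t c \<in> cyc t"
    proof -
      have "t * cm t c = cm t c * t"
        using cyc_commute [OF that] by simp
      then have "(t * cm t c) ^ p = t ^ p * cm t c ^ p"
        by (rule power_mult_commute)
      moreover have "(inverse c * t * c) ^ p = t ^ p"
        by (metis C(3) c(1) conj_of_commute conj_power t(2))
      ultimately show ?thesis
        by (metis conj_eq_cm left_cancel mult.right_neutral)
    qed
    show "c \<in> Z" if "c * t = t * c"
      by (rule center_by_cover [of _ t C]) (use c that C t(4) in blast)+
  qed (use N_def C t in auto)
  show ?thesis
    using cov_trans [OF 1 cov_trans [OF 2 3]] by (simp add: power3_eq_cube mult.assoc)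
qed

end

section \<open>Central elements of order \<open>p\<close>\<close>

context grp begin

text \<open>The double centraliser serves as an abelian subgroup around \<open>S\<close>, without
  speaking of generated subgroups.\<close>

lemma commuting_closure:
  assumes S: "\<And>x y. x \<in> S \<Longrightarrow> y \<in> S \<Longrightarrow> x * y = y * x"
  shows "S \<subseteq> centr (centr S)"
    and "x \<in> centr (centr S) \<Longrightarrow> y \<in> centr (centr S) \<Longrightarrow> x * y = y * x"
proof -
  show S2: "S \<subseteq> centr (centr S)"
    by (auto simp: centr_def)
  have "S \<subseteq> centr S"
    using S by (auto simp: centr_def)
  then have "centr (centr S) \<subseteq> centr S"
    by (auto simp: centr_def)
  then show "x * y = y * x" if "x \<in> centr (centr S)" "y \<in> centr (centr S)"
    using that centrD by blast
qed

end

context pgrp begin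

definition Om :: "'a set" where
  "Om = {z \<in> Z. z ^ p = 1}"

text \<open>On the abelian group \<open>U\<close> the \<open>p\<close>-th power map is a
  homomorphism with kernel inside \<open>Om\<close>. The injection records the power of
  \<open>u\<close> and the deviation of \<open>u\<close> from a chosen root of that power.\<close>

lemma card_le_power_image:
  assumes U: "sgp U" "U \<subseteq> G" "\<And>a b. a \<in> U \<Longrightarrow> b \<in> U \<Longrightarrow> a * b = b * a"
    and central: "\<And>x. x \<in> G \<Longrightarrow> x ^ p = 1 \<Longrightarrow> x \<in> Z"
  shows "card U \<le> card Om * card ((\<lambda>u. u ^ p) ` U)"
proof -
  define r where "r y = (SOME u. u \<in> U \<and> u ^ p = y)" for y
  have r: "r (u ^ p) \<in> U \<and> r (u ^ p) ^ p = u ^ p" if "u \<in> U" for u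
    unfolding r_def by (rule someI_ex) (use that in auto)
  have fin: "finite ((\<lambda>u. u ^ p) ` U)" "finite Om"
    using U fin_G by (auto simp: Om_def Z_def intro: finite_subset)
  have "card U \<le> card (Om \<times> (\<lambda>u. u ^ p) ` U)"
  proof (rule card_inj_on_le)
    show "inj_on (\<lambda>u. (inverse (r (u ^ p)) * u, u ^ p)) U"
      by (auto simp: inj_on_def)
    show "(\<lambda>u. (inverse (r (u ^ p)) * u, u ^ p)) ` U \<subseteq> Om \<times> (\<lambda>u. u ^ p) ` U"
    proof safe
      fix u assume u: "u \<in> U"
      define v where "v = r (u ^ p)"
      have v: "v \<in> U" "v ^ p = u ^ p"
        using r [OF u] by (auto simp: v_def)
      have iv: "inverse v \<in> U"
        using v U(1) sgp_inv by blast
      have "(inverse v * u) ^ p = inverse v ^ p * u ^ p"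
        by (rule power_mult_commute) (use U(3) iv u in blast)
      then have "(inverse v * u) ^ p = 1"
        using v(2) by (metis inv_power left_inv)
      then show "inverse (r (u ^ p)) * u \<in> Om"
        using central [of "inverse v * u"] iv u U(1,2) sgp_mult unfolding v_def Om_def by blast
    qed auto
  qed (simp add: fin)
  then show ?thesis
    by (simp add: card_cartesian_product)
qed

end

context few_conj begin

text \<open>The set \<open>M\<close> built from the elements supplied by \<open>D\<close> has
  \<open>card Om * card Z\<close> elements, the largest size that the power map allows; this
  equality is what forces the structure.\<close>

lemma central_socle_bound:
  assumes central: "\<And>x. x \<in> G \<Longrightarrow> x ^ p = 1 \<Longrightarrow> x \<in> Z"
    and D: "\<And>z. z \<in> Z \<Longrightarrow> z \<noteq> 1 \<Longrightarrow> z ^ p = 1 \<Longrightarrow> \<exists>g\<in>G. g \<notin> Z \<and> (\<forall>x\<in>G. cm g x \<in> cyc z)"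
  shows "cov G Z (if p = 2 then 16 else p ^ 3)"
proof (cases "G \<subseteq> Z")
  case True
  then show ?thesis
    by (rule cov_triv) (use p_pos in auto)
next
  case False
  define O1 where "O1 = Om - {1}"
  have O1: "z \<in> Z" "z \<in> G" "z ^ p = 1" "z \<noteq> 1" "z \<in> Om" if "z \<in> O1" for z
    using that Z_G by (auto simp: O1_def Om_def)
  define L where "L = cyc ` O1"
  have "\<exists>a t. a \<in> G \<and> t \<in> G \<and> (\<forall>x\<in>G. cm a x \<in> l) \<and> cm a t \<noteq> 1" if "l \<in> L" for l
  proof -
    obtain z where z: "z \<in> O1" "l = cyc z"
      using \<open>l \<in> L\<close> by (auto simp: L_def)
    obtain g where g: "g \<in> G" "g \<notin> Z" "\<forall>x\<in>G. cm g x \<in> cyc z"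
      using D O1 z(1) by metis
    then obtain t where "t \<in> G" "cm g t \<noteq> 1"
      using Z_I cm_eq_one_iff by metis
    then show ?thesis
      using g z(2) by blast
  qed
  \<comment> \<open>One choice per line makes all choices commute: the commutator of
    \<open>A l\<close> and \<open>A l'\<close> lies in both lines, and distinct lines meet
    trivially.\<close>
  then obtain A T where AT: "\<And>l. l \<in> L \<Longrightarrow> A l \<in> G \<and> T l \<in> G \<and> (\<forall>x\<in>G. cm (A l) x \<in> l) \<and> cm (A l) (T l) \<noteq> 1"
    by metis
  have LZ: "c \<in> Z" "c ^ p = 1" if lc: "l \<in> L" "c \<in> l" for l c
  proof -
    obtain z where z: "z \<in> O1" "l = cyc z"
      using \<open>l \<in> L\<close> by (auto simp: L_def)
    show "c \<in> Z"
      using z lc(2) O1 cyc_Z by blast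
    show "c ^ p = 1"
      using cyc_power_one z lc(2) O1(3) by blast
  qed
  have gen: "l = cyc c" if lc: "l \<in> L" "c \<in> l" "c \<noteq> 1" for l c
  proof -
    obtain z where z: "z \<in> O1" "l = cyc z"
      using \<open>l \<in> L\<close> by (auto simp: L_def)
    have "cyc z = cyc c"
      by (rule line_eq [of _ _ c]) (use z lc O1 LZ Z_G cyc_self in auto)
    then show ?thesis using z by simp
  qed
  have Adisj: "l = l'" if "l \<in> L" "l' \<in> L" "c \<in> l" "c \<in> l'" "c \<noteq> 1" for l l' c
    using gen that by metis
  have Ainv: "inverse c \<in> l" if "l \<in> L" "c \<in> l" for l c
    using that sgp_inv [OF sgp_cyc_G [OF O1(2)]] by (auto simp: L_def)
  have AZ: "cm (A l) x \<in> Z" "cm (A l) x ^ p = 1" "cm (A l) x \<in> l" if "l \<in> L" "x \<in> G" for l x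
    using AT that LZ by blast+
  have Acomm: "A l * A l' = A l' * A l" if l: "l \<in> L" "l' \<in> L" for l l'
  proof (rule ccontr)
    assume "A l * A l' \<noteq> A l' * A l"
    then have n: "cm (A l) (A l') \<noteq> 1"
      by (simp add: cm_eq_one_iff)
    have "cm (A l') (A l) \<in> l'"
      using AT l by blast
    then have "cm (A l) (A l') \<in> l'"
      using Ainv [OF l(2)] by (metis inv_cm)
    moreover have "cm (A l) (A l') \<in> l"
      using AT l by blast
    ultimately have "l = l'"
      using Adisj n l by blast
    then show False
      using \<open>A l * A l' \<noteq> A l' * A l\<close> by simp
  qed
  have Apow: "A l ^ p \<in> Z" if "l \<in> L" for l
  proof (rule Z_I)
    fix x assume x: "x \<in> G"
    have "cm (A l ^ p) x = cm (A l) x ^ p"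
      by (rule cm_Z_power_left) (use AT AZ that x in auto)
    then show "A l ^ p * x = x * A l ^ p"
      using AZ(2) [OF that x] by (simp add: cm_eq_one_iff)
  qed (use AT that G_power in blast)
  have "\<exists>i. cm (A (cyc z)) (T (cyc z)) ^ i = z" if "z \<in> O1" for z
  proof -
    have "cyc z \<in> L"
      using that by (simp add: L_def)
    then have "z \<in> cyc (cm (A (cyc z)) (T (cyc z)))"
      using gen AT cyc_self by metis
    then obtain i where "z = cm (A (cyc z)) (T (cyc z)) ^ i"
      unfolding cyc_def [of "cm (A (cyc z)) (T (cyc z))"] by blast
    then show ?thesis by metis
  qed
  then obtain I where I: "\<And>z. z \<in> O1 \<Longrightarrow> cm (A (cyc z)) (T (cyc z)) ^ I z = z"
    by metis
  \<comment> \<open>The exponent \<open>I z\<close> makes the commutator of \<open>g z\<close> with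
    the witness \<open>T (cyc z)\<close> equal to \<open>z\<close>, so \<open>z\<close> can be
    recovered from the coset of \<open>g z\<close> modulo \<open>Z\<close>. The value at 1 is set by
    hand because 1 spans no line.\<close>
  define g where "g z = (if z = 1 then 1 else A (cyc z) ^ I z)" for z
  have gcm: "cm (g z) x = cm (A (cyc z)) x ^ I z" if "z \<in> O1" "x \<in> G" for z x
    unfolding g_def using that O1 AT AZ
    by (simp add: L_def cm_Z_power_left)
  have gG: "g z \<in> G" if "z \<in> Om" for z
    using that AT G_power G_one by (auto simp: g_def O1_def L_def)
  have gcyc: "cm (g z) x \<in> cyc z" if "z \<in> Om" "x \<in> G" for z x
  proof (cases "z = 1")
    case True
    then show ?thesis
      using power_cyc [of 1 0] by (simp add: g_def)
  next
    case False
    then have "z \<in> O1" using that by (simp add: O1_def)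
    moreover have "cm (A (cyc z)) x ^ I z \<in> cyc z"
      by (rule sgp_power [OF sgp_cyc_G]) (use AT that \<open>z \<in> O1\<close> O1 in \<open>auto simp: L_def\<close>)
    ultimately show ?thesis
      using gcm that by simp
  qed
  have gT: "cm (g z) (T (cyc z)) = z" if "z \<in> O1" for z
    using that gcm I AT by (simp add: L_def)
  define M where "M = (\<lambda>(z, \<zeta>). g z * \<zeta>) ` (Om \<times> Z)"
  have cmM: "cm (g z * \<zeta>) x = cm (g z) x" if "\<zeta> \<in> Z" "x \<in> G" "z \<in> Om" for z \<zeta> x
  proof -
    have "cm (\<zeta>) x = 1"
      using that Z_commute by (simp add: cm_eq_one_iff)
    moreover have "cm (g z) x \<in> Z"
      using gcyc that cyc_Z by (auto simp: Om_def)
    ultimately show ?thesis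
      using cm_Z_left that Z_G by simp
  qed
  have Om1: "1 \<in> Om"
    using sgp_one [OF sgp_Z] by (simp add: Om_def)
  have inj: "inj_on (\<lambda>(z, \<zeta>). g z * \<zeta>) (Om \<times> Z)"
  proof -
    have key: "z = z'" if z: "z \<in> Om" "z' \<in> Om" "\<zeta> \<in> Z" "\<zeta>' \<in> Z" "g z * \<zeta> = g z' * \<zeta>'" "z \<noteq> 1"
      for z z' \<zeta> \<zeta>'
    proof -
      have c: "cm (g z) x = cm (g z') x" if "x \<in> G" for x
        using cmM z that by metis
      have zO: "z \<in> O1" using z by (simp add: O1_def)
      then have T: "T (cyc z) \<in> G"
        using AT by (simp add: L_def)
      have "z \<in> cyc z'"
        using gT [OF zO] c [OF T] gcyc [OF z(2) T] by simp
      then have "cyc z = cyc z'"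
        by (intro line_eq [of z z' z]) (use z zO O1 Z_G cyc_self in \<open>auto simp: Om_def\<close>)
      moreover have "z' \<noteq> 1"
        using \<open>z \<in> cyc z'\<close> z(6) by (auto simp: cyc_def)
      ultimately have "cm (g z') (T (cyc z)) = z'"
        using gT [of z'] z(2) by (simp add: O1_def)
      then show ?thesis
        using gT [OF zO] c [OF T] by simp
    qed
    show ?thesis
    proof (rule inj_onI, clarify)
      fix z \<zeta> z' \<zeta>' assume a: "z \<in> Om" "\<zeta> \<in> Z" "z' \<in> Om" "\<zeta>' \<in> Z" "g z * \<zeta> = g z' * \<zeta>'"
      have "z = z'"
        using key [of z z' \<zeta> \<zeta>'] key [of z' z \<zeta>' \<zeta>] a by metis
      then show "z = z' \<and> \<zeta> = \<zeta>'"
        using a(5) by simp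
    qed
  qed
  have finO: "finite Om" "finite Z"
    using fin_G by (auto simp: Om_def Z_def)
  have cardM: "card M = card Om * card Z"
    unfolding M_def using inj by (simp add: card_image card_cartesian_product)
  define S0 where "S0 = Z \<union> A ` L"
  have S0G: "S0 \<subseteq> G"
    using AT Z_G by (auto simp: S0_def)
  define U where "U S = {u \<in> G. u \<in> centr (centr S) \<and> u ^ p \<in> Z}" for S
  \<comment> \<open>Since \<open>M\<close> lies in \<open>U S\<close> and the power map bounds
    \<open>U S\<close> by the size of \<open>M\<close>, both agree. A general \<open>S\<close> is
    allowed so that one more element can be adjoined later: whatever commutes with \<open>S0\<close>
    and has its \<open>p\<close>-th power in \<open>Z\<close> lies in \<open>M\<close>.\<close>
  have key: "S \<subseteq> M" "U S = M" "sgp M" "\<And>x y. x \<in> M \<Longrightarrow> y \<in> M \<Longrightarrow> x * y = y * x" "(\<lambda>u. u ^ p) ` M = Z"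
    if S: "S0 \<subseteq> S" "S \<subseteq> G" "\<And>s. s \<in> S \<Longrightarrow> s ^ p \<in> Z" "\<And>x y. x \<in> S \<Longrightarrow> y \<in> S \<Longrightarrow> x * y = y * x" for S
  proof -
    have ab: "x * y = y * x" if "x \<in> U S" "y \<in> U S" for x y
      using commuting_closure(2) [of S] S(4) that by (simp add: U_def)
    have sub: "sgp (U S)"
      unfolding sgp_def
    proof (intro conjI ballI)
      show "1 \<in> U S"
        using sgp_one [OF sgp_G] sgp_one [OF sgp_Z] sgp_one [OF sgp_centr] by (simp add: U_def)
      show "x * y \<in> U S" if "x \<in> U S" "y \<in> U S" for x y
        using that sgp_mult [OF sgp_G, of x y] sgp_mult [OF sgp_centr, of x "centr S" y]
          sgp_mult [OF sgp_Z, of "x ^ p" "y ^ p"] power_mult_commute [OF ab [OF that]]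
        by (simp add: U_def)
      show "inverse x \<in> U S" if "x \<in> U S" for x
        using that sgp_inv [OF sgp_G, of x] sgp_inv [OF sgp_centr, of x "centr S"]
          sgp_inv [OF sgp_Z, of "x ^ p"]
        by (simp add: U_def flip: inv_power)
    qed
    have SU: "S \<subseteq> U S"
      using commuting_closure(1) [of S] S by (auto simp: U_def)
    have MU: "M \<subseteq> U S"
    proof
      fix m assume "m \<in> M"
      then obtain z \<zeta> where m: "z \<in> Om" "\<zeta> \<in> Z" "m = g z * \<zeta>"
        by (auto simp: M_def)
      have "\<zeta> \<in> U S"
        using m SU S by (auto simp: S0_def)
      moreover have "g z \<in> U S"
      proof (cases "z = 1")
        case False
        then have "A (cyc z) \<in> S0"
          using m by (auto simp: S0_def L_def O1_def)
        then show ?thesis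
          using SU S(1) sub False by (auto simp: g_def intro: sgp_power)
      qed (use sub sgp_one in \<open>auto simp: g_def\<close>)
      ultimately show "m \<in> U S"
        using m sub sgp_mult by blast
    qed
    have imZ: "(\<lambda>u. u ^ p) ` U S \<subseteq> Z"
      by (auto simp: U_def)
    have le: "card (U S) \<le> card Om * card ((\<lambda>u. u ^ p) ` U S)"
      by (rule card_le_power_image) (use sub ab central in \<open>auto simp: U_def\<close>)
    moreover have "card ((\<lambda>u. u ^ p) ` U S) \<le> card Z"
      using imZ finO by (simp add: card_mono)
    ultimately have "card (U S) \<le> card M"
      unfolding cardM by (meson le_trans mult_le_mono2)
    moreover have "finite (U S)"
      using fin_G by (simp add: U_def)
    ultimately show US: "U S = M"
      using MU by (metis card_seteq)
    show "S \<subseteq> M" "sgp M" "\<And>x y. x \<in> M \<Longrightarrow> y \<in> M \<Longrightarrow> x * y = y * x"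
      using US SU sub ab by auto
    have "card Om * card Z \<le> card Om * card ((\<lambda>u. u ^ p) ` M)"
      using le US cardM by simp
    moreover have "0 < card Om"
      using Om1 finO by (auto simp: card_gt_0_iff)
    ultimately have "card Z \<le> card ((\<lambda>u. u ^ p) ` M)"
      by simp
    then show "(\<lambda>u. u ^ p) ` M = Z"
      using imZ US finO by (metis card_seteq)
  qed
  have S0p: "s ^ p \<in> Z" if "s \<in> S0" for s
    using that Apow sgp_power [OF sgp_Z] by (auto simp: S0_def)
  have ZA: "A l * z = z * A l" if "z \<in> Z" "l \<in> L" for z l
    using Z_commute [OF that(1)] AT [OF that(2)] by metis
  have S0c: "x * y = y * x" if "x \<in> S0" "y \<in> S0" for x y
    using that unfolding S0_def by (elim UnE imageE) (simp_all add: Acomm ZA Z_commute Z_G)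
  note M0 = key [OF subset_refl S0G S0p S0c]
  have Mcm: "\<exists>z\<in>Om. \<forall>x\<in>G. cm u x \<in> cyc z" if u: "u \<in> M" for u
  proof -
    obtain z \<zeta> where m: "z \<in> Om" "\<zeta> \<in> Z" "u = g z * \<zeta>"
      using u by (auto simp: M_def)
    have "cm u x \<in> cyc z" if "x \<in> G" for x
      using gcyc [OF m(1) that] cmM [OF m(2) that m(1)] m(3) by simp
    then show ?thesis
      using m(1) by blast
  qed
  have MG: "M \<subseteq> G"
    using gG Z_G G_mult by (auto simp: M_def)
  obtain g0 where g0: "g0 \<in> G" "g0 \<notin> Z"
    using False by blast
  then have "g0 \<noteq> 1"
    using sgp_one [OF sgp_Z] by blast
  then have "g0 ^ p ^ (ht g0 - 1) \<in> O1"
    using bottom [OF g0(1)] central [of "g0 ^ p ^ (ht g0 - 1)"] G_power [OF g0(1)]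
    by (simp add: O1_def Om_def)
  then obtain l0 where l0: "l0 \<in> L"
    by (auto simp: L_def)
  define a0 where "a0 = A l0"
  have a0: "a0 \<in> G" "a0 \<in> M" "\<And>x. x \<in> G \<Longrightarrow> cm a0 x \<in> Z" "\<And>x. x \<in> G \<Longrightarrow> cm a0 x \<in> l0"
    using AT AZ l0 M0(1) by (auto simp: a0_def S0_def)
  have a0_mult: "cm a0 (x * y) = cm a0 x * cm a0 y" if "x \<in> G" "y \<in> G" for x y
    by (rule cm_Z_right) (use a0 that G_cm in auto)
  have a0_power: "cm a0 (x ^ i) = cm a0 x ^ i" if "x \<in> G" for x i
    by (rule cm_Z_power_right) (use a0 that in auto)
  define C where "C = G \<inter> centr {a0}"
  have C: "x \<in> C \<longleftrightarrow> x \<in> G \<and> cm a0 x = 1" for x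
    by (auto simp: C_def centr_def cm_eq_one_iff)
  have sgpC: "sgp C"
    unfolding C_def by (rule sgp_Int [OF sgp_G sgp_centr])
  \<comment> \<open>All commutators of the element \<open>a0 * A l\<close> of \<open>M\<close> lie
    in one line. An \<open>x\<close> commuting with \<open>a0\<close> but not with
    \<open>A l\<close> would make this line \<open>l\<close>, while some \<open>y\<close> commuting
    with \<open>A l\<close> but not with \<open>a0\<close> makes it \<open>l0\<close>.\<close>
  have CA: "x * A l = A l * x" if x: "x \<in> C" and l: "l \<in> L" for x l
  proof (rule ccontr)
    assume nc: "x * A l \<noteq> A l * x"
    have xG: "x \<in> G" and x0: "cm a0 x = 1"
      using x C by auto
    define d where "d = cm (A l) x"
    have d: "d \<noteq> 1" "d \<in> l" "d \<in> Z"
      using nc AZ [OF l xG] unfolding d_def by (auto simp: cm_eq_one_iff)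
    define y0 where "y0 = T l0"
    have y0: "y0 \<in> G" "cm a0 y0 \<noteq> 1"
      using AT [OF l0] by (auto simp: y0_def a0_def)
    have "inverse (cm (A l) y0) \<in> cyc d"
      using gen [OF l d(2,1)] AZ(3) [OF l y0(1)] Ainv [OF l] by blast
    then obtain i where i: "inverse (cm (A l) y0) = d ^ i"
      by (auto simp: cyc_def)
    \<comment> \<open>The power of \<open>x\<close> cancels the commutator of \<open>y0\<close> with
      \<open>A l\<close> and leaves that with \<open>a0\<close> unchanged.\<close>
    define y where "y = y0 * x ^ i"
    have yG: "y \<in> G" using y0 xG G_mult G_power by (simp add: y_def)
    have "cm (A l) y = cm (A l) y0 * cm (A l) (x ^ i)"
      unfolding y_def by (rule cm_Z_right) (use AZ AT l y0 xG G_power G_cm in auto)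
    also have "cm (A l) (x ^ i) = d ^ i"
      unfolding d_def by (rule cm_Z_power_right) (use AZ AT l xG in auto)
    finally have y1: "cm (A l) y = 1"
      using i by (metis right_inv)
    have y2: "cm a0 y \<noteq> 1"
      using y0 xG x0 G_power by (simp add: y_def a0_mult a0_power)
    have "a0 * A l \<in> M"
      using M0(1) l sgp_mult [OF M0(3) a0(2), of "A l"] by (auto simp: S0_def)
    then obtain z where z: "z \<in> Om" "\<And>x. x \<in> G \<Longrightarrow> cm (a0 * A l) x \<in> cyc z"
      using Mcm by blast
    have c: "cm (a0 * A l) x = cm a0 x * cm (A l) x" if "x \<in> G" for x
      by (rule cm_Z_left) (use a0 AT l that in auto)
    have "d \<in> cyc z" "cm a0 y \<in> cyc z"
      using z(2) [OF xG] z(2) [OF yG] c [OF xG] c [OF yG] x0 y1 by (simp_all add: d_def)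
    have "z \<noteq> 1"
      using \<open>d \<in> cyc z\<close> d(1) by (auto simp: cyc_def)
    then have zL: "cyc z \<in> L"
      using z(1) by (simp add: O1_def L_def)
    have "cyc z = l"
      by (rule Adisj [OF zL l \<open>d \<in> cyc z\<close> d(2,1)])
    moreover have "cyc z = l0"
      by (rule Adisj [OF zL l0 \<open>cm a0 y \<in> cyc z\<close> a0(4) [OF yG] y2])
    ultimately have "l = l0" by simp
    then show False
      using x nc C by (simp add: a0_def cm_eq_one_iff)
  qed
  have CM: "x * u = u * x" if "x \<in> C" "u \<in> M" for x u
  proof -
    obtain z \<zeta> where m: "z \<in> Om" "\<zeta> \<in> Z" "u = g z * \<zeta>"
      using \<open>u \<in> M\<close> by (auto simp: M_def)
    have "x \<in> G" using that C by blast
    have "A (cyc z) * x = x * A (cyc z)" if "z \<noteq> 1"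
      using CA [OF \<open>x \<in> C\<close>] that m by (simp add: L_def O1_def)
    then have "g z * x = x * g z"
      by (simp add: g_def commute_power)
    moreover have "\<zeta> * x = x * \<zeta>"
      using Z_commute m \<open>x \<in> G\<close> by blast
    ultimately show ?thesis
      using commute_mult m(3) by metis
  qed
  have cover: "\<exists>i<p. t ^ i * y \<in> C" if t: "t \<in> G" "t \<notin> C" and y: "y \<in> G" for t y
  proof -
    have d: "cm a0 t \<noteq> 1" "cm a0 t \<in> l0" "cm a0 t ^ p = 1"
      using t C a0 AZ(2) [OF l0] by (auto simp: a0_def)
    have "inverse (cm a0 y) \<in> cyc (cm a0 t)"
      using gen [OF l0 d(2,1)] a0(4) [OF y] Ainv [OF l0] by blast
    then obtain k where k: "inverse (cm a0 y) = cm a0 t ^ k"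
      by (auto simp: cyc_def)
    have "cm a0 t ^ k = cm a0 t ^ (p * (k div p)) * cm a0 t ^ (k mod p)"
      by (simp flip: power_add)
    then have k': "cm a0 t ^ (k mod p) = inverse (cm a0 y)"
      using d(3) k by (simp add: power_mult)
    have "cm a0 (t ^ (k mod p) * y) = 1"
      using t y k' G_power by (simp add: a0_mult a0_power)
    then have "t ^ (k mod p) * y \<in> C"
      using C t y G_mult G_power by simp
    then show ?thesis
      using p_pos by (intro exI [of _ "k mod p"]) simp
  qed
  have MZ: "u \<in> Z" if "u \<in> M" "t \<in> G" "t \<notin> C" "u * t = t * u" for u t
  proof (rule center_by_cover [of u t C])
    show "\<exists>i. t ^ i * y \<in> C" if "y \<in> G" for y
      using cover [OF \<open>t \<in> G\<close> \<open>t \<notin> C\<close> that] by blast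
    show "u * c = c * u" if "c \<in> C" for c
      using CM [OF that \<open>u \<in> M\<close>] by simp
  qed (use that MG in auto)
  have vM: "v \<in> M" if v: "v \<in> C" "v ^ p \<in> Z" for v
  proof -
    have vG: "v \<in> G" using v C by blast
    have vs: "v * s = s * v" if "s \<in> S0" for s
      using that CA [OF v(1)] Z_commute [of s v] vG by (auto simp: S0_def)
    have "insert v S0 \<subseteq> M"
      by (rule key(1)) (use S0G S0p S0c vG v vs in auto)
    then show ?thesis by simp
  qed
  have MC: "M \<subseteq> C"
    using M0(4) a0(2) MG C by (auto simp: cm_eq_one_iff)
  have pC: "t ^ p \<in> C" if "t \<in> G" for t
  proof -
    have "cm a0 (t ^ p) = cm a0 t ^ p"
      using that by (rule a0_power)
    then show ?thesis
      using AZ(2) [OF l0 that] C that G_power by (simp add: a0_def)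
  qed
  \<comment> \<open>If \<open>t ^ p\<close> were not yet central, the last noncentral element
    \<open>v\<close> among the iterated \<open>p\<close>-th powers of \<open>t\<close> would lie in
    \<open>M\<close> by \<open>vM\<close> and commute with \<open>t\<close>, hence be central by
    \<open>MZ\<close>.\<close>
  have tpZ: "t ^ p \<in> Z" if t: "t \<in> G" "t \<notin> C" for t
  proof -
    define k where "k = (LEAST k. t ^ p ^ k \<in> Z)"
    have "t ^ p ^ ht t \<in> Z"
      using power_ht t sgp_one [OF sgp_Z] by simp
    then have kZ: "t ^ p ^ k \<in> Z"
      unfolding k_def by (rule LeastI)
    have kmin: "t ^ p ^ j \<notin> Z" if "j < k" for j
      using not_less_Least that unfolding k_def by blast
    have "t \<notin> Z"
      using t C a0 Z_commute [of t a0] by (auto simp: cm_eq_one_iff)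
    then have k0: "k \<noteq> 0"
      using kZ by (metis power_0 power_one_right)
    show ?thesis
    proof (cases "k = 1")
      case False
      then obtain j where j: "k = Suc (Suc j)"
        using k0 by (metis One_nat_def not0_implies_Suc)
      define v where "v = t ^ p ^ Suc j"
      have "v = (t ^ p ^ j) ^ p"
        by (simp add: v_def mult.commute flip: power_mult)
      then have "v \<in> C"
        using pC G_power t by simp
      moreover have "v ^ p = t ^ p ^ k"
        by (simp add: v_def j mult.commute mult.left_commute flip: power_mult)
      ultimately have "v \<in> M"
        using vM kZ by simp
      moreover have "v * t = t * v"
        by (simp add: v_def power_commutes)
      ultimately have "v \<in> Z"
        using MZ t by blast
      then show ?thesis
        using kmin [of "Suc j"] j by (simp add: v_def)
    qed (use kZ in simp)
  qed
  define t where "t = T l0"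
  have t: "t \<in> G" "t \<notin> C"
    using AT [OF l0] C by (auto simp: t_def a0_def)
  show ?thesis
  proof (cases "p = 2")
    case False
    \<comment> \<open>The powers of \<open>M\<close> fill \<open>Z\<close>, so some \<open>u\<close>
      in \<open>M\<close> cancels \<open>t ^ p\<close>; for odd \<open>p\<close> the commutator term
      vanishes and \<open>t * u\<close> has order dividing \<open>p\<close>.\<close>
    have "inverse (t ^ p) \<in> Z"
      using tpZ [OF t] sgp_inv [OF sgp_Z] by blast
    then obtain u where u: "u \<in> M" "u ^ p = inverse (t ^ p)"
      using M0(5) by (metis imageE)
    obtain z where z: "z \<in> Om" "\<And>x. x \<in> G \<Longrightarrow> cm u x \<in> cyc z"
      using Mcm u by blast
    define c where "c = cm u t"
    have c: "c \<in> Z" "c ^ p = 1"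
    proof -
      show "c \<in> Z" using z t cyc_Z by (auto simp: c_def Om_def)
      show "c ^ p = 1"
        using z t cyc_power_one by (auto simp: c_def Om_def)
    qed
    have "u * t = t * u * c"
      by (simp add: c_def mult_cm)
    then have "(t * u) ^ p = t ^ p * u ^ p * c ^ (p choose 2)"
      by (rule class2_power) (use c Z_commute t u MG in auto)
    moreover have "c ^ (p choose 2) = 1"
      using p_dvd_choose_two [OF prime_p, of 1] False c(2) by (auto simp: power_mult elim!: dvdE)
    ultimately have "(t * u) ^ p = 1"
      using u by simp
    then have "t * u \<in> Z"
      using central t u MG G_mult by blast
    then have "t * u \<in> C"
      using C Z_G Z_commute [of "t * u" a0] a0 by (auto simp: cm_eq_one_iff)
    then have "t \<in> C"
      using sgp_mult_right [OF sgpC, of u t] u MC by auto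
    then show ?thesis
      using t by blast
  next
    case True
    define N where "N = {x. nz x (cyc t)}"
    have cyt: "sgp (cyc t)" "cyc t \<subseteq> G"
      using t sgp_cyc_G cyc_G by auto
    have 1: "cov G C p"
      by (rule covI_power) (rule cover [OF t])
    have 2: "cov C (C \<inter> N) p"
      unfolding N_def by (rule cov_nz) (use cyt sgpC C in auto)
    \<comment> \<open>For such \<open>v\<close> the commutator \<open>e\<close> is a power of
      \<open>t\<close> commuting with \<open>a0\<close>, hence an even power and central. Squares of
      elements outside \<open>C\<close> are central, and comparing those of \<open>t\<close> and
      \<open>t * v\<close> puts \<open>v ^ 2\<close> into \<open>Z\<close>.\<close>
    have CN: "C \<inter> N \<subseteq> M"
    proof
      fix v assume v: "v \<in> C \<inter> N"
      then have vG: "v \<in> G" using C by blast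
      define e where "e = cm t v"
      have "inverse v * t * v \<in> cyc t"
        using v nzD cyc_self unfolding N_def by blast
      then have "e \<in> cyc t"
        using sgp_mult_left [OF cyt(1) cyc_self] by (simp add: e_def conj_eq_cm)
      then obtain k where k: "e = t ^ k"
        by (auto simp: cyc_def)
      have "cm a0 e = 1"
      proof -
        have "inverse v \<in> G" "cm a0 (inverse v) = 1" "cm a0 v = 1"
          using v C sgp_inv [OF sgpC] by blast+
        then have "cm a0 (inverse v * t * v) = cm a0 t"
          using vG t G_mult by (simp add: a0_mult)
        then have "cm a0 (t * e) = cm a0 t"
          by (simp add: conj_eq_cm e_def)
        moreover have "cm a0 (t * e) = cm a0 t * cm a0 e"
          using a0_mult t G_cm vG by (auto simp: e_def)
        ultimately show ?thesis
          by (metis left_cancel mult.right_neutral)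
      qed
      then have "cm a0 t ^ k = 1"
        using a0_power t k by simp
      then have "2 dvd k"
        using order_p_dvd [of "cm a0 t" k] t C a0 Z_G True by auto
      then have "e \<in> Z"
        using k tpZ [OF t] True sgp_power [OF sgp_Z] by (auto simp: power_mult elim!: dvdE)
      have tv: "t * v \<in> G" "t * v \<notin> C"
        using t vG v G_mult sgp_mult_right [OF sgpC, of v t] by auto
      then have "(t * v) ^ 2 \<in> Z"
        using tpZ True by simp
      moreover have "(t * v) ^ 2 = t ^ 2 * v ^ 2 * inverse e"
      proof -
        have "t * v = v * t * e"
          by (simp add: e_def mult_cm)
        then have "v * t = t * v * inverse e"
          by (simp add: mult.assoc)
        then have "t * (v * t) * v = t * t * v * (inverse e * v)"
          by (simp add: mult.assoc)
        also have "inverse e * v = v * inverse e"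
          using \<open>e \<in> Z\<close> vG Z_commute commute_inv by blast
        finally show ?thesis
          by (simp add: power2_eq_square mult.assoc)
      qed
      moreover have "t ^ 2 \<in> Z"
        using tpZ [OF t] True by simp
      ultimately have "v ^ 2 \<in> Z"
        using \<open>e \<in> Z\<close> sgp_mult_left [OF sgp_Z] sgp_mult_right [OF sgp_Z] sgp_inv [OF sgp_Z] by metis
      then show "v \<in> M"
        using vM v True by simp
    qed
    have 3: "cov M (M \<inter> N) p"
      unfolding N_def by (rule cov_nz) (use cyt M0 MG in auto)
    have 4: "cov (M \<inter> N) Z p"
    proof (rule cov_commuting [of _ t])
      show "sgp (M \<inter> N)"
        unfolding N_def by (rule sgp_Int [OF M0(3) sgp_nz])
      fix c assume c: "c \<in> M \<inter> N"
      obtain z where z: "z \<in> Om" "\<And>x. x \<in> G \<Longrightarrow> cm c x \<in> cyc z"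
        using Mcm c by blast
      show "cm t c ^ p = 1"
      proof -
        have "cm c t ^ p = 1"
          using z t cyc_power_one by (auto simp: Om_def)
        then show ?thesis
          by (metis inv_cm inv_one inv_power)
      qed
      show "c \<in> Z" if "c * t = t * c"
        using MZ c t that by blast
    qed (use MG N_def t in auto)
    have "cov C Z (p * (p * p))"
      using cov_trans [OF 2 cov_mono [OF cov_trans [OF 3 4] CN subset_refl order_refl]] .
    then have "cov G Z (p * (p * (p * p)))"
      using cov_trans [OF 1] by blast
    then show ?thesis
      using True by simp
  qed
qed

end

context pgrp begin

lemma pgrp_subgroup: "sgp H \<Longrightarrow> H \<subseteq> G \<Longrightarrow> pgrp H p n"
  using prime_p fin_G exp_G by unfold_locales (auto intro: finite_subset)

end

section \<open>A noncentral element of order \<open>p\<close>\<close>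

context few_conj begin

lemma centr_order_p:
  assumes h: "h \<in> G" "h ^ p = 1" and x: "x \<in> G"
  shows "nz x (cyc h) \<longleftrightarrow> x * h = h * x"
proof
  assume "x * h = h * x"
  then have "h * x = x * h" by simp
  then have "x * a = a * x" if "a \<in> cyc h" for a
    using cyc_commute [OF that] by simp
  then show "nz x (cyc h)"
    by (rule nz_centr)
qed (use nz_order_p assms in blast)

text \<open>A commutator normalises \<open>cyc h\<close>, hence centralises \<open>h\<close>. This
  makes the centraliser of \<open>h\<close> normal in \<open>G\<close>, so it centralises every
  conjugate of \<open>h\<close> as well.\<close>

lemma centr_order_p_normal:
  assumes h: "h \<in> G" "h ^ p = 1" and c: "c \<in> G" "c * h = h * c" and y: "y \<in> G"
  shows "cm c y * h = h * cm c y"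
    and "(inverse y * c * y) * h = h * (inverse y * c * y)"
    and "c * (inverse y * h * y) = (inverse y * h * y) * c"
proof -
  have k: "cm c y * h = h * cm c y" if "y \<in> G" for y
    using P2 [OF sgp_cyc_G cyc_G, of h c y] centr_order_p [OF h] h c that G_cm by blast
  have k2: "(inverse y * c * y) * h = h * (inverse y * c * y)" if "y \<in> G" for y
    unfolding conj_eq_cm using c k [OF that] by (rule_tac commute_mult)
  show "cm c y * h = h * cm c y" "(inverse y * c * y) * h = h * (inverse y * c * y)"
    using k k2 y by auto
  have "(y * c * inverse y) * h = h * (y * c * inverse y)"
    using k2 [of "inverse y"] G_inv [OF y] by simp
  then have "inverse y * ((y * c * inverse y) * h) * y = inverse y * (h * (y * c * inverse y)) * y"
    by simp
  then show "c * (inverse y * h * y) = (inverse y * h * y) * c"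
    by (simp add: mult.assoc)
qed

lemma centr_order_p_cover:
  assumes h: "h \<in> G" "h ^ p = 1" and t: "t \<in> G" "t * h \<noteq> h * t" and y: "y \<in> G"
  shows "\<exists>i<p. t ^ i * y \<in> G \<inter> centr {h}"
proof -
  obtain i where i: "i < p" "nz (t ^ i * y) (cyc h)"
    using P3 [OF sgp_cyc_G cyc_G, of h t y] centr_order_p [OF h] h t y by blast
  moreover have "t ^ i * y \<in> G"
    using t y G_power G_mult by blast
  ultimately show ?thesis
    using centr_order_p [OF h] by (auto simp: centr_def)
qed

text \<open>The commutator \<open>cm h t\<close> need not be central, but a second commutator with \<open>t\<close> is:
  \<open>cm h t\<close> normalises \<open>cyc t\<close>.\<close>

lemma central_commutator:
  assumes h0: "h0 \<in> G" "h0 ^ p = 1" "h0 \<notin> Z"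
  obtains h t where "h \<in> G" "h ^ p = 1" "t \<in> G" "cm h t \<in> Z" "cm h t \<noteq> 1"
proof -
  obtain t where t: "t \<in> G" "t * h0 \<noteq> h0 * t"
    using h0 Z_I by metis
  define z where "z = cm h0 t"
  define C where "C = G \<inter> centr {h0}"
  note cover = centr_order_p_cover [OF h0(1,2) t, folded C_def]
  have cover': "\<exists>i. t ^ i * y \<in> C" if "y \<in> G" for y
    using cover [OF that] by blast
  have C: "c \<in> C \<longleftrightarrow> c \<in> G \<and> c * h0 = h0 * c" for c
    by (auto simp: C_def centr_def)
  have zG: "z \<in> G"
    unfolding z_def using h0 t G_cm by blast
  \<comment> \<open>\<open>z\<close> is a quotient of two conjugates of \<open>h0\<close>, and
    \<open>C\<close> centralises both.\<close>
  have zC: "c * z = z * c" if "c \<in> C" for c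
  proof -
    have "z = inverse h0 * (inverse t * h0 * t)"
      by (simp add: z_def cm_def mult.assoc)
    moreover have "(inverse t * h0 * t) * c = c * (inverse t * h0 * t)"
      using centr_order_p_normal(3) [OF h0(1,2)] that C t(1) by simp
    moreover have "inverse h0 * c = c * inverse h0"
      using commute_inv [of h0 c] that C by metis
    ultimately show ?thesis
      using commute_mult by metis
  qed
  have zp: "z ^ p = 1"
  proof -
    have "h0 * z = z * h0"
      using zC [of h0] h0 C by simp
    then have "(h0 * z) ^ p = h0 ^ p * z ^ p"
      by (rule power_mult_commute)
    moreover have "(h0 * z) ^ p = inverse t * h0 ^ p * t"
      unfolding z_def conj_eq_cm [symmetric] by (rule conj_power)
    ultimately show ?thesis
      using h0 by simp
  qed
  have z1: "z \<noteq> 1"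
    using t by (metis cm_eq_one_iff z_def)
  show ?thesis
  proof (cases "z \<in> Z")
    case True
    then show ?thesis
      using that [of h0 t] h0 t z1 unfolding z_def by blast
  next
    case False
    have nt: "t * z \<noteq> z * t"
    proof
      assume "t * z = z * t"
      then have "z \<in> Z"
        using center_by_cover [OF zG _ _ cover'] zC by simp
      then show False using False by blast
    qed
    define y where "y = cm z t"
    have "nz z (cyc t)"
      unfolding z_def using P2 [OF sgp_cyc_G cyc_G] h0 t by blast
    then have "inverse z * t * z \<in> cyc t"
      using nzD cyc_self by blast
    then have "inverse (inverse z * t * z) * t \<in> cyc t"
      using sgp_cyc_G [OF t(1)] sgp_mult sgp_inv cyc_self by metis
    then have "y \<in> cyc t"
      by (simp add: y_def cm_def mult.assoc)
    then have yt: "y * t = t * y"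
      using cyc_commute by blast
    \<comment> \<open>\<open>y\<close> is a quotient of two conjugates of \<open>z\<close>; the
      normal subgroup \<open>C\<close> centralises \<open>z\<close> and therefore its
      conjugates.\<close>
    have "y * c = c * y" if "c \<in> C" for c
    proof -
      have "inverse z * c = c * inverse z"
        using zC [OF that] commute_inv by metis
      moreover have "(inverse t * z * t) * c = c * (inverse t * z * t)"
      proof -
        have "inverse (inverse t) * c * inverse t \<in> C"
          using centr_order_p_normal(2) [OF h0(1,2), of c "inverse t"] that C t(1) G_inv G_mult by auto
        then have "(t * c * inverse t) * z = z * (t * c * inverse t)"
          using zC by simp
        then have "inverse t * ((t * c * inverse t) * z) * t = inverse t * (z * (t * c * inverse t)) * t"
          by simp
        then show ?thesis
          by (simp add: mult.assoc)
      qed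
      moreover have "y = inverse z * (inverse t * z * t)"
        by (simp add: y_def cm_def mult.assoc)
      ultimately show ?thesis
        using commute_mult by metis
    qed
    then have "y \<in> Z"
      using center_by_cover [OF _ yt _ cover'] G_cm [OF zG t(1)] by (simp add: y_def)
    moreover have "y \<noteq> 1"
      using nt by (metis cm_eq_one_iff y_def)
    ultimately show ?thesis
      using that [of z t] zG zp t unfolding y_def by blast
  qed
qed

end

section \<open>The centraliser C of h and its subgroups avoiding z\<close>

locale socle = few_conj +
  fixes h t
  assumes h: "h \<in> G" "h ^ p = 1" and t: "t \<in> G"
    and zZ: "cm h t \<in> Z" and z1: "cm h t \<noteq> 1"
begin

definition z where "z = cm h t"

definition C where "C = G \<inter> centr {h}"

lemma z: "z \<in> Z" "z \<noteq> 1" "z \<in> G" "z ^ p = 1"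
proof -
  show "z \<in> Z" "z \<noteq> 1" "z \<in> G"
    using zZ z1 Z_G by (auto simp: z_def)
  have "cm (h ^ p) t = z ^ p"
    unfolding z_def by (rule cm_Z_power_left) (use h t zZ in auto)
  then show "z ^ p = 1"
    using h by simp
qed

lemma C_iff: "c \<in> C \<longleftrightarrow> c \<in> G \<and> c * h = h * c"
  by (auto simp: C_def centr_def)

lemma CG: "C \<subseteq> G"
  by (auto simp: C_def)

lemma sgp_C: "sgp C"
  unfolding C_def by (rule sgp_Int [OF sgp_G sgp_centr])

lemma C_mem: "h \<in> C" "z \<in> C" "t \<notin> C" "Z \<subseteq> C"
  using h z Z_commute z1 Z_G by (auto simp: C_iff z_def cm_eq_one_iff)

lemma cover: "x \<in> G \<Longrightarrow> x \<notin> C \<Longrightarrow> y \<in> G \<Longrightarrow> \<exists>i<p. x ^ i * y \<in> C"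
  using centr_order_p_cover [OF h, of x y] by (auto simp: C_def centr_def)

lemma cm_C: "x \<in> G \<Longrightarrow> y \<in> G \<Longrightarrow> cm x y \<in> C"
  using P2 [OF sgp_cyc_G cyc_G, of h x y] centr_order_p [OF h] G_cm h C_iff by blast

lemma p_power_C: "x \<in> G \<Longrightarrow> x ^ p \<in> C"
  using P1 [OF sgp_cyc_G cyc_G, of h x] centr_order_p [OF h] G_power h C_iff by blast

lemma nz_C: "y \<in> G \<Longrightarrow> nz y C"
  unfolding nz_def conj_eq_cm
  using centr_order_p_normal(2) [OF h, of _ y] centr_order_p_normal(2) [OF h, of _ "inverse y"]
  by (auto simp: C_iff G_mult G_inv conj_eq_cm [symmetric])

lemma h_conj: "c \<in> C \<Longrightarrow> inverse (c * t) * h * (c * t) = h * z"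
  by (simp add: C_iff mult.assoc z_def cm_def) (metis left_inv_assoc mult.assoc)

text \<open>\<open>h\<close> and \<open>z\<close> span an elementary abelian group of rank 2 whose
  lines are generated by \<open>z\<close> and by the elements \<open>h * z ^ k\<close>; a subgroup
  containing none of these generators meets it trivially.\<close>

lemma socle_root:
  assumes S: "sgp S" "z \<notin> S" "\<And>k. h * z ^ k \<notin> S" and m: "h ^ m * z ^ l \<in> S"
  shows "p dvd m" "p dvd l"
proof -
  have hz: "h * z = z * h"
    using Z_commute z h by metis
  have h1: "h \<noteq> 1"
    using z1 by auto
  show pm: "p dvd m"
  proof (rule ccontr)
    assume "\<not> p dvd m"
    then obtain j where j: "(h ^ m) ^ j = h"
      using coprime_root h(1) by blast
    have "(h ^ m * z ^ l) ^ j = (h ^ m) ^ j * (z ^ l) ^ j"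
      by (rule power_mult_commute) (rule commute_power2 [OF hz])
    then have "h * z ^ (l * j) \<in> S"
      using sgp_power [OF S(1) m, of j] j by (simp add: power_mult)
    then show False using S(3) by blast
  qed
  then have "h ^ m = 1"
    using h by (auto simp: power_mult elim!: dvdE)
  then have zl: "z ^ l \<in> S"
    using m by simp
  show "p dvd l"
  proof (rule ccontr)
    assume "\<not> p dvd l"
    then show False
      using coprime_cyc z(3) cyc_sub [OF S(1) zl] S(2) by blast
  qed
qed

text \<open>If \<open>c\<close> does not normalise \<open>K\<close> and \<open>K\<close> contains some \<open>h z\<^sup>j\<close>, then some \<open>c\<^sup>i t\<close> normalises \<open>K\<close>,
  and conjugating \<open>h z\<^sup>j\<close> by it produces the factor \<open>z\<close>.\<close>

lemma nz_of_hz: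
  assumes K: "sgp K" "K \<subseteq> G" "z \<notin> K" "h * z ^ j \<in> K" and c: "c \<in> C"
  shows "nz c K"
proof (rule ccontr)
  assume "\<not> nz c K"
  then obtain i where i: "nz (c ^ i * t) K"
    using P3 [OF K(1,2)] c t by (auto simp: C_iff)
  have ci: "c ^ i \<in> C"
    using sgp_power sgp_C c by blast
  define x where "x = c ^ i * t"
  have xG: "x \<in> G"
    unfolding x_def using ci t CG G_mult by blast
  have "inverse x * (h * z ^ j) * x = (inverse x * h * x) * (inverse x * z ^ j * x)"
    by (simp add: mult.assoc)
  also have "\<dots> = h * z * z ^ j"
    using h_conj [OF ci] Z_conj [OF sgp_power [OF sgp_Z z(1)] xG] by (simp add: x_def)
  also have "\<dots> = (h * z ^ j) * z"
    by (simp add: mult.assoc power_commutes)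
  finally have "(h * z ^ j) * z \<in> K"
    using nzD [OF i K(4)] by (simp add: x_def)
  then show False
    using sgp_mult_left [OF K(1,4)] K(3) by simp
qed

text \<open>If \<open>S\<close> meets the span of \<open>h\<close> and \<open>z\<close> trivially,
  it is enlarged in two ways, by \<open>h\<close> and by \<open>h * z\<close>. Both enlargements
  avoid \<open>z\<close> and fall under \<open>nz_of_hz\<close>, and their intersection is
  \<open>S\<close>.\<close>

lemma nz_avoiding:
  assumes S: "sgp S" "S \<subseteq> C" "z \<notin> S" and c: "c \<in> C"
  shows "nz c S"
proof (cases "\<exists>k. h * z ^ k \<in> S")
  case True
  then show ?thesis
    using nz_of_hz [OF S(1) _ S(3)] S(2) CG c by blast
next
  case False
  then have no: "h * z ^ k \<notin> S" for k by blast
  have hz: "h * z = z * h"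
    using Z_commute z h by metis
  define K where "K j = {(h * z ^ j) ^ i * s | i s. s \<in> S}" for j
  have e: "h * z ^ j * s = s * (h * z ^ j)" "(h * z ^ j) ^ i = h ^ i * z ^ (j * i)" "(h * z ^ j) ^ p = 1"
    if "s \<in> S" for j s i
  proof -
    have sC: "s \<in> G" "s * h = h * s"
      using that S C_iff by auto
    have "z ^ j * s = s * z ^ j"
      using Z_commute sgp_power [OF sgp_Z z(1)] sC by blast
    then show "h * z ^ j * s = s * (h * z ^ j)"
      using sC by (metis mult.assoc)
    show *: "(h * z ^ j) ^ i = h ^ i * z ^ (j * i)" for i
      using power_mult_commute commute_power [of z h j] hz by (metis power_mult)
    show "(h * z ^ j) ^ p = 1"
      using h z(4) by (simp add: * mult.commute [of j]) (simp add: power_mult)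
  qed
  have K: "nz c (K j)" for j
  proof (rule nz_of_hz)
    show "sgp (K j)"
      unfolding sgp_def
    proof (intro conjI ballI)
      have "1 = (h * z ^ j) ^ 0 * 1" by simp
      then show "1 \<in> K j"
        unfolding K_def using sgp_one [OF S(1)] by blast
    next
      fix x y assume "x \<in> K j" "y \<in> K j"
      then obtain i s k r where xy: "x = (h * z ^ j) ^ i * s" "s \<in> S" "y = (h * z ^ j) ^ k * r" "r \<in> S"
        unfolding K_def by blast
      have "s * (h * z ^ j) ^ k = (h * z ^ j) ^ k * s"
        using commute_power [of "h * z ^ j" s] e(1) [OF xy(2)] by metis
      then have "x * y = (h * z ^ j) ^ (i + k) * (s * r)"
        unfolding xy(1,3) by (simp add: power_add mult.assoc) (simp flip: mult.assoc)
      then show "x * y \<in> K j"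
        unfolding K_def using sgp_mult [OF S(1)] xy by blast
    next
      fix x assume "x \<in> K j"
      then obtain i s where x: "x = (h * z ^ j) ^ i * s" "s \<in> S"
        unfolding K_def by blast
      have i: "inverse s \<in> S"
        using x sgp_inv [OF S(1)] by blast
      have "(h * z ^ j) ^ (i * p - i) * (h * z ^ j) ^ i = ((h * z ^ j) ^ p) ^ i"
        using p_pos by (simp add: mult.commute flip: power_add power_mult)
      then have "inverse ((h * z ^ j) ^ i) = (h * z ^ j) ^ (i * p - i)"
        using e(3) [OF x(2)] by (metis inv_inv inv_unique power_one)
      moreover have "inverse s * (h * z ^ j) ^ k = (h * z ^ j) ^ k * inverse s" for k
        using commute_power [of "h * z ^ j" "inverse s"] e(1) [OF i] by metis
      ultimately have "inverse x = (h * z ^ j) ^ (i * p - i) * inverse s"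
        by (simp add: x)
      then show "inverse x \<in> K j"
        unfolding K_def using i by blast
    qed
    show "K j \<subseteq> G"
      unfolding K_def using S(2) CG h z G_power G_mult by auto
    show "z \<notin> K j"
    proof
      assume "z \<in> K j"
      then obtain i s where x: "z = (h * z ^ j) ^ i * s" "s \<in> S"
        unfolding K_def by blast
      have "z ^ (p - 1) * z = 1"
        using z(4) p_pos by (metis Suc_pred' power_Suc2)
      moreover have "z ^ (p - 1) * (h * z ^ j) ^ i = (h * z ^ j) ^ i * z ^ (p - 1)"
        using Z_commute [OF sgp_power [OF sgp_Z z(1)]] h z G_power G_mult by blast
      ultimately have "(h * z ^ j) ^ i * z ^ (p - 1) * s = 1"
        using x(1) by (metis mult.assoc)
      then have "inverse ((h * z ^ j) ^ i * z ^ (p - 1)) = s"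
        by (rule inv_unique)
      then have "(h * z ^ j) ^ i * z ^ (p - 1) = inverse s"
        by (metis inv_inv)
      then have "h ^ i * z ^ (j * i + (p - 1)) = inverse s"
        using e(2) [OF x(2)] by (simp add: power_add mult.assoc)
      then have "h ^ i * z ^ (j * i + (p - 1)) \<in> S"
        using sgp_inv [OF S(1) x(2)] by simp
      then have "p dvd i" "p dvd j * i + (p - 1)"
        using socle_root [OF S(1,3) no] by blast+
      then have "p dvd p - 1"
        by (metis dvd_add_right_iff dvd_mult)
      then show False
        using p_gt_1 by (auto dest: dvd_imp_le)
    qed
    have "h * z ^ j = (h * z ^ j) ^ 1 * 1" by simp
    then show "h * z ^ j \<in> K j"
      unfolding K_def using sgp_one [OF S(1)] by blast
  qed (fact c)
  \<comment> \<open>Comparing the two expressions for \<open>x\<close> puts a product of a power of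
    \<open>h\<close> and the inverse of \<open>z ^ k\<close> into \<open>S\<close>, with multiples
    of \<open>p - 1\<close> standing for negative exponents; hence \<open>p dvd k\<close>, and the
    second expression reduces to its factor in \<open>S\<close>.\<close>
  have "K 0 \<inter> K 1 \<subseteq> S"
  proof
    fix x assume "x \<in> K 0 \<inter> K 1"
    then obtain i s k r where xs: "x = (h * z ^ 0) ^ i * s" "s \<in> S" "x = (h * z ^ 1) ^ k * r" "r \<in> S"
      unfolding K_def by blast
    have "h ^ i * s = h ^ k * z ^ k * r"
      using xs e(2) [OF xs(2), of 1 k] by simp
    then have "h ^ (k * (p - 1)) * (h ^ i * s) * inverse s = h ^ (k * (p - 1)) * (h ^ k * z ^ k * r) * inverse s"
      by simp
    then have "h ^ (k * (p - 1) + i) = h ^ (k * (p - 1) + k) * z ^ k * (r * inverse s)"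
      by (simp add: mult.assoc power_add)
    moreover have "k * (p - 1) + k = p * k"
      using p_pos by (simp add: algebra_simps)
    ultimately have "h ^ (k * (p - 1) + i) = z ^ k * (r * inverse s)"
      using h by (simp add: power_mult)
    then have "h ^ (k * (p - 1) + i) * inverse (z ^ k) = z ^ k * (r * inverse s) * inverse (z ^ k)"
      by simp
    also have "\<dots> = r * inverse s"
    proof -
      have "r * inverse s \<in> G"
        using xs S CG G_mult G_inv by blast
      then show ?thesis
        using Z_commute [OF sgp_power [OF sgp_Z z(1)], of "r * inverse s" k] by (simp add: mult.assoc)
    qed
    also have "inverse (z ^ k) = z ^ (k * (p - 1))"
    proof (rule inv_unique)
      have "k + k * (p - 1) = p * k"
        using p_pos by (simp add: algebra_simps)
      then show "z ^ k * z ^ (k * (p - 1)) = 1"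
        using z(4) by (metis power_add power_mult power_one)
    qed
    finally have "h ^ (k * (p - 1) + i) * z ^ (k * (p - 1)) \<in> S"
      using xs sgp_mult [OF S(1)] sgp_inv [OF S(1)] by simp
    then have "p dvd k * (p - 1)"
      using socle_root [OF S(1,3) no] by blast
    then have "p dvd k"
      using prime_p p_gt_1 by (metis dvd_imp_le less_numeral_extra(3) diff_less not_le prime_dvd_mult_nat zero_less_diff zero_less_one p_pos)
    then have "(h * z ^ 1) ^ k = 1"
      using e(3) [OF xs(2), of 1] by (auto simp: power_mult elim!: dvdE)
    then show "x \<in> S"
      using xs by simp
  qed
  moreover have "S \<subseteq> K j" for j
  proof
    fix s assume "s \<in> S"
    moreover have "s = (h * z ^ j) ^ 0 * s" by simp
    ultimately show "s \<in> K j" unfolding K_def by blast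
  qed
  ultimately have "S = K 0 \<inter> K 1" by blast
  then show ?thesis
    using nz_Int K by metis
qed

text \<open>A line in \<open>C\<close> either is \<open>cyc z\<close> or avoids \<open>z\<close>; in
  the second case \<open>C\<close> normalises it and therefore centralises it.\<close>

lemma order_p_central:
  assumes x: "x \<in> C" "x ^ p = 1" and c: "c \<in> C"
  shows "c * x = x * c"
proof (cases "z \<in> cyc x")
  case True
  then have "x \<in> cyc z"
    using line_sym x z CG by blast
  then show ?thesis
    using cyc_Z [OF z(1)] Z_commute c CG by (metis in_mono)
next
  case False
  have "nz c (cyc x)"
    by (rule nz_avoiding) (use False c x sgp_cyc_G CG cyc_sub [OF sgp_C] in auto)
  then show ?thesis
    using nz_order_p x c CG by blast
qed

lemma abelian_C:
  assumes "\<And>a b. a \<in> C \<Longrightarrow> b \<in> C \<Longrightarrow> a * b = b * a"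
  shows "cov G Z (p ^ 3)"
  by (rule abelian_index [OF sgp_C CG assms t p_power_C [OF t] nz_C [OF t]])
     (use cover [OF t C_mem(3)] in auto)

end

section \<open>Noncommuting pairs of minimal order in C\<close>

context socle begin

lemma pgrp_C: "pgrp C p n"
  by (rule pgrp_subgroup [OF sgp_C CG])

lemma order_p_ZC: "x \<in> C \<Longrightarrow> x ^ p = 1 \<Longrightarrow> x \<in> pgrp.Z C"
  using order_p_central by (intro pgrp.Z_I [OF pgrp_C]) metis+

lemma ht_ge_2:
  assumes "a \<in> C" "b \<in> C" "cm a b \<noteq> 1"
  shows "2 \<le> ht a" "2 \<le> ht b"
proof -
  have "2 \<le> ht a" if ab: "a \<in> C" "b \<in> C" "a * b \<noteq> b * a" for a b
  proof (rule ccontr)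
    assume "\<not> 2 \<le> ht a"
    then have "p ^ ht a dvd p ^ 1"
      by (intro le_imp_power_dvd) simp
    then obtain k where "p ^ 1 = p ^ ht a * k" ..
    moreover have "a ^ (p ^ ht a * k) = 1"
      using power_ht ab CG by (auto simp: power_mult)
    ultimately have "a ^ p = 1"
      by (metis power_one_right)
    then show False
      using order_p_central [of a b] ab by simp
  qed
  moreover have "a * b \<noteq> b * a"
    using assms by (simp add: cm_eq_one_iff)
  ultimately show "2 \<le> ht a" "2 \<le> ht b"
    using assms by metis+
qed

text \<open>If \<open>cyc a\<close> avoids \<open>z\<close>, then \<open>b\<close> normalises it, so
  it contains \<open>cm a b\<close>. Either way it contains one of two elements of order
  \<open>p\<close>, and a cyclic \<open>p\<close>-group has only one line.\<close>

lemma bottom_in_pair: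
  assumes ab: "a \<in> C" "b \<in> C" and c: "cm a b \<noteq> 1" "cm a b ^ p = 1"
  shows "\<exists>y\<in>{z, cm a b}. a ^ p ^ (ht a - 1) \<in> cyc y"
proof -
  have aG: "a \<in> G" "a \<noteq> 1" and cG: "cm a b \<in> G"
    using ab c CG G_cm by auto
  have "\<exists>y\<in>{z, cm a b}. y \<in> cyc a"
  proof (cases "z \<in> cyc a")
    case False
    have "nz b (cyc a)"
      by (rule nz_avoiding) (use False ab sgp_cyc_G CG cyc_sub [OF sgp_C] in auto)
    then have "a * cm a b \<in> cyc a"
      using nzD cyc_self unfolding conj_eq_cm [symmetric] by blast
    then show ?thesis
      using sgp_mult_left [OF sgp_cyc_G cyc_self] aG by blast
  qed blast
  then obtain y where y: "y \<in> {z, cm a b}" "y \<in> cyc a" by blast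
  have "a ^ p ^ (ht a - 1) \<in> cyc y"
    by (rule omega_line [OF aG(1) power_cyc _ y(2)]) (use bottom [OF aG] y z c in auto)
  then show ?thesis using y by blast
qed

lemma commuting_conj_cm: "x * b = b * x \<Longrightarrow> cm (a * x) b = inverse x * cm a b * x"
  by (simp add: cm_mult_left cm_eq_one_iff [symmetric])

text \<open>Multiplying \<open>a\<close> by a power of \<open>b\<close> keeps the commutator with
  \<open>b\<close>, so by minimality the height cannot drop. Outside the exceptional case the power
  formula yields \<open>\<alpha> * \<beta> ^ j\<close> as a power of the product. If
  \<open>\<alpha>\<close> and \<open>\<beta>\<close> span the same line, a suitable \<open>j\<close>
  kills it; if not, \<open>j = 1\<close> gives a third line at the bottom, against
  \<open>bottom_in_pair\<close>.\<close>

lemma minimal_pair_ht: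
  assumes ab: "a \<in> C" "b \<in> C" and c: "cm a b \<noteq> 1" "cm a b ^ p = 1"
    and min: "\<And>x y. x \<in> C \<Longrightarrow> y \<in> C \<Longrightarrow> cm x y \<noteq> 1 \<Longrightarrow> ht a + ht b \<le> ht x + ht y"
    and le: "ht a \<le> ht b"
  shows "p = 2 \<and> ht a = 2 \<and> ht b = 2"
proof (rule ccontr)
  assume neg: "\<not> (p = 2 \<and> ht a = 2 \<and> ht b = 2)"
  interpret C: pgrp C p n by (rule pgrp_C)
  define f e where "f = ht a" and "e = ht b"
  have f2: "2 \<le> f" "f \<le> e"
    using ht_ge_2 [OF ab c(1)] le by (auto simp: f_def e_def)
  have G: "a \<in> G" "b \<in> G" "a \<noteq> 1" "b \<noteq> 1"
    using ab CG c(1) by auto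
  define N where "N = p ^ (f - 1)"
  define \<alpha> \<beta> where "\<alpha> = a ^ N" and "\<beta> = b ^ p ^ (e - 1)"
  have \<alpha>: "\<alpha> \<noteq> 1" "\<alpha> ^ p = 1" "\<alpha> \<in> G" and \<beta>: "\<beta> \<noteq> 1" "\<beta> ^ p = 1" "\<beta> \<in> G"
    using bottom [OF G(1,3)] bottom [OF G(2,4)] G_power G
    by (auto simp: \<alpha>_def \<beta>_def N_def f_def e_def)
  define d where "d = cm b a"
  have d: "d \<in> C.Z" "d ^ p = 1" "d \<in> C"
  proof -
    show "d \<in> C" using ab sgp_cm sgp_C by (simp add: d_def)
    show "d ^ p = 1"
      using c(2) by (metis d_def inv_cm inv_one inv_power)
    then show "d \<in> C.Z" using order_p_ZC \<open>d \<in> C\<close> by blast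
  qed
  have pw: "(a * b ^ (j * p ^ (e - f))) ^ N = \<alpha> * \<beta> ^ j" for j
  proof -
    define m where "m = j * p ^ (e - f)"
    have "cm (b ^ m) a = d ^ m"
      unfolding d_def by (rule C.cm_Z_power_left) (use ab d d_def in auto)
    then have ba: "b ^ m * a = a * b ^ m * d ^ m"
      using mult_cm [of a "b ^ m"] by simp
    have dm: "d ^ m \<in> C.Z"
      using sgp_power [OF C.sgp_Z d(1)] .
    have "(a * b ^ m) ^ N = a ^ N * (b ^ m) ^ N * (d ^ m) ^ (N choose 2)"
      by (rule class2_power [OF ba]) (use dm C.Z_commute ab sgp_power [OF sgp_C] in auto)
    \<comment> \<open>The exception arises here: for \<open>e = f\<close> the factor
      \<open>m\<close> gives no help, and with \<open>p = 2\<close> the binomial coefficient is even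
      only if \<open>f\<close> is at least 3.\<close>
    moreover have "p dvd m * (N choose 2)"
    proof (cases "e = f")
      case True
      have "p dvd (N choose 2)"
        unfolding N_def by (rule p_dvd_choose_two [OF prime_p]) (use neg f2 True f_def e_def in auto)
      then show ?thesis by simp
    next
      case False
      then have "p dvd m"
        using f2 by (simp add: m_def dvd_power_iff_le)
      then show ?thesis by simp
    qed
    then have "(d ^ m) ^ (N choose 2) = 1"
      using d(2) by (metis dvdE power_mult power_one)
    moreover have "(b ^ m) ^ N = \<beta> ^ j"
    proof -
      have "p ^ (e - f) * p ^ (f - 1) = p ^ (e - 1)"
        using f2 by (simp flip: power_add)
      then have "m * N = p ^ (e - 1) * j"
        by (simp add: m_def N_def ac_simps)
      then show ?thesis
        by (metis \<beta>_def power_mult)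
    qed
    ultimately show ?thesis
      by (simp add: m_def \<alpha>_def)
  qed
  have cmj: "cm (a * b ^ m) b = cm a b" for m
  proof -
    have "cm (a * b ^ m) b = inverse (b ^ m) * cm a b * b ^ m"
      by (rule commuting_conj_cm) (simp add: power_commutes)
    also have "\<dots> = cm a b"
    proof (rule C.Z_conj)
      show "cm a b \<in> C.Z"
        using order_p_ZC c ab sgp_cm sgp_C by blast
    qed (use ab sgp_power [OF sgp_C] in blast)
    finally show ?thesis .
  qed
  have aj: "a * b ^ m \<in> C" for m
    using ab sgp_C sgp_power sgp_mult by blast
  have htj: "f \<le> ht (a * b ^ m)" for m
    using min [OF aj ab(2), of m] c(1) cmj by (simp add: f_def)
  show False
  proof (cases "cyc \<alpha> = cyc \<beta>")
    case True
    then have "inverse \<alpha> \<in> cyc \<beta>"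
      using cyc_self sgp_inv sgp_cyc_G \<beta>(3) by blast
    then obtain j where "inverse \<alpha> = \<beta> ^ j"
      by (auto simp: cyc_def)
    then have "(a * b ^ (j * p ^ (e - f))) ^ p ^ (f - 1) = 1"
      using pw [of j] by (metis N_def right_inv)
    then have "ht (a * b ^ (j * p ^ (e - f))) \<le> f - 1"
      by (rule ht_le)
    then show False
      using htj [of "j * p ^ (e - f)"] f2 by simp
  next
    case False
    obtain y1 where y1: "y1 \<in> {z, cm a b}" "\<alpha> \<in> cyc y1"
      using bottom_in_pair [OF ab c] by (auto simp: \<alpha>_def N_def f_def)
    obtain y2 where y2: "y2 \<in> {z, cm a b}" "\<beta> \<in> cyc y2"
    proof -
      have c': "cm b a \<noteq> 1" "cm b a ^ p = 1"
        using d c by (auto simp: d_def cm_eq_one_iff)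
      obtain y where y: "y \<in> {z, cm b a}" "\<beta> \<in> cyc y"
        using bottom_in_pair [OF ab(2,1) c'] by (auto simp: \<beta>_def e_def)
      have "\<beta> \<in> cyc (cm a b)" if "\<beta> \<in> cyc (cm b a)"
      proof -
        have "cm b a \<in> cyc (cm a b)"
          using sgp_inv [OF sgp_cyc_G cyc_self] G_cm G inv_cm by metis
        then show ?thesis
          using that cyc_trans by blast
      qed
      then show thesis
        using y that by blast
    qed
    have Y: "y \<in> G" "y ^ p = 1" if "y \<in> {z, cm a b}" for y
      using that z c G_cm G by auto
    have cyc1: "cyc y1 = cyc \<alpha>" and cyc2: "cyc y2 = cyc \<beta>"
      using line_eq [of y1 \<alpha> \<alpha>] line_eq [of y2 \<beta> \<beta>] Y y1 y2 \<alpha> \<beta> cyc_self by blast+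
    define x where "x = a * b ^ (1 * p ^ (e - f))"
    have x: "x \<in> C" "cm x b = cm a b" "x ^ N = \<alpha> * \<beta>"
      using aj cmj pw [of 1] by (auto simp: x_def)
    have "\<alpha> * \<beta> \<noteq> 1"
    proof
      assume "\<alpha> * \<beta> = 1"
      then have "\<beta> \<in> cyc \<alpha>"
        using inv_unique sgp_inv [OF sgp_cyc_G cyc_self] \<alpha>(3) by metis
      then have "cyc \<alpha> = cyc \<beta>"
        using line_eq [of \<alpha> \<beta> \<beta>] \<alpha> \<beta> cyc_self by blast
      then show False using False by blast
    qed
    have "\<alpha> * \<beta> = \<beta> * \<alpha>"
    proof -
      have "\<alpha> \<in> C.Z"
        using order_p_ZC \<alpha> ab sgp_power [OF sgp_C] by (simp add: \<alpha>_def)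
      then show ?thesis
        using C.Z_commute [of \<alpha> "b ^ p ^ (e - 1)"] ab sgp_power [OF sgp_C] by (simp add: \<beta>_def)
    qed
    then have "x ^ p ^ f = 1"
    proof -
      have "x ^ p ^ f = (x ^ N) ^ p"
        using f2 by (metis N_def One_nat_def Suc_pred' less_le_trans pos2 power_Suc2 power_mult)
      then show ?thesis
        using x(3) \<alpha> \<beta> power_mult_commute [OF \<open>\<alpha> * \<beta> = \<beta> * \<alpha>\<close>, of p] by simp
    qed
    then have "ht x = f"
      using ht_le htj [of "1 * p ^ (e - f)"] by (metis le_antisym x_def)
    then obtain y where y: "y \<in> {z, cm a b}" "\<alpha> * \<beta> \<in> cyc y"
      using bottom_in_pair [OF x(1) ab(2)] x c by (auto simp: N_def)
    then have "y = y1 \<or> y = y2"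
      using y1 y2 cyc1 cyc2 False by auto
    then show False
    proof
      assume "y = y1"
      then have "\<alpha> * \<beta> \<in> cyc \<alpha>" using y cyc1 by simp
      then have "\<beta> \<in> cyc \<alpha>"
        using sgp_mult_left [OF sgp_cyc_G cyc_self] \<alpha>(3) by blast
      then show False
        using line_eq [of \<alpha> \<beta> \<beta>] \<alpha> \<beta> cyc_self False by blast
    next
      assume "y = y2"
      then have "\<alpha> * \<beta> \<in> cyc \<beta>" using y cyc2 by simp
      then have "\<alpha> \<in> cyc \<beta>"
        using sgp_mult_right [OF sgp_cyc_G cyc_self] \<beta>(3) by blast
      then show False
        using line_eq [of \<alpha> \<beta> \<alpha>] \<alpha> \<beta> cyc_self False by blast
    qed
  qed
qed

lemma minimal_pair_ht':
  assumes ab: "a \<in> C" "b \<in> C" and c: "cm a b \<noteq> 1" "cm a b ^ p = 1"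
    and min: "\<And>x y. x \<in> C \<Longrightarrow> y \<in> C \<Longrightarrow> cm x y \<noteq> 1 \<Longrightarrow> ht a + ht b \<le> ht x + ht y"
  shows "p = 2 \<and> ht a = 2 \<and> ht b = 2"
proof (cases "ht a \<le> ht b")
  case True
  then show ?thesis
    using minimal_pair_ht [OF ab c min] by blast
next
  case False
  have "cm b a \<noteq> 1" "cm b a ^ p = 1"
    using c by (metis inv_cm inv_inv inv_one, metis inv_cm inv_one inv_power)
  then show ?thesis
    using minimal_pair_ht [OF ab(2,1)] min False by (metis add.commute nat_le_linear)
qed

text \<open>Minimality makes \<open>a ^ p\<close> commute with \<open>b\<close>. Both
  \<open>a * d\<close> and \<open>cm a b * a\<close> are conjugates of \<open>a\<close> whose
  \<open>p\<close>-th powers are still \<open>a ^ p\<close>; expanding these powers gives the two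
  relations.\<close>

lemma minimal_pair_cm:
  assumes ab: "a \<in> C" "b \<in> C" and c: "cm a b \<noteq> 1"
    and min: "\<And>x y. x \<in> C \<Longrightarrow> y \<in> C \<Longrightarrow> cm x y \<noteq> 1 \<Longrightarrow> ht a + ht b \<le> ht x + ht y"
  defines "d \<equiv> cm a (cm a b)"
  shows "d ^ p = 1" "cm a b ^ p * d ^ (p choose 2) = 1"
proof -
  have G: "a \<in> G" "b \<in> G" "a \<noteq> 1"
    using ab CG c by auto
  define e where "e = cm a b"
  have eC: "e \<in> C"
    using ab sgp_cm sgp_C by (simp add: e_def)
  have apb: "a ^ p * b = b * a ^ p"
  proof (rule ccontr)
    assume "a ^ p * b \<noteq> b * a ^ p"
    then have "ht a + ht b \<le> ht (a ^ p) + ht b"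
      using min [of "a ^ p" b] ab sgp_power [OF sgp_C] by (simp add: cm_eq_one_iff)
    then show False
      using ht_power G by fastforce
  qed
  have ape: "a ^ p * e = e * a ^ p"
  proof -
    have "a ^ p * inverse a = inverse a * a ^ p"
      using commute_inv [of a "a ^ p"] by (simp add: power_commutes)
    moreover have "a ^ p * inverse b = inverse b * a ^ p"
      using commute_inv [of b "a ^ p"] apb by metis
    ultimately show ?thesis
      using apb unfolding e_def cm_def by (metis commute_mult power_commutes)
  qed
  have "nz e (cyc a)"
    unfolding e_def using P2 [OF sgp_cyc_G cyc_G] G by blast
  then have "inverse e * a * e \<in> cyc a"
    using nzD cyc_self by blast
  then have d_cyc: "d \<in> cyc a"
    using sgp_mult_left [OF sgp_cyc_G cyc_self] G(1) by (simp add: d_def e_def conj_eq_cm)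
  have ad: "a * d = d * a"
    using cyc_commute [OF d_cyc] by simp
  have "(a * d) ^ p = a ^ p"
  proof -
    have "a * d = inverse e * a * e"
      by (simp add: d_def e_def conj_eq_cm)
    then have "(a * d) ^ p = inverse e * a ^ p * e"
      using conj_power by simp
    also have "\<dots> = a ^ p"
      using ape by (simp add: mult.assoc)
    finally show ?thesis .
  qed
  then show dp: "d ^ p = 1"
    using power_mult_commute [OF ad] by (metis left_cancel mult.right_neutral)
  have dC: "d \<in> C"
    using d_cyc cyc_sub [OF sgp_C ab(1)] by blast
  have "a * e = e * a * d"
    using mult_cm [of e a] by (simp add: d_def e_def)
  then have "(e * a) ^ p = e ^ p * a ^ p * d ^ (p choose 2)"
    by (rule class2_power) (use order_p_central [OF dC dp] ab eC in auto)
  moreover have "(e * a) ^ p = a ^ p"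
  proof -
    have "e * a = inverse (b * a) * a * (b * a)"
      by (simp add: e_def cm_def mult.assoc)
    then have "(e * a) ^ p = inverse (b * a) * a ^ p * (b * a)"
      by (simp only: conj_power)
    also have "\<dots> = a ^ p"
    proof (rule conj_of_commute)
      show "a ^ p * (b * a) = b * a * a ^ p"
        using apb by (metis mult.assoc power_commutes)
    qed
    finally show ?thesis .
  qed
  moreover have "a ^ p * d ^ (p choose 2) = d ^ (p choose 2) * a ^ p"
    using commute_power2 [OF ad] by simp
  ultimately have "e ^ p * d ^ (p choose 2) * a ^ p = 1 * a ^ p"
    by (metis mult.assoc mult.left_neutral)
  then show "cm a b ^ p * d ^ (p choose 2) = 1"
    unfolding right_cancel e_def .
qed

text \<open>In a pair of noncommuting elements of minimal orders the commutator has order \<open>p\<close>, except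
  that for \<open>p = 2\<close> the second element may have to be replaced by the commutator itself.\<close>

lemma special_pair:
  assumes "a0 \<in> C" "b0 \<in> C" "cm a0 b0 \<noteq> 1"
  shows "p = 2 \<and> (\<exists>a\<in>C. \<exists>b\<in>C. cm a b \<noteq> 1 \<and> cm a b ^ 2 = 1 \<and> a ^ 4 = 1 \<and> b ^ 4 = 1
    \<and> a ^ 2 \<in> {z, cm a b} \<and> b ^ 2 \<in> {z, cm a b})"
proof -
  define Q where "Q s \<longleftrightarrow> (\<exists>a\<in>C. \<exists>b\<in>C. cm a b \<noteq> 1 \<and> ht a + ht b = s)" for s
  have "Q (ht a0 + ht b0)"
    using assms by (auto simp: Q_def)
  then have "Q (LEAST s. Q s)"
    by (rule LeastI)
  then obtain a b where ab: "a \<in> C" "b \<in> C" "cm a b \<noteq> 1" "ht a + ht b = (LEAST s. Q s)"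
    by (auto simp: Q_def)
  have min: "ht a + ht b \<le> ht x + ht y" if "x \<in> C" "y \<in> C" "cm x y \<noteq> 1" for x y
    unfolding ab(4) by (rule Least_le) (use that in \<open>auto simp: Q_def\<close>)
  have ba: "cm b a \<noteq> 1"
    using ab(3) by (simp add: cm_eq_one_iff)
  have "\<exists>a\<in>C. \<exists>b\<in>C. cm a b \<noteq> 1 \<and> cm a b ^ p = 1 \<and>
    (\<forall>x\<in>C. \<forall>y\<in>C. cm x y \<noteq> 1 \<longrightarrow> ht a + ht b \<le> ht x + ht y)"
  proof (cases "cm a b ^ p = 1")
    case True
    then show ?thesis using ab min by blast
  next
    case False
    note 1 = minimal_pair_cm [OF ab(1-3) min]
    have min': "ht b + ht a \<le> ht x + ht y" if "x \<in> C" "y \<in> C" "cm x y \<noteq> 1" for x y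
      using min [OF that] by simp
    note 2 = minimal_pair_cm [OF ab(2,1) ba min']
    define c where "c = cm a b"
    have c': "cm b a = inverse c"
      by (simp add: c_def inv_cm)
    have cC: "c \<in> C"
      using ab sgp_cm sgp_C by (simp add: c_def)
    have p2: "p = 2"
    proof (rule ccontr)
      assume "p \<noteq> 2"
      then have "p dvd (p choose 2)"
        using p_dvd_choose_two [OF prime_p, of 1] by simp
      then have "cm a (cm a b) ^ (p choose 2) = 1"
        using 1(1) by (metis dvdE power_mult power_one)
      then show False
        using 1(2) False by simp
    qed
    have d1: "cm a c \<noteq> 1"
      using 1(2) False by (auto simp: c_def)
    have d2: "cm b (inverse c) \<noteq> 1"
      using 2(2) False by (auto simp: c' c_def simp flip: inv_power) (metis inv_inv inv_one)
    have c4: "c ^ p ^ 2 = 1"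
    proof -
      have "c ^ p * cm a c = 1"
        using 1(2) p2 by (simp add: c_def)
      then have "c ^ p = inverse (cm a c)"
        using inv_unique inv_inv by metis
      then have "(c ^ p) ^ p = 1"
        using 1(1) by (metis c_def inv_one inv_power)
      then show ?thesis
        by (simp add: power2_eq_square power_mult)
    qed
    \<comment> \<open>As \<open>c\<close> has order at most 4, comparing the minimal pair with the
      pairs \<open>a\<close>, \<open>c\<close> and \<open>b\<close>, \<open>inverse c\<close> bounds
      all heights by 2. Noncommuting elements have height at least 2, so \<open>a\<close> and
      \<open>c\<close> form a minimal pair again.\<close>
    have hc: "ht c \<le> 2" "ht (inverse c) \<le> 2"
      using ht_le c4 by (blast, metis ht_le inv_one inv_power)
    have "ht a \<le> 2" "ht b \<le> 2"
      using min [OF ab(1) cC d1] min [OF ab(2) sgp_inv [OF sgp_C cC] d2] hc by auto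
    then have "ht a + ht c \<le> ht x + ht y" if "x \<in> C" "y \<in> C" "cm x y \<noteq> 1" for x y
      using ht_ge_2 [OF that] hc by simp
    then show ?thesis
      using ab(1) cC d1 1(1) by (auto simp: c_def)
  qed
  then obtain a b where ab: "a \<in> C" "b \<in> C" "cm a b \<noteq> 1" "cm a b ^ p = 1"
    and min: "\<And>x y. x \<in> C \<Longrightarrow> y \<in> C \<Longrightarrow> cm x y \<noteq> 1 \<Longrightarrow> ht a + ht b \<le> ht x + ht y"
    by blast
  have ht2: "p = 2" "ht a = 2" "ht b = 2"
    using minimal_pair_ht' [OF ab min] by auto
  have G: "a \<in> G" "b \<in> G" "a \<noteq> 1" "b \<noteq> 1"
    using ab CG by auto
  have ord2: "u = y" if u: "u \<in> cyc y" "y ^ 2 = 1" "u \<noteq> 1" for u y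
  proof -
    obtain k where "u = y ^ k" using u by (auto simp: cyc_def)
    also have "\<dots> = (y ^ 2) ^ (k div 2) * y ^ (k mod 2)"
      by (simp flip: power_mult power_add)
    also have "\<dots> = y ^ (k mod 2)"
      using u by simp
    finally show ?thesis
      using u(3) by (cases "k mod 2 = 0") (auto simp: mod2_eq_if)
  qed
  have ba: "cm b a \<noteq> 1" "cm b a ^ p = 1"
    using ab by (metis inv_cm inv_inv inv_one, metis inv_cm inv_one inv_power)
  have inv: "cm b a = cm a b"
    using ab(4) ht2(1) by (metis inv_cm inv_unique power2_eq_square)
  have "a ^ 2 \<in> {z, cm a b}"
    using bottom_in_pair [OF ab] bottom(1) [OF G(1,3)] ht2 ord2 z(4) ab(4) by auto
  moreover have "b ^ 2 \<in> {z, cm a b}"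
    using bottom_in_pair [OF ab(2,1) ba] bottom(1) [OF G(2,4)] ht2 ord2 z(4) ba(2) inv by auto
  moreover have "a ^ 4 = 1" "b ^ 4 = 1"
    using power_ht [OF G(1)] power_ht [OF G(2)] ht2 by simp_all
  ultimately show ?thesis
    using ab ht2(1) by blast
qed

lemma socle_bound_odd:
  assumes "p \<noteq> 2"
  shows "cov G Z (p ^ 3)"
  using special_pair assms by (intro abelian_C) (metis cm_eq_one_iff)

end

section \<open>Noncommuting elements of \<open>C\<close> for \<open>p = 2\<close>\<close>

context grp begin

text \<open>Conjugation as a right action: \<open>cj (a * b)\<close> applies \<open>cj a\<close>
  first.\<close>

definition cj :: "'a \<Rightarrow> 'a \<Rightarrow> 'a" where
  "cj g x = inverse g * x * g"

lemma cj_one [simp]: "cj g 1 = 1" "cj 1 x = x"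
  by (simp_all add: cj_def)

lemma cj_mult: "cj g (x * y) = cj g x * cj g y"
  by (simp add: cj_def mult.assoc)

lemma cj_inv: "cj g (inverse x) = inverse (cj g x)"
  by (simp add: cj_def mult.assoc)

lemma cj_power: "cj g (x ^ k) = cj g x ^ k"
  by (simp add: cj_def conj_power)

lemma cj_comp: "cj (a * b) x = cj b (cj a x)"
  by (simp add: cj_def mult.assoc)

lemma cj_eq_self: "cj g x = x \<longleftrightarrow> x * g = g * x"
  unfolding cj_def by (metis left_inv_assoc mult.assoc right_inv_assoc)

lemma cj_commute: "x * g = g * x \<Longrightarrow> cj g x = x"
  by (simp add: cj_eq_self)

lemma cj_inj [simp]: "cj g x = cj g y \<longleftrightarrow> x = y"
  by (simp add: cj_def)

lemma cj_eq_one [simp]: "cj g x = 1 \<longleftrightarrow> x = 1"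
  using cj_inj [of g x 1] by simp

lemma cm_cj: "cm x g = inverse x * cj g x"
  by (simp add: cm_def cj_def mult.assoc)

lemma cj_cm: "cj g x = x * cm x g"
  by (simp add: cm_def cj_def mult.assoc)

lemma mult_cj: "g * cj g x = x * g"
  by (simp add: cj_def mult.assoc)

lemma cj_nz: "nz g H \<Longrightarrow> x \<in> H \<Longrightarrow> cj g x \<in> H"
  by (simp add: cj_def nzD)

lemma nz_cj_mem:
  assumes "sgp H" "nz g H"
  shows "cj g x \<in> H \<longleftrightarrow> x \<in> H"
proof
  assume "cj g x \<in> H"
  then have "g * cj g x * inverse g \<in> H"
    using nzD' [OF assms(2)] by blast
  then show "x \<in> H"
    by (simp add: cj_def mult.assoc)
qed (use cj_nz assms in blast)

lemma cm_in_normalised: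
  assumes "sgp H" "nz f H" "l \<in> H"
  shows "cm f l \<in> H"
proof -
  have "cm f l = cj f (inverse l) * l"
    by (simp add: cm_def cj_def)
  then show ?thesis
    using assms cj_nz sgp_inv sgp_mult by metis
qed

lemma square_mult: "(l * c) ^ 2 = l ^ 2 * cj l c * c"
  by (simp add: cj_def power2_eq_square mult.assoc)

lemma involution_cyc:
  assumes "u \<in> cyc y" "y ^ 2 = 1" "u \<noteq> 1"
  shows "u = y"
proof -
  obtain k where "u = y ^ k"
    using assms(1) by (auto simp: cyc_def)
  also have "\<dots> = (y ^ 2) ^ (k div 2) * y ^ (k mod 2)"
    by (simp flip: power_mult power_add)
  finally show ?thesis
    using assms(2,3) by (cases "k mod 2 = 0") (auto simp: mod2_eq_if)
qed

lemma cyc_square: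
  assumes u: "u \<in> cyc y" and y: "y ^ 2 = z" "z ^ 2 = 1"
  shows "u \<in> {1, y, z, y * z}"
proof -
  obtain k where "u = y ^ k"
    using u by (auto simp: cyc_def)
  also have "\<dots> = (y ^ 2) ^ (k div 2) * y ^ (k mod 2)"
    by (simp flip: power_mult power_add)
  finally have "u = z ^ (k div 2) * y ^ (k mod 2)"
    using y by simp
  moreover have "z ^ j = 1 \<or> z ^ j = z" for j
  proof -
    have "z ^ j = (z ^ 2) ^ (j div 2) * z ^ (j mod 2)"
      by (simp flip: power_mult power_add)
    then show ?thesis
      using y(2) by (cases "j mod 2 = 0") (auto simp: mod2_eq_if)
  qed
  moreover have "z * y = y * z"
    using y(1) by (auto simp: power_commutes)
  moreover have "y ^ (k mod 2) = 1 \<or> y ^ (k mod 2) = y"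
    by (cases "k mod 2 = 0") (auto simp: mod2_eq_if)
  ultimately show ?thesis
    by (metis insertCI mult.left_neutral mult.right_neutral)
qed

lemma inverse_involution: "x ^ 2 = 1 \<Longrightarrow> inverse x = x"
  by (rule inv_unique) (simp add: power2_eq_square)

end

locale socle2 = socle G 2 n h t for G :: "'a::grp set" and n h t
begin

lemma h2: "h ^ 2 = 1" and z2: "z ^ 2 = 1"
  using h z by auto

lemma inv_h: "inverse h = h" and inv_z: "inverse z = z"
  using h2 z2 inverse_involution by auto

lemma hh [simp]: "h * h = 1" "h * (h * x) = x"
  using h2 by (simp_all add: power2_eq_square flip: mult.assoc)

lemma zz [simp]: "z * z = 1" "z * (z * x) = x"
  using z2 by (simp_all add: power2_eq_square flip: mult.assoc)

lemma h1: "h \<noteq> 1" "h \<noteq> z"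
proof -
  show "h \<noteq> 1" using z1 by auto
  show "h \<noteq> z"
    using z Z_commute t z1 by (metis cm_eq_one_iff)
qed

lemma z_comm: "x \<in> G \<Longrightarrow> x * z = z * x"
  using Z_commute z by metis

lemma cj_z: "x \<in> G \<Longrightarrow> cj x z = z"
  by (rule cj_commute) (use z_comm in simp)

lemma C_G: "c \<in> C \<Longrightarrow> c \<in> G"
  using CG by blast

lemma C_mult: "a \<in> C \<Longrightarrow> b \<in> C \<Longrightarrow> a * b \<in> C"
  and C_inv: "a \<in> C \<Longrightarrow> inverse a \<in> C"
  and C_power: "a \<in> C \<Longrightarrow> a ^ k \<in> C"
  using sgp_mult sgp_inv sgp_power sgp_C by blast+

lemma C_h: "c \<in> C \<Longrightarrow> c * h = h * c"
  by (simp add: C_iff)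

lemma cj_C: "c \<in> C \<Longrightarrow> x \<in> G \<Longrightarrow> cj x c \<in> C"
  using cj_nz nz_C by blast

lemma square_C: "x \<in> G \<Longrightarrow> x ^ 2 \<in> C"
  using p_power_C by simp

lemma outside_mult: "l \<in> G \<Longrightarrow> l \<notin> C \<Longrightarrow> y \<in> G \<Longrightarrow> y \<notin> C \<Longrightarrow> l * y \<in> C"
  using cover [of l y] by (auto simp: less_2_cases_iff)

lemma outside_right: "l \<notin> C \<Longrightarrow> c \<in> C \<Longrightarrow> l * c \<notin> C"
  and outside_left: "l \<notin> C \<Longrightarrow> c \<in> C \<Longrightarrow> c * l \<notin> C"
  using sgp_mult_right sgp_mult_left sgp_C by blast+

lemma outside_t:
  assumes "l \<in> G" "l \<notin> C"
  obtains c where "c \<in> C" "l = t * c"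
proof -
  have "inverse t \<notin> C"
    using C_mem(3) sgp_inv_iff sgp_C by blast
  then have "inverse t * l \<in> C"
    using outside_mult assms t G_inv by blast
  then show thesis
    using that [of "inverse t * l"] by simp
qed

lemma cj_h: assumes "l \<in> G" "l \<notin> C" shows "cj l h = h * z"
proof -
  obtain c where c: "c \<in> C" "l = t * c"
    using outside_t assms by blast
  have "cj t h = h * z"
    by (simp add: cj_cm z_def)
  then have "cj l h = cj c h * cj c z"
    by (simp add: c(2) cj_comp cj_mult)
  also have "cj c h = h"
    using c C_h by (simp add: cj_eq_self)
  finally show ?thesis
    using cj_z C_G c by simp
qed

lemma cj_hz: "l \<in> G \<Longrightarrow> l \<notin> C \<Longrightarrow> cj l (h * z) = h"
  by (simp add: cj_mult cj_h cj_z mult.assoc)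

text \<open>Multiplication by \<open>h\<close> stays outside \<open>C\<close> and toggles squares by
  \<open>z\<close>, so the squares 1 and \<open>z\<close> occur together or not at all outside
  \<open>C\<close>.\<close>

lemma square_h: "l \<in> G \<Longrightarrow> l \<notin> C \<Longrightarrow> (l * h) ^ 2 = l ^ 2 * z"
  using z_comm [OF h(1)] by (simp add: square_mult cj_h mult.assoc)

lemma outside_power: "l \<in> G \<Longrightarrow> l \<notin> C \<Longrightarrow> l ^ k \<in> C \<longleftrightarrow> even k"
proof -
  assume l: "l \<in> G" "l \<notin> C"
  have k: "l ^ k = (l ^ 2) ^ (k div 2) * l ^ (k mod 2)"
    by (simp flip: power_mult power_add)
  have "(l ^ 2) ^ (k div 2) \<in> C"
    using C_power square_C l by blast
  then show ?thesis
    unfolding k using sgp_mult_left [OF sgp_C] l C_power [of 1] sgp_one [OF sgp_C]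
    by (cases "even k") (auto simp: even_iff_mod_2_eq_zero odd_iff_mod_2_eq_one)
qed

lemma cyc_outside_C:
  assumes l: "l \<in> G" "l \<notin> C" and x: "x \<in> cyc l" "x \<in> C"
  shows "x \<in> cyc (l ^ 2)"
proof -
  obtain k where k: "x = l ^ k"
    using x by (auto simp: cyc_def)
  then obtain j where "k = 2 * j"
    using outside_power l x(2) by (auto elim: evenE)
  then show ?thesis
    using k power_cyc by (simp add: power_mult)
qed

lemma nz_square: "sgp H \<Longrightarrow> H \<subseteq> G \<Longrightarrow> x \<in> G \<Longrightarrow> nz (x ^ 2) H"
  using P1 by simp

lemma nz_cyc_square: "l \<in> G \<Longrightarrow> q \<in> cyc (l ^ 2) \<Longrightarrow> sgp H \<Longrightarrow> H \<subseteq> G \<Longrightarrow> nz q H"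
  using cyc_sub [OF sgp_nz, of "l ^ 2" H] nz_square by auto

text \<open>The alternative for \<open>r\<close> is the point: the square of an element normalising
  a cyclic group of order 4 acts trivially on it, so an \<open>r\<close> that acts nontrivially
  leaves only \<open>r = s\<close>.\<close>

lemma order4_in_cyc:
  assumes s: "s \<in> G" "s \<noteq> 1" "s \<noteq> z" and zs: "z \<in> cyc s"
  obtains r where "r \<in> cyc s" "r ^ 2 = z" "r = s \<or> (\<exists>q\<in>cyc s. r = q ^ 2)"
proof -
  have "ht s \<noteq> 0"
    using s ht_eq_0 by simp
  moreover have "ht s \<noteq> 1"
  proof
    assume "ht s = 1"
    then have "s ^ 2 = 1"
      using power_ht [OF s(1)] by simp
    then show False
      using involution_cyc [OF zs] z s by simp
  qed
  ultimately obtain k where k: "ht s = Suc (Suc k)"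
    by (metis One_nat_def not0_implies_Suc)
  define r where "r = s ^ 2 ^ k"
  have r2: "r ^ 2 = s ^ 2 ^ (ht s - 1)"
    by (simp add: r_def k mult.commute flip: power_mult)
  have "z \<in> cyc (s ^ 2 ^ (ht s - 1))"
    using omega [OF s(1) zs] z by simp
  then have "z = r ^ 2"
    using involution_cyc bottom(2) [OF s(1,2)] z r2 by simp
  moreover have "r = s \<or> (\<exists>q\<in>cyc s. r = q ^ 2)"
  proof (cases k)
    case (Suc j)
    then have "r = (s ^ 2 ^ j) ^ 2"
      by (simp add: r_def mult.commute flip: power_mult)
    then show ?thesis using power_cyc by blast
  qed (simp add: r_def)
  ultimately show thesis
    using that [of r] power_cyc [of s "2 ^ k"] unfolding r_def by metis
qed

lemma involution_central: "e \<in> C \<Longrightarrow> e ^ 2 = 1 \<Longrightarrow> c \<in> C \<Longrightarrow> c * e = e * c"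
  by (rule order_p_central)

end

text \<open>Dividing by \<open>M \<inter> t\<^sup>-\<^sup>1 M t\<close> for a maximal subgroup \<open>M\<close> of \<open>C\<close> that contains \<open>h\<close> and
  avoids \<open>z\<close> leads to this situation.\<close>

locale tight = socle2 +
  fixes Y
  assumes Y: "sgp Y" "Y \<subseteq> C" "h \<in> Y" "z \<notin> Y"
    and Y_max: "\<And>S. sgp S \<Longrightarrow> Y \<subseteq> S \<Longrightarrow> S \<subseteq> C \<Longrightarrow> S \<noteq> Y \<Longrightarrow> z \<in> S"
    and Y_disj: "\<And>y. y \<in> Y \<Longrightarrow> cj t y \<in> Y \<Longrightarrow> y = 1"
begin

lemma nz_Y: "c \<in> C \<Longrightarrow> nz c Y"
  by (rule nz_avoiding [OF Y(1,2,4)])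

lemma Y_outside:
  assumes l: "l \<in> G" "l \<notin> C" and y: "y \<in> Y" "cj l y \<in> Y"
  shows "y = 1"
proof -
  obtain c where c: "c \<in> C" "l = t * c"
    using outside_t l by blast
  have "cj c (cj t y) \<in> Y"
    using y c by (simp add: cj_comp)
  then have "cj t y \<in> Y"
    using nz_cj_mem [OF Y(1) nz_Y [OF c(1)]] by simp
  then show ?thesis
    using Y_disj y by blast
qed

text \<open>\<open>Y\<close> and its conjugate by \<open>l\<close> are both normal in
  \<open>C\<close> and meet trivially, so their mutual commutators vanish.\<close>

lemma Y_commute:
  assumes l: "l \<in> G" "l \<notin> C" and y: "x \<in> Y" "y \<in> Y"
  shows "x * cj l y = cj l y * x"
proof -
  have C: "x \<in> C" "y \<in> C" "cj l y \<in> C"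
    using y Y cj_C l by auto
  define k where "k = cm x (cj l y)"
  have 1: "k \<in> Y"
    unfolding k_def cm_cj using nz_Y [OF C(3)] cj_nz y Y(1) sgp_mult sgp_inv by blast
  have "cm (cj l y) x = inverse (cj l y) * cj x (cj l y)"
    by (rule cm_cj)
  also have "cj x (cj l y) = cj l (cj (l * x * inverse l) y)"
    by (simp add: cj_def mult.assoc)
  finally have "cm (cj l y) x = cj l (inverse y * cj (l * x * inverse l) y)"
    by (simp add: cj_mult cj_inv)
  moreover have "l * x * inverse l \<in> C"
    using cj_C [OF C(1) G_inv [OF l(1)]] by (simp add: cj_def)
  then have "inverse y * cj (l * x * inverse l) y \<in> Y"
    using nz_Y cj_nz y Y(1) sgp_mult sgp_inv by blast
  ultimately obtain w where w: "w \<in> Y" "cm (cj l y) x = cj l w"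
    by blast
  have "inverse k = cj l w"
    using w by (simp add: k_def inv_cm)
  then have "cj l w \<in> Y"
    using 1 sgp_inv [OF Y(1)] by metis
  then have "w = 1"
    using Y_outside l w by blast
  then have "k = 1"
    using \<open>inverse k = cj l w\<close> by (metis cj_one(1) inv_inv inv_one)
  then show ?thesis
    by (simp add: k_def cm_eq_one_iff)
qed

text \<open>\<open>Y\<close> together with the coset of \<open>x\<close> is a subgroup properly
  containing \<open>Y\<close>, so maximality puts \<open>z\<close> into that coset.\<close>

lemma Y_extend:
  assumes x: "x \<in> C" "x ^ 2 \<in> Y" "x \<notin> Y"
  shows "inverse x * z \<in> Y"
proof -
  define S where "S = {y. y \<in> Y \<or> inverse x * y \<in> Y}"
  have n: "cj x y \<in> Y \<longleftrightarrow> y \<in> Y" for y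
    using nz_cj_mem [OF Y(1) nz_Y [OF x(1)]] .
  have xx: "x * x \<in> Y" "inverse x * inverse x \<in> Y"
    using x sgp_inv [OF Y(1), of "x * x"] by (auto simp: power2_eq_square)
  have mem: "x * y \<in> Y \<longleftrightarrow> inverse x * y \<in> Y" for y
    using sgp_mult_left [OF Y(1) xx(2), of "x * y"] by (simp add: mult.assoc)
  have memr: "y * x \<in> Y \<longleftrightarrow> inverse x * y \<in> Y" for y
    using n [of "y * x"] n [of "x * y"] mem [of y] by (simp add: cj_def mult.assoc)
  have "sgp S"
    unfolding sgp_def
  proof (intro conjI ballI)
    show "1 \<in> S" using sgp_one [OF Y(1)] by (simp add: S_def)
  next
    fix a b assume "a \<in> S" "b \<in> S"
    then consider "a \<in> Y" "b \<in> Y" | "inverse x * a \<in> Y" "b \<in> Y" | "a \<in> Y" "inverse x * b \<in> Y"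
      | "inverse x * a \<in> Y" "inverse x * b \<in> Y"
      by (auto simp: S_def)
    then show "a * b \<in> S"
    proof cases
      case 1
      then show ?thesis using sgp_mult [OF Y(1)] by (simp add: S_def)
    next
      case 2
      then show ?thesis using sgp_mult [OF Y(1), of "inverse x * a" b] by (simp add: S_def mult.assoc)
    next
      case 3
      have "inverse x * a * x \<in> Y" using 3 n [of a] by (simp add: cj_def)
      then have "(inverse x * a * x) * (inverse x * b) \<in> Y"
        using 3 sgp_mult [OF Y(1)] by blast
      then show ?thesis by (simp add: S_def mult.assoc)
    next
      case 4
      then have "a * x \<in> Y" using memr by simp
      then have "(a * x) * (inverse x * b) \<in> Y"
        using 4 sgp_mult [OF Y(1)] by blast
      then show ?thesis by (simp add: S_def mult.assoc)
    qed
  next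
    fix a assume "a \<in> S"
    then consider "a \<in> Y" | "inverse x * a \<in> Y"
      by (auto simp: S_def)
    then show "inverse a \<in> S"
    proof cases
      case 1
      then show ?thesis using sgp_inv [OF Y(1)] by (simp add: S_def)
    next
      case 2
      then have "inverse (inverse x * a) \<in> Y"
        using sgp_inv [OF Y(1)] by blast
      then have "inverse a * x \<in> Y" by simp
      then show ?thesis using memr by (simp add: S_def)
    qed
  qed
  moreover have "Y \<subseteq> S"
    by (auto simp: S_def)
  moreover have "S \<subseteq> C"
    using Y(2) x(1) sgp_mult_left [OF sgp_C C_inv [OF x(1)]] by (auto simp: S_def)
  moreover have "x \<in> S"
    using sgp_one [OF Y(1)] by (simp add: S_def)
  ultimately have "z \<in> S"
    using Y_max x(3) by metis
  then show ?thesis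
    using Y(4) by (simp add: S_def)
qed

text \<open>An involution \<open>e\<close> of \<open>Y\<close> other than \<open>h\<close> has its
  conjugate \<open>x\<close> by \<open>t\<close> outside \<open>Y\<close>, so \<open>x * z\<close>
  and \<open>x * z * h\<close> lie in \<open>Y\<close>. The latter is the conjugate of
  \<open>e * h\<close>, and \<open>Y_disj\<close> gives \<open>e = h\<close> after all. An
  involution outside \<open>Y\<close> enters \<open>Y\<close> after multiplication by
  \<open>z\<close>.\<close>

lemma involutions:
  assumes e: "e \<in> C" "e ^ 2 = 1"
  shows "e \<in> {1, h, z, h * z}"
proof -
  have inY: "e = 1 \<or> e = h" if e: "e \<in> Y" "e ^ 2 = 1" for e
  proof (rule ccontr)
    assume neg: "\<not> (e = 1 \<or> e = h)"
    define x where "x = cj t e"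
    have x: "x \<in> C" "x ^ 2 = 1"
      using e Y(2) cj_C t by (auto simp: x_def simp flip: cj_power)
    have "x \<notin> Y"
      using Y_disj e neg by (auto simp: x_def)
    then have "inverse x * z \<in> Y"
      using Y_extend x sgp_one [OF Y(1)] by simp
    then have "x * z \<in> Y"
      using inverse_involution [OF x(2)] by simp
    then have "(x * z) * h \<in> Y"
      using Y sgp_mult by blast
    moreover have "(x * z) * h = cj t (e * h)"
      using cj_h [OF t C_mem(3)] z_comm [OF h(1)] by (simp add: cj_mult x_def mult.assoc)
    moreover have "e * h \<in> Y"
      using e Y sgp_mult by blast
    ultimately have "e * h = 1"
      using Y_disj by metis
    then have "e * h * h = h" by simp
    then have "e = h" by (simp add: mult.assoc)
    then show False using neg by simp
  qed
  show ?thesis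
  proof (cases "e \<in> Y")
    case False
    then have "inverse e * z \<in> Y"
      using Y_extend e sgp_one [OF Y(1)] by simp
    then have ez: "e * z \<in> Y"
      using inverse_involution [OF e(2)] by simp
    have "(e * z) ^ 2 = 1"
      using e z2 z_comm C_G by (simp add: power_mult_commute)
    then have "e * z = 1 \<or> e * z = h"
      using inY ez by blast
    then have "e * z * z = z \<or> e * z * z = h * z" by auto
    then show ?thesis by (auto simp: mult.assoc)
  qed (use inY e in auto)
qed

lemma involution_outside:
  assumes e: "e \<in> C" "e ^ 2 = 1" and l: "l \<in> G" "l \<notin> C" and c: "cj l e = e"
  shows "e = 1 \<or> e = z"
proof -
  have "h * z \<noteq> h"
    using z(2) by (metis left_cancel mult.right_neutral)
  then show ?thesis
    using involutions [OF e] cj_h [OF l] cj_hz [OF l] c by auto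
qed

lemma involution_outside':
  assumes e: "e \<in> C" "e ^ 2 = 1" and l: "l \<in> G" "l \<notin> C" and c: "cj l e = e * z"
  shows "e = h \<or> e = h * z"
  using involutions [OF e] cj_z [OF l(1)] c z by auto

end

context grp begin

lemma cj_cj: "cj l (cj c x) = cj (cj l c) (cj l x)"
  by (simp add: cj_def mult.assoc)

end

section \<open>Square roots of h in Y\<close>

context tight begin

lemma cj_root_h:
  assumes y: "y \<in> Y" "y ^ 2 = h" and c: "nz c (cyc y)" "cj c h = h"
  shows "cj c y = y \<or> cj c y = y * h"
proof -
  have "cj c y \<in> {1, y, h, y * h}"
    using cyc_square [OF cj_nz [OF c(1) cyc_self] y(2) h2] .
  moreover have "cj c y ^ 2 = h"
    using y(2) c(2) by (metis cj_power)
  ultimately show ?thesis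
    using h1 h2 by auto
qed

text \<open>Being a square, \<open>h\<close> normalises \<open>cyc l\<close>, which puts
  \<open>cm h l = z\<close> into it. If \<open>l ^ 2\<close> did not centralise \<open>y\<close>, it
  would invert it, and the iterated commutator of \<open>y\<close> with \<open>l\<close> would put
  \<open>h * z\<close> into \<open>cyc l\<close>, although \<open>l\<close> moves
  \<open>h * z\<close>.\<close>

lemma root_h_outside:
  assumes y: "y \<in> Y" "y ^ 2 = h" and l: "l \<in> G" "l \<notin> C"
  shows "z \<in> cyc l" "cj (l ^ 2) y = y"
proof -
  have yC: "y \<in> C" "y \<in> G" using y Y CG by auto
  have cyl: "sgp (cyc l)" "cyc l \<subseteq> G"
    using l sgp_cyc_G cyc_G by auto
  have "nz h (cyc l)"
    using nz_square [OF cyl yC(2)] y by simp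
  then have "cm h l \<in> cyc l"
    using cm_in_normalised cyl cyc_self by blast
  then show "z \<in> cyc l"
    using cj_h [OF l] inv_h by (simp add: cm_cj)
  define v where "v = cj l y"
  have yv: "y * v = v * y"
    unfolding v_def by (rule Y_commute [OF l y(1) y(1)])
  have "cj (l ^ 2) h = h"
    using cj_h [OF l] cj_hz [OF l] by (simp add: power2_eq_square cj_comp)
  then consider "cj (l ^ 2) y = y" | "cj (l ^ 2) y = y * h"
    using cj_root_h [OF y nz_square] l sgp_cyc_G cyc_G yC by blast
  then show "cj (l ^ 2) y = y"
  proof cases
    case 2
    have "inverse y = y * h"
      using y h2 by (intro inv_unique) (simp add: power2_eq_square flip: mult.assoc)
    then have lv: "cj l v = inverse y"
      using 2 by (simp add: v_def power2_eq_square cj_comp)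
    define f where "f = cm y l"
    have f: "f = inverse y * v"
      by (simp add: f_def v_def cm_cj)
    have "nz f (cyc l)"
      unfolding f_def by (rule P2) (use cyl yC l in auto)
    then have "cm f l \<in> cyc l"
      using cm_in_normalised cyl cyc_self by blast
    moreover have "cm f l = inverse (v ^ 2)"
    proof -
      have "cj l f = inverse v * inverse y"
        using lv by (simp add: f cj_mult cj_inv flip: v_def)
      then have "cm f l = inverse v * (y * inverse v) * inverse y"
        by (simp add: cm_cj f mult.assoc)
      also have "y * inverse v = inverse v * y"
        using commute_inv [of v y] yv by simp
      finally show ?thesis
        by (simp add: mult.assoc power2_eq_square)
    qed
    moreover have "v ^ 2 = h * z"
      using y(2) cj_h [OF l] by (simp add: v_def flip: cj_power)
    moreover have "inverse (h * z) = h * z"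
      using inv_h inv_z z_comm [OF h(1)] by simp
    ultimately have "h * z \<in> cyc l" by simp
    then have "cj l (h * z) = h * z"
      using cyc_commute by (intro cj_commute) blast
    then have "h * z = h"
      using cj_hz l by simp
    then show ?thesis
      using z(2) by (metis left_cancel mult.right_neutral)
  qed
qed

text \<open>Multiplying \<open>y\<close> by its conjugate produces a root of \<open>z\<close> that
  \<open>l\<close> fixes; it serves to turn other roots of \<open>z\<close> into
  involutions.\<close>

lemma root_h_e:
  assumes y: "y \<in> Y" "y ^ 2 = h" and l: "l \<in> G" "l \<notin> C"
  defines "v \<equiv> cj l y" and "e \<equiv> y * cj l y"
  shows "cj l v = y" "y * v = v * y" "cj l e = e" "e ^ 2 = z" "e \<in> C" "v \<in> C" "y \<in> C" "v ^ 2 = h * z"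
    and "e * y = y * e" "e * v = v * e"
proof -
  show yC: "y \<in> C" using y Y by auto
  show vC: "v \<in> C" unfolding v_def by (rule cj_C [OF yC l(1)])
  show eC: "e \<in> C" using yC vC C_mult unfolding e_def v_def by blast
  show lv: "cj l v = y"
    using root_h_outside(2) [OF y l] by (simp add: v_def power2_eq_square cj_comp)
  show yv: "y * v = v * y"
    unfolding v_def by (rule Y_commute [OF l y(1) y(1)])
  have e: "e = y * v" by (simp add: e_def v_def)
  show "cj l e = e"
    using lv yv by (simp add: e cj_mult) (simp add: v_def)
  show v2: "v ^ 2 = h * z"
    using y(2) cj_h [OF l] by (simp add: v_def flip: cj_power)
  show "e ^ 2 = z"
    using power_mult_commute [OF yv, of 2] y v2 by (simp add: e)
  show "e * y = y * e" "e * v = v * e"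
    using yv by (simp_all add: e mult.assoc) (metis mult.assoc)
qed

text \<open>\<open>z\<close> lies in \<open>cyc l\<close>, which excludes the square 1. Multiplying
  an outside element by \<open>y * cj l y\<close> or by \<open>y\<close> converts each of the other
  squares into one already excluded.\<close>

lemma root_h_square:
  assumes y: "y \<in> Y" "y ^ 2 = h" and l: "l \<in> G" "l \<notin> C"
  shows "l ^ 2 \<noteq> 1" "l ^ 2 \<noteq> z" "l ^ 2 \<noteq> y * cj l y" "l ^ 2 \<noteq> y * cj l y * z"
proof -
  note e = root_h_e [OF y l]
  have ne: "x ^ 2 \<noteq> 1" if x: "x \<in> G" "x \<notin> C" for x
    using involution_cyc [OF root_h_outside(1) [OF y x]] z(2) x(2) C_mem(2) by auto
  have ne2: "x ^ 2 \<noteq> z" if x: "x \<in> G" "x \<notin> C" for x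
  proof
    assume x2: "x ^ 2 = z"
    note e = root_h_e [OF y x]
    have "(x * (y * cj x y)) ^ 2 = 1"
      using e x2 z2 by (simp add: square_mult mult.assoc flip: power2_eq_square)
    moreover have "x * (y * cj x y) \<in> G" "x * (y * cj x y) \<notin> C"
      using x e(5) C_G G_mult outside_right by auto
    ultimately show False using ne by blast
  qed
  show "l ^ 2 \<noteq> 1" "l ^ 2 \<noteq> z"
    using ne ne2 l by auto
  have ly: "l * y \<in> G" "l * y \<notin> C"
    using l e(7) C_G G_mult outside_right by auto
  have sq: "(l * y) ^ 2 = l ^ 2 * (y * cj l y)"
    using e(2) by (simp add: square_mult mult.assoc)
  have ee: "y * cj l y * (y * cj l y) = z"
    using e(4) by (simp add: power2_eq_square)
  show "l ^ 2 \<noteq> y * cj l y"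
    using ne2 [OF ly] sq ee by auto
  show "l ^ 2 \<noteq> y * cj l y * z"
  proof
    assume "l ^ 2 = y * cj l y * z"
    then have "(l * y) ^ 2 = y * cj l y * (z * (y * cj l y))"
      using sq by (simp add: mult.assoc)
    also have "z * (y * cj l y) = y * cj l y * z"
      using z_comm [OF C_G [OF e(5)]] by simp
    finally have "(l * y) ^ 2 = 1"
      using ee by (metis mult.assoc zz(1))
    then show False using ne ly by blast
  qed
qed

text \<open>Among the powers of \<open>l ^ 2\<close>, the root \<open>r\<close> of \<open>z\<close>
  agrees with \<open>e\<close> up to \<open>z\<close>; since \<open>l ^ 2\<close> itself is neither,
  \<open>r\<close> is the square of some power \<open>q\<close>. An element \<open>c\<close> moving
  \<open>y\<close> is multiplied by \<open>z\<close> under \<open>r\<close>, yet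
  \<open>c ^ 2 = z\<close> and \<open>q\<close> normalises \<open>cyc c\<close>, so
  \<open>q ^ 2\<close> must fix \<open>c\<close>.\<close>

lemma root_h_central:
  assumes y: "y \<in> Y" "y ^ 2 = h" and c: "c \<in> C"
  shows "cj c y = y"
proof (rule ccontr)
  assume neg: "cj c y \<noteq> y"
  define l where "l = t"
  have l: "l \<in> G" "l \<notin> C" using t C_mem by (auto simp: l_def)
  define v e where "v = cj l y" and "e = y * v"
  note E = root_h_e [OF y l, folded v_def, folded e_def]
  note sq = root_h_square [OF y l, folded v_def, folded e_def]
  have s: "l ^ 2 \<in> G" using l G_power by blast
  have "z \<in> cyc (l ^ 2)"
    using cyc_outside_C [OF l root_h_outside(1) [OF y l]] C_mem by blast
  then obtain r where r: "r \<in> cyc (l ^ 2)" "r ^ 2 = z" "r = l ^ 2 \<or> (\<exists>q\<in>cyc (l ^ 2). r = q ^ 2)"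
    using order4_in_cyc [OF s sq(1,2)] by blast
  have rC: "r \<in> C"
    using r(1) cyc_sub [OF sgp_C square_C [OF l(1)]] by blast
  have ly: "l ^ 2 * y = y * l ^ 2"
    using root_h_outside(2) [OF y l] by (simp add: cj_eq_self)
  have "cj (l ^ 2) v = v"
    using E(1) by (simp add: v_def power2_eq_square cj_comp)
  then have lv: "l ^ 2 * v = v * l ^ 2"
    by (simp add: cj_eq_self)
  have "y * r = r * y" "v * r = r * v"
    using cyc_commute [OF r(1) ly] cyc_commute [OF r(1) lv] by simp_all
  then have "e * r = r * e"
    unfolding e_def by (rule commute_mult)
  then have "(r * inverse e) ^ 2 = r ^ 2 * inverse e ^ 2"
    using commute_inv [of e r] by (intro power_mult_commute) simp
  then have "(r * inverse e) ^ 2 = 1"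
    using r(2) E(4) inv_z by (simp flip: inv_power)
  moreover have "cj l (r * inverse e) = r * inverse e"
  proof -
    have "cj l r = r"
      by (rule cj_commute) (use cyc_commute [OF r(1)] in \<open>simp add: power_commutes\<close>)
    then show ?thesis
      using E(3) by (simp add: cj_mult cj_inv)
  qed
  ultimately have "r * inverse e = 1 \<or> r * inverse e = z"
    using involution_outside rC E(5) C_mult C_inv l by blast
  then have "r * inverse e * e = e \<or> r * inverse e * e = z * e" by auto
  then have re: "r = e \<or> r = e * z"
    using z_comm [OF C_G [OF E(5)]] by (auto simp: mult.assoc)
  then obtain q where q: "q \<in> cyc (l ^ 2)" "r = q ^ 2"
    using r(3) sq by auto
  have nzY: "nz x (cyc y)" if "x \<in> C" for x
    by (rule nz_avoiding) (use that y E Y CG sgp_cyc_G cyc_sub [OF sgp_C E(7)] cyc_sub [OF Y(1) y(1)] in auto)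
  have hC: "cj x h = h" if "x \<in> C" for x
    using that C_h by (simp add: cj_eq_self)
  have root: "cj x y = y \<or> cj x y = y * h" if "x \<in> C" for x
    by (rule cj_root_h [OF y nzY [OF that] hC [OF that]])
  have cy: "cj c y = y * h"
    using root c neg by blast
  have cyh: "cj c (y * h) = y"
    using cy hC [OF c] by (simp add: cj_mult mult.assoc)
  define c' where "c' = cj l c"
  have c'C: "c' \<in> C"
    unfolding c'_def by (rule cj_C [OF c l(1)])
  \<comment> \<open>Squares of outside elements fix \<open>y\<close>; for \<open>l * c\<close> this
    shows that the conjugate of \<open>c\<close> by \<open>l\<close> moves \<open>y\<close> in the
    same way as \<open>c\<close> does.\<close>
  have "cj ((l * c) ^ 2) y = y"
    by (rule root_h_outside(2) [OF y]) (use l c C_G G_mult outside_right in auto)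
  then have "cj c (cj c' (cj (l ^ 2) y)) = y"
    by (simp add: square_mult cj_comp c'_def)
  then have "cj c (cj c' y) = cj c (y * h)"
    using root_h_outside(2) [OF y l] cyh by simp
  then have c'y: "cj c' y = y * h" by simp
  have "cj l (cj c v) = cj c' (cj l v)"
    unfolding c'_def by (rule cj_cj)
  also have "\<dots> = cj l (v * (h * z))"
    using E(1) c'y cj_hz [OF l] by (simp add: cj_mult)
  finally have cv: "cj c v = v * (h * z)" by simp
  have hv: "h * v = v * h"
    using C_h [OF E(6)] by simp
  have ce: "cj c e = e * z"
  proof -
    have "cj c e = y * (h * v) * (h * z)"
      by (simp add: e_def cj_mult cy cv mult.assoc)
    then show ?thesis
      by (simp add: hv e_def mult.assoc)
  qed
  then have cr: "cj c r = r * z"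
    using re cj_z [OF C_G [OF c]] by (auto simp: cj_mult)
  have cG: "c \<in> G" using c C_G by blast
  have "c * cj c r = r * c"
    by (rule mult_cj)
  then have "c * r * z = r * c"
    using cr by (simp add: mult.assoc)
  then have "c * r = r * c * z"
    by (metis mult.assoc zz(1) mult.right_neutral)
  then have rc: "cj r c = c * z"
    by (simp add: cj_def mult.assoc)
  have cyc_c: "sgp (cyc c)" "cyc c \<subseteq> G"
    using cG sgp_cyc_G cyc_G by auto
  have "c * z \<in> cyc c"
    using cj_nz [OF nz_cyc_square [OF l(1) r(1) cyc_c] cyc_self] rc by simp
  then have zc: "z \<in> cyc c"
    using sgp_mult_left [OF cyc_c(1) cyc_self] by simp
  have c1: "c \<noteq> 1" "c \<noteq> z"
    using neg cj_z [OF C_G] E(7) z_comm [of y] C_G [OF E(7)] by (auto simp: cj_eq_self)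
  obtain r4 where r4: "r4 \<in> cyc c" "r4 ^ 2 = z" "r4 = c \<or> (\<exists>q\<in>cyc c. r4 = q ^ 2)"
    using order4_in_cyc [OF cG c1 zc] by blast
  \<comment> \<open>Otherwise \<open>r4\<close> is a power of \<open>c ^ 2\<close> and commutes with
    \<open>e\<close>; then \<open>r4 * inverse e\<close> has square 1, hence is central in
    \<open>C\<close>, and \<open>c\<close> would fix \<open>e\<close>.\<close>
  have c2: "c ^ 2 = z"
  proof (cases "r4 = c")
    case False
    then obtain k where k: "r4 = (c ^ k) ^ 2"
      using r4(3) by (auto simp: cyc_def)
    then have r4k: "r4 = (c ^ 2) ^ k"
      by (simp add: mult.commute flip: power_mult)
    have "cj (c ^ 2) e = e"
      using ce cj_z [OF cG] by (simp add: power2_eq_square cj_comp cj_mult mult.assoc)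
    then have "c ^ 2 * e = e * c ^ 2"
      by (simp add: cj_eq_self)
    then have r4e: "r4 * e = e * r4"
      unfolding r4k by (rule commute_power)
    then have "(r4 * inverse e) ^ 2 = r4 ^ 2 * inverse e ^ 2"
      using commute_inv [of e r4] by (intro power_mult_commute) simp
    then have i: "(r4 * inverse e) ^ 2 = 1"
      using r4(2) E(4) inv_z by (simp flip: inv_power)
    have "r4 \<in> C"
      using r4(1) cyc_sub [OF sgp_C c] by blast
    then have "c * (r4 * inverse e) = (r4 * inverse e) * c"
      using involution_central [OF _ i c] E(5) C_mult C_inv by blast
    then have "cj c (r4 * inverse e) = r4 * inverse e"
      by (simp add: cj_eq_self)
    moreover have "cj c r4 = r4"
      using cyc_commute [OF r4(1)] by (simp add: cj_eq_self)
    ultimately have "inverse (e * z) = inverse e"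
      using ce by (simp add: cj_mult cj_inv)
    then have "e * z = e * 1"
      unfolding inv_eq_iff by simp
    then show ?thesis
      using z(2) by (simp only: left_cancel)
  qed (use r4 in simp)
  have "cj q c \<in> {1, c, z, c * z}"
    using cyc_square [OF cj_nz [OF nz_cyc_square [OF l(1) q(1) cyc_c] cyc_self] c2 z2] .
  moreover have qG: "q \<in> G"
    using q(1) cyc_G [OF s] by blast
  have "cj q c \<noteq> z"
    using cj_z [OF qG] c1 by (metis cj_inj)
  ultimately have "cj q c = c \<or> cj q c = c * z"
    using c1 by auto
  then have "cj r c = c"
    using cj_z [OF qG] by (auto simp: q(2) power2_eq_square cj_comp cj_mult mult.assoc)
  then show False
    using rc z(2) by (metis left_cancel mult.right_neutral)
qed

lemma special_pair2:
  assumes "a0 \<in> C" "b0 \<in> C" "cm a0 b0 \<noteq> 1"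
  obtains a b where "a \<in> C" "b \<in> C" "cm a b \<noteq> 1" "a ^ 2 \<noteq> 1" "b ^ 2 \<noteq> 1"
    "a ^ 2 \<in> {z, h, h * z}" "b ^ 2 \<in> {z, h, h * z}"
proof -
  obtain a b where ab: "a \<in> C" "b \<in> C" "cm a b \<noteq> 1" "cm a b ^ 2 = 1"
    "a ^ 2 \<in> {z, cm a b}" "b ^ 2 \<in> {z, cm a b}"
    using special_pair [OF assms] by blast
  have "cm a b \<in> {1, h, z, h * z}"
    using involutions ab sgp_cm [OF sgp_C] by blast
  then have c: "cm a b \<in> {z, h, h * z}"
    using ab(3) by auto
  have "a ^ 2 \<noteq> 1" "b ^ 2 \<noteq> 1"
    using ab(3,5,6) z(2) by auto
  then show thesis
    using that [OF ab(1-3)] ab(5,6) c by auto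
qed

text \<open>Some noncommuting pair has squares among \<open>z\<close>, \<open>h\<close> and
  \<open>h * z\<close>, and each value is impossible: roots of \<open>z\<close> have square 1 after
  multiplication by \<open>e\<close>, roots of \<open>h\<close> reduce to
  \<open>root_h_central\<close> through \<open>Y_extend\<close>, and roots of \<open>h * z\<close>
  are conjugate to roots of \<open>h\<close>.\<close>

lemma root_h_abelian:
  assumes y: "y \<in> Y" "y ^ 2 = h" and ab: "a0 \<in> C" "b0 \<in> C"
  shows "cm a0 b0 = 1"
proof (rule ccontr)
  assume "cm a0 b0 \<noteq> 1"
  then obtain a b where ab: "a \<in> C" "b \<in> C" "cm a b \<noteq> 1" "a ^ 2 \<in> {z, h, h * z}"
    using special_pair2 ab by metis
  have l: "t \<in> G" "t \<notin> C" using t C_mem by auto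
  define v e where "v = cj t y" and "e = y * v"
  note E = root_h_e [OF y l, folded v_def, folded e_def]
  have cv: "cj c v = v" if "c \<in> C" for c
  proof -
    have "cj c v = cj t (cj (t * c * inverse t) y)"
      by (simp add: v_def cj_def mult.assoc)
    moreover have "t * c * inverse t \<in> C"
      using cj_C [OF that G_inv [OF t]] by (simp add: cj_def)
    ultimately show ?thesis
      using root_h_central [OF y] by (simp add: v_def)
  qed
  have ec: "e * c = c * e" if "c \<in> C" for c
    using cv [OF that] root_h_central [OF y that] by (simp add: e_def flip: cj_eq_self) (simp add: cj_mult)
  have noncentral: False if "\<And>c. c \<in> C \<Longrightarrow> a * c = c * a"
    using that [OF ab(2)] ab(3) by (simp add: cm_eq_one_iff)
  have h_case: "x * c = c * x" if x: "x \<in> C" "x ^ 2 = h" "c \<in> C" for x c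
  proof (cases "x \<in> Y")
    case True
    then show ?thesis
      using root_h_central [OF True x(2,3)] by (simp add: cj_eq_self)
  next
    case False
    then have w: "inverse x * z \<in> Y"
      using Y_extend x Y(3) by simp
    have xG: "inverse x \<in> G" using x C_G G_inv by blast
    have "(inverse x * z) ^ 2 = inverse x ^ 2 * z ^ 2"
      by (rule power_mult_commute) (rule z_comm [OF xG])
    then have "(inverse x * z) ^ 2 = h"
      using x(2) z2 inv_h by (simp flip: inv_power)
    then have "cj c (inverse x * z) = inverse x * z"
      using root_h_central w x(3) by blast
    then have "cj c x = x"
      using cj_z [OF C_G [OF x(3)]] by (simp add: cj_mult cj_inv)
    then show ?thesis
      by (simp add: cj_eq_self)
  qed
  consider "a ^ 2 = z" | "a ^ 2 = h" | "a ^ 2 = h * z"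
    using ab(4) by blast
  then show False
  proof cases
    case 1
    have "(a * e) ^ 2 = a ^ 2 * e ^ 2"
      by (rule power_mult_commute) (use ec [OF ab(1)] in simp)
    then have i: "(a * e) ^ 2 = 1"
      using 1 E(4) by simp
    have "a * c = c * a" if "c \<in> C" for c
    proof -
      have "cj c (a * e) = a * e"
        using involution_central [OF C_mult [OF ab(1) E(5)] i that] by (simp add: cj_eq_self)
      moreover have "cj c e = e"
        using ec [OF that] by (simp add: cj_eq_self)
      ultimately show ?thesis
        by (simp add: cj_mult cj_eq_self)
    qed
    then show False using noncentral by blast
  next
    case 2
    then show False using noncentral h_case ab(1) by blast
  next
    case 3
    have "cj t a ^ 2 = h"
      using 3 cj_hz [OF l] by (metis cj_power)
    then have "cj t a * cj t b = cj t b * cj t a"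
      using h_case [of "cj t a" "cj t b"] cj_C ab(1,2) t by blast
    then have "cj t (a * b) = cj t (b * a)"
      by (simp add: cj_mult)
    then show False
      using ab(3) by (simp add: cm_eq_one_iff)
  qed
qed

end

section \<open>Actions on cyclic groups of order 4, and the case without roots of h in Y\<close>

context socle2 begin

lemma norm4:
  assumes c: "c \<in> G" "c ^ 2 = z" and q: "q \<in> G" "nz q (cyc c)"
  shows "cj q c = c \<or> cj q c = c * z"
proof -
  have "cj q c \<in> {1, c, z, c * z}"
    using cyc_square [OF cj_nz [OF q(2) cyc_self] c(2) z2] .
  moreover have "cj q c \<noteq> 1"
    using c z(2) by auto
  moreover have "cj q c \<noteq> z"
  proof
    assume "cj q c = z"
    then have "c = z"
      using cj_z [OF q(1)] by (metis cj_inj)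
    then show False using c z2 z(2) by simp
  qed
  ultimately show ?thesis by blast
qed

lemma norm4_square: "c \<in> G \<Longrightarrow> c ^ 2 = z \<Longrightarrow> q \<in> G \<Longrightarrow> nz q (cyc c) \<Longrightarrow> cj (q ^ 2) c = c"
  using norm4 [of c q] by (auto simp: power2_eq_square cj_comp cj_mult cj_z mult.assoc)

lemma cj_swap_z:
  assumes "f \<in> G" "c \<in> G" "cj f c = c * z"
  shows "cj c f = f * z"
proof -
  have "f * (c * z) = c * f"
    using mult_cj [of f c] assms(3) by simp
  then have "f * c * z * z = c * f * z"
    by (simp add: mult.assoc)
  then have "f * c = c * (f * z)"
    by (simp add: mult.assoc)
  then show ?thesis
    by (simp add: cj_def mult.assoc)
qed

end

context tight begin

lemma Y_small:
  assumes no: "\<And>y. y \<in> Y \<Longrightarrow> y ^ 2 \<noteq> h" and y: "y \<in> Y"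
  shows "y = 1 \<or> y = h"
proof (rule ccontr)
  assume neg: "\<not> (y = 1 \<or> y = h)"
  have yG: "y \<in> G" "y \<noteq> 1" using y Y CG neg by auto
  define b where "b = y ^ 2 ^ (ht y - 1)"
  have b: "b \<in> Y" "b \<noteq> 1" "b ^ 2 = 1"
    using bottom [OF yG] sgp_power [OF Y(1) y] by (auto simp: b_def)
  have "h * z \<notin> Y"
    using sgp_mult_left [OF Y(1,3)] Y(4) by simp
  then have bh: "b = h"
    using involutions [of b] b Y by auto
  have "ht y \<noteq> 0"
    using yG ht_eq_0 by simp
  moreover have "ht y \<noteq> 1"
    using bh neg by (auto simp: b_def)
  ultimately obtain k where "ht y = Suc (Suc k)"
    by (metis One_nat_def not0_implies_Suc)
  then have "(y ^ 2 ^ k) ^ 2 = h"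
    using bh by (simp add: b_def mult.commute flip: power_mult)
  then show False
    using no sgp_power [OF Y(1) y] by blast
qed

text \<open>Here \<open>Y\<close> is just \<open>{1, h}\<close>. If the claim fails,
  \<open>f = x ^ 2\<close> has square \<open>z\<close> and moves some \<open>c\<close> of order 4.
  Outside elements that move \<open>f\<close> have square \<open>f * h\<close> up to
  \<open>z\<close>. Multiplying a suitable one by \<open>c\<close> yields an outside
  \<open>w\<close> with such a square, although \<open>w\<close> fixes \<open>f\<close> and moves
  \<open>h\<close>, hence moves its own square.\<close>

lemma noncommuting_square:
  assumes x: "x \<in> C" and v: "v \<in> C" "cm x v \<noteq> 1"
  shows "x ^ 2 = z"
proof (rule ccontr)
  assume xz: "x ^ 2 \<noteq> z"
  have l: "t \<in> G" "t \<notin> C" using t C_mem by auto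
  have Ys: "y = 1 \<or> y = h" if "y \<in> Y" for y
    using Y_small that root_h_abelian x v by metis
  have hz: "h * z = z * h"
    using z_comm [OF h(1)] .
  have hz2: "(h * z) ^ 2 = 1"
    using power_mult_commute [OF hz] h2 z2 by simp
  \<comment> \<open>A root of \<open>h\<close> cannot lie in \<open>{1, h}\<close>, and
    \<open>Y_extend\<close> would then make it an element of square 1.\<close>
  have Q4h: "u ^ 2 \<noteq> h" if u: "u \<in> C" for u
  proof
    assume u2: "u ^ 2 = h"
    have "u \<notin> Y"
    proof
      assume "u \<in> Y"
      then have "u ^ 2 = 1"
        using Ys [of u] h2 by auto
      then show False using u2 h1 by simp
    qed
    then have "inverse u * z \<in> Y"
      using Y_extend u u2 Y(3) by simp
    then have "inverse u * z = 1 \<or> inverse u * z = h"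
      by (rule Ys)
    then have "inverse u * z * z = z \<or> inverse u * z * z = h * z" by auto
    then have "inverse u = z \<or> inverse u = h * z"
      by (simp add: mult.assoc)
    then have "inverse u ^ 2 = 1"
      using z2 hz2 by metis
    then have "u ^ 2 = 1"
      by (metis inv_inv inv_one inv_power)
    then show False using u2 h1 by simp
  qed
  have Q4: "u ^ 2 = z" if u: "u \<in> C" "u ^ 2 \<noteq> 1" "(u ^ 2) ^ 2 = 1" for u
  proof -
    have "u ^ 2 \<in> {1, h, z, h * z}"
      using involutions u C_power by blast
    moreover have "u ^ 2 \<noteq> h * z"
    proof
      assume "u ^ 2 = h * z"
      then have "cj t u ^ 2 = h"
        using cj_hz [OF l] by (metis cj_power)
      then show False using Q4h cj_C u(1) t by blast
    qed
    ultimately show ?thesis using Q4h u by auto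
  qed
  have xG: "x \<in> G" using x C_G by blast
  define f where "f = x ^ 2"
  have f: "f \<in> C" "f \<in> G" "f \<noteq> z"
    using xz C_power x C_G by (auto simp: f_def)
  have f1: "f \<noteq> 1"
    using involution_central [OF x _ v(1)] v(2) by (auto simp: f_def cm_eq_one_iff)
  have f2: "f ^ 2 \<noteq> 1"
    using Q4 [OF x] f f1 by (auto simp: f_def)
  have "z \<in> cyc f"
  proof -
    have n0: "ht f \<noteq> 0" "ht f \<noteq> 1"
      using power_ht [OF f(2)] f1 f2 ht_eq_0 [OF f(2)] by auto
    then obtain k where k: "ht f = Suc (Suc k)"
      by (metis One_nat_def not0_implies_Suc)
    define r where "r = f ^ 2 ^ k"
    have r: "r ^ 2 = f ^ 2 ^ (ht f - 1)"
      by (simp add: r_def k mult.commute flip: power_mult)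
    have "r ^ 2 = z"
      by (rule Q4) (use bottom [OF f(2) f1] r C_power [OF f(1)] in \<open>auto simp: r_def\<close>)
    then show ?thesis
      using r power_cyc by metis
  qed
  then obtain r where r: "r \<in> cyc f" "r ^ 2 = z" "r = f \<or> (\<exists>q\<in>cyc f. r = q ^ 2)"
    using order4_in_cyc f f1 by blast
  have rC: "r \<in> C" using r(1) cyc_sub [OF sgp_C f(1)] by blast
  obtain a b where ab: "a \<in> C" "b \<in> C" "cm a b \<noteq> 1" "a ^ 2 \<noteq> 1" "b ^ 2 \<noteq> 1"
    "a ^ 2 \<in> {z, h, h * z}" "b ^ 2 \<in> {z, h, h * z}"
    using special_pair2 x v by metis
  have "y ^ 2 = 1" if "y \<in> {z, h, h * z}" for y
    using that z2 h2 hz2 by auto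
  then have ab2: "a ^ 2 = z" "b ^ 2 = z"
    using Q4 [OF ab(1,4)] Q4 [OF ab(2,5)] ab(6,7) by blast+
  \<comment> \<open>If \<open>r\<close> commuted with both, \<open>r * inverse a\<close> would have
    square 1 and be central in \<open>C\<close>, so \<open>a\<close> would commute with
    \<open>b\<close>.\<close>
  have "\<exists>c\<in>{a, b}. cj r c \<noteq> c"
  proof (rule ccontr)
    assume "\<not> (\<exists>c\<in>{a, b}. cj r c \<noteq> c)"
    then have ra: "a * r = r * a" and rb: "b * r = r * b"
      by (auto simp: cj_eq_self)
    have "(r * inverse a) ^ 2 = r ^ 2 * inverse a ^ 2"
      using commute_inv [OF ra] by (intro power_mult_commute) simp
    then have "(r * inverse a) ^ 2 = 1"
      using r(2) ab2 inv_z by (simp flip: inv_power)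
    then have "b * (r * inverse a) = (r * inverse a) * b"
      using involution_central C_mult C_inv rC ab by blast
    then have "r * (b * inverse a) = r * (inverse a * b)"
      using rb by (metis mult.assoc)
    then have "inverse a * b = b * inverse a" by simp
    then have "inverse (inverse a) * b = b * inverse (inverse a)"
      by (rule commute_inv)
    then show False
      using ab(3) by (simp add: cm_eq_one_iff)
  qed
  then obtain c where c: "c \<in> C" "c ^ 2 = z" "cj r c \<noteq> c"
    using ab ab2 by blast
  have cG: "c \<in> G" and cyc_c: "sgp (cyc c)" "cyc c \<subseteq> G"
    using c C_G sgp_cyc_G cyc_G by auto
  have rf: "r = f"
  proof (rule ccontr)
    assume "r \<noteq> f"
    then obtain q where q: "q \<in> cyc f" "r = q ^ 2"
      using r(3) by blast
    have "nz q (cyc c)"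
      using nz_cyc_square [OF xG _ cyc_c] q by (simp add: f_def)
    moreover have "q \<in> G"
      using q(1) cyc_G [OF f(2)] by blast
    ultimately have "cj r c = c"
      using norm4_square cG c(2) q(2) by simp
    then show False using c by blast
  qed
  have f2z: "f ^ 2 = z" using r rf by simp
  have nzf: "nz f H" if "sgp H" "H \<subseteq> G" for H
    using nz_square [OF that xG] by (simp add: f_def)
  have fc: "cj f c = c * z"
    using norm4 [OF cG c(2) f(2) nzf [OF cyc_c]] c(3) rf by simp
  have cf: "cj c f = f * z"
    by (rule cj_swap_z [OF f(2) cG fc])
  \<comment> \<open>The quotient of \<open>f\<close> and its conjugate \<open>g\<close> is
    \<open>cm f l\<close>, a power of \<open>l\<close>, so \<open>l\<close> fixes it. Once
    \<open>f\<close> and \<open>g\<close> commute it has square 1, which leaves only 1 and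
    \<open>z\<close>.\<close>
  have lf: "cj l f = f \<or> cj l f = f * z" if l: "l \<in> G" "l \<notin> C" for l
  proof -
    define x1 g where "x1 = cj l x" and "g = cj l f"
    have C1: "x1 \<in> C" "g \<in> C" "x1 \<in> G" "g \<in> G"
      using cj_C x f l C_G by (auto simp: x1_def g_def)
    have gx: "g = x1 ^ 2"
      by (simp add: g_def f_def x1_def cj_power)
    have g2: "g ^ 2 = z"
      using f2z cj_z [OF l(1)] by (simp add: g_def flip: cj_power)
    have x14: "x1 ^ 4 = z"
      using g2 gx by (simp flip: power_mult)
    \<comment> \<open>\<open>f\<close> acts on the cyclic group of \<open>x1\<close>, whose fourth
      power is \<open>z\<close>. If it moved \<open>g\<close>, the exponent would be 3 modulo 4 and
      \<open>x1 * f\<close> would have square 1 or \<open>z\<close>; then \<open>f\<close> changes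
      \<open>x1\<close> by at most a factor \<open>z\<close> and fixes \<open>g\<close>.\<close>
    have fg: "cj f g = g"
    proof (rule ccontr)
      assume ng: "cj f g \<noteq> g"
      have "cj f x1 \<in> cyc x1"
        using cj_nz [OF nzf cyc_self] sgp_cyc_G cyc_G C1 by blast
      then obtain k where "cj f x1 = x1 ^ k"
        by (auto simp: cyc_def)
      also have "\<dots> = (x1 ^ 4) ^ (k div 4) * x1 ^ (k mod 4)"
        by (simp flip: power_mult power_add)
      finally have k: "cj f x1 = z ^ (k div 4) * x1 ^ (k mod 4)"
        by (simp add: x14)
      define \<zeta> where "\<zeta> = z ^ (k div 4)"
      have \<zeta>: "\<zeta> = 1 \<or> \<zeta> = z"
      proof -
        have "\<zeta> \<in> cyc z" by (simp add: \<zeta>_def power_cyc)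
        then show ?thesis using involution_cyc z2 by blast
      qed
      have \<zeta>f: "cj f \<zeta> = \<zeta>" and \<zeta>c: "\<zeta> * x1 ^ j = x1 ^ j * \<zeta>" and \<zeta>2: "\<zeta> ^ 2 = 1" for j
        using \<zeta> cj_z [OF f(2)] z_comm [OF G_power [OF C1(3)], of j] z2 by auto
      have fgk: "cj f g = (\<zeta> * x1 ^ (k mod 4)) ^ 2"
        by (simp add: gx cj_power k \<zeta>_def)
      also have "\<dots> = (x1 ^ (k mod 4)) ^ 2"
        using power_mult_commute [OF \<zeta>c] \<zeta>2 by simp
      finally have fgk: "cj f g = g ^ (k mod 4)"
        by (simp add: gx mult.commute flip: power_mult)
      have "g \<noteq> 1" "g \<noteq> z"
        using g2 z2 z(2) by auto
      moreover have "cj f z = z" using cj_z f by blast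
      moreover have "k mod 4 < 4" by simp
      ultimately have k3: "k mod 4 = 3"
      proof -
        have "k mod 4 \<noteq> 0"
        proof
          assume "k mod 4 = 0"
          then have "cj f g = 1"
            using fgk by simp
          then show False using \<open>g \<noteq> 1\<close> by simp
        qed
        moreover have "k mod 4 \<noteq> 1"
          using fgk ng by auto
        moreover have "k mod 4 \<noteq> 2"
        proof
          assume "k mod 4 = 2"
          then have "cj f g = cj f z"
            using fgk g2 \<open>cj f z = z\<close> by simp
          then show False using \<open>g \<noteq> z\<close> by simp
        qed
        ultimately show ?thesis
          using \<open>k mod 4 < 4\<close> by linarith
      qed
      define w where "w = x1 * f"
      have wC: "w \<in> C" "w \<in> G"
        using C1 f C_mult C_G by (auto simp: w_def)
      have "w ^ 2 = x1 * (f * f * cj f x1)"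
        by (simp add: w_def power2_eq_square cj_def mult.assoc)
      also have "\<dots> = x1 * (z * (\<zeta> * x1 ^ 3))"
        using f2z k k3 by (simp add: power2_eq_square \<zeta>_def)
      also have "\<dots> = z * \<zeta> * x1 ^ 4"
        using z_comm [OF C1(3)] \<zeta>c [of 1] by (simp add: numeral_eq_Suc) (metis mult.assoc)
      also have "\<dots> = \<zeta>"
        using x14 \<zeta> by auto
      finally have w2: "w ^ 2 = \<zeta>" .
      have "cj f w = w \<or> cj f w = w * z"
      proof (cases "\<zeta> = 1")
        case True
        then have "f * w = w * f"
          using involution_central wC f w2 by simp
        then show ?thesis by (simp add: cj_eq_self)
      next
        case False
        then show ?thesis
          using norm4 [OF wC(2) _ f(2) nzf] sgp_cyc_G cyc_G wC w2 \<zeta> by blast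
      qed
      then have "cj f x1 = x1 \<or> cj f x1 = x1 * z"
      proof
        assume "cj f w = w"
        then have "cj f x1 * f = x1 * f"
          by (simp add: w_def cj_mult cj_eq_self [THEN iffD2])
        then show ?thesis by simp
      next
        assume "cj f w = w * z"
        then have "cj f x1 * f = x1 * (f * z)"
          by (simp add: w_def cj_mult cj_eq_self [THEN iffD2] mult.assoc)
        also have "f * z = z * f"
          using z_comm f by blast
        finally have "cj f x1 * f = x1 * z * f"
          by (simp add: mult.assoc)
        then show ?thesis by simp
      qed
      then have "cj f g = g"
        using power_mult_commute [OF z_comm [OF C1(3)], of 2] z2 by (auto simp: gx cj_power)
      then show False using ng by blast
    qed
    define e where "e = inverse f * g"
    have gf: "g * f = f * g"
      using fg by (simp add: cj_eq_self)
    have "e ^ 2 = inverse f ^ 2 * g ^ 2"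
      unfolding e_def using commute_inv [of f g] gf by (intro power_mult_commute) simp
    then have e2: "e ^ 2 = 1"
      using f2z g2 inv_z by (simp flip: inv_power)
    have eC: "e \<in> C"
      unfolding e_def using f C1 C_mult C_inv by blast
    have "cm f l \<in> cyc l"
      by (rule cm_in_normalised [OF _ nzf cyc_self]) (use l sgp_cyc_G cyc_G in auto)
    then have "e \<in> cyc l"
      by (simp add: e_def g_def cm_cj)
    then have "cj l e = e"
      using cyc_commute by (intro cj_commute) blast
    then have "e = 1 \<or> e = z"
      using involution_outside eC e2 l by blast
    moreover have "g = f * e" by (simp add: e_def)
    ultimately show ?thesis by (auto simp: g_def)
  qed
  have zc: "z \<in> cyc m" "m ^ 2 \<noteq> 1" if m: "m \<in> G" "m \<notin> C" "cj m f = f * z" for m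
  proof -
    have "cm f m \<in> cyc m"
      by (rule cm_in_normalised [OF _ nzf cyc_self]) (use m sgp_cyc_G cyc_G in auto)
    then show zm: "z \<in> cyc m"
      using m(3) by (simp add: cm_cj)
    show "m ^ 2 \<noteq> 1"
      using involution_cyc [OF zm] z(2) C_mem(2) m(2) by auto
  qed
  \<comment> \<open>Write a root \<open>r'\<close> of \<open>z\<close> among the powers of
    \<open>m ^ 2\<close> as \<open>f * e\<close>. As \<open>m\<close> fixes \<open>r'\<close> but
    moves \<open>f\<close>, it moves the involution \<open>e\<close>, so \<open>e\<close> is
    \<open>h\<close> or \<open>h * z\<close>. And \<open>r'\<close> is \<open>m ^ 2\<close> itself,
    because a proper square would fix \<open>c\<close>.\<close>
  have sq: "m ^ 2 = f * h \<or> m ^ 2 = f * h * z" if m: "m \<in> G" "m \<notin> C" "cj m f = f * z" for m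
  proof -
    have mh: "m * h \<in> G" "m * h \<notin> C"
      using m C_mem h G_mult outside_right by auto
    have "cj h f = f" "cj h z = z"
      using C_h [OF f(1)] cj_z [OF h(1)] by (auto simp: cj_eq_self)
    then have "cj (m * h) f = f * z"
      using m(3) by (simp add: cj_comp cj_mult)
    then have "(m * h) ^ 2 \<noteq> 1"
      using zc mh by blast
    then have mz: "m ^ 2 \<noteq> z"
      using square_h m by auto
    have "z \<in> cyc (m ^ 2)"
      using cyc_outside_C m zc C_mem by blast
    then obtain r' where r': "r' \<in> cyc (m ^ 2)" "r' ^ 2 = z" "r' = m ^ 2 \<or> (\<exists>q\<in>cyc (m ^ 2). r' = q ^ 2)"
      using order4_in_cyc zc mz m G_power by metis
    have r'C: "r' \<in> C"
      using r'(1) cyc_sub [OF sgp_C square_C [OF m(1)]] by blast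
    have "cj (m ^ 2) f = f"
      using m(3) cj_z [OF m(1)] by (simp add: power2_eq_square cj_comp cj_mult mult.assoc)
    then have "r' * f = f * r'"
      using cyc_commute [OF r'(1)] by (simp add: cj_eq_self)
    then have fr: "inverse f * r' = r' * inverse f"
      using commute_inv [of f r'] by simp
    define e where "e = inverse f * r'"
    have "e ^ 2 = inverse f ^ 2 * r' ^ 2"
      unfolding e_def by (rule power_mult_commute [OF fr])
    then have e2: "e ^ 2 = 1"
      using f2z r'(2) inv_z by (simp flip: inv_power)
    have eC: "e \<in> C"
      unfolding e_def using f r'C C_mult C_inv by blast
    have r'e: "r' = f * e" by (simp add: e_def)
    have "cj m r' = r'"
      by (rule cj_commute) (use cyc_commute [OF r'(1)] in \<open>simp add: power_commutes\<close>)
    then have "f * z * cj m e = f * e"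
      using m(3) by (simp add: r'e cj_mult)
    then have "z * (z * cj m e) = z * e"
      by (simp add: mult.assoc)
    then have "cj m e = e * z"
      using z_comm [OF C_G [OF eC]] by simp
    then have eh: "e = h \<or> e = h * z"
      using involution_outside' eC e2 m by blast
    have "r' = m ^ 2"
    proof (rule ccontr)
      assume "r' \<noteq> m ^ 2"
      then obtain q where q: "q \<in> cyc (m ^ 2)" "r' = q ^ 2"
        using r'(3) by blast
      have "q \<in> G"
        using q(1) cyc_G [OF G_power [OF m(1)]] by blast
      then have "cj r' c = c"
        using norm4_square [OF cG c(2)] nz_cyc_square [OF m(1) q(1) cyc_c] q(2) by simp
      moreover have "cj e c = c"
        using involution_central [OF eC e2 c(1)] by (simp add: cj_eq_self)
      ultimately have "c * z = c"
        using fc cj_z [OF C_G [OF eC]] by (simp add: r'e cj_comp cj_mult)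
      then show False
        using z(2) by (metis left_cancel mult.right_neutral)
    qed
    then show ?thesis
      using eh r'e by (auto simp: mult.assoc)
  qed
  obtain m where m: "m \<in> G" "m \<notin> C" "cj m f = f * z"
  proof (cases "cj t f = f")
    case True
    then have "cj (t * c) f = f * z"
      using cf by (simp add: cj_comp)
    then show thesis
      using that [of "t * c"] t cG G_mult outside_right c(1) l(2) by blast
  next
    case False
    then show thesis
      using that [of t] lf [OF l] l by blast
  qed
  \<comment> \<open>The square of \<open>x\<close> moves \<open>c\<close>, so \<open>P3\<close>
    applies to \<open>x\<close>. Since \<open>x\<close> commutes with \<open>f\<close>, the
    resulting \<open>m'\<close> still moves \<open>f\<close>.\<close>
  have "\<not> nz x (cyc c)"
    using norm4_square [OF cG c(2) xG] c(3) rf by (auto simp: f_def)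
  then obtain i where i: "nz (x ^ i * m) (cyc c)"
    using P3 [OF cyc_c xG m(1)] by blast
  define m' where "m' = x ^ i * m"
  have m': "m' \<in> G" "m' \<notin> C"
    using m x xG G_mult G_power outside_left C_power by (auto simp: m'_def)
  have "cj (x ^ i) f = f"
    by (simp add: cj_eq_self f_def flip: power_add)
  then have m'f: "cj m' f = f * z"
    using m(3) by (simp add: m'_def cj_comp)
  have m'c: "cj m' c = c \<or> cj m' c = c * z"
    using norm4 [OF cG c(2) m'(1)] i by (simp add: m'_def)
  define w where "w = m' * c"
  have w: "w \<in> G" "w \<notin> C"
    using m' c cG G_mult outside_right by (auto simp: w_def)
  have cc: "c * c = z" using c(2) by (simp add: power2_eq_square)
  have czc: "c * (z * c) = 1"
    using z_comm [OF cG] cc by (metis mult.assoc zz(1))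
  have "w ^ 2 = m' ^ 2 * z \<or> w ^ 2 = m' ^ 2"
    using m'c cc czc by (auto simp: w_def square_mult mult.assoc)
  then have w2: "w ^ 2 = f * h \<or> w ^ 2 = f * h * z"
    using sq [OF m' m'f] by (auto simp: mult.assoc)
  have wf: "cj w f = f"
    using m'f cf cj_z [OF cG] by (simp add: w_def cj_comp cj_mult mult.assoc)
  have "cj w (w ^ 2) = w ^ 2"
    by (simp add: cj_eq_self power_commutes)
  moreover have "cj w (f * h) = f * h * z"
    using wf cj_h [OF w] by (simp add: cj_mult mult.assoc)
  moreover have "cj w (f * h * z) = f * h"
    using wf cj_h [OF w] cj_z [OF w(1)] by (simp add: cj_mult mult.assoc)
  ultimately have "f * h * z = f * h"
    using w2 by auto
  then show False
    using z(2) by (metis left_cancel mult.right_neutral)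
qed

text \<open>\<open>u\<close>, \<open>v\<close> and \<open>u * v\<close> all have square
  \<open>z\<close>; these quaternion relations determine the commutator.\<close>

lemma noncommuting_pair:
  assumes "u \<in> C" "v \<in> C" "cm u v \<noteq> 1"
  shows "u ^ 2 = z" "cm u v = z"
proof -
  show u: "u ^ 2 = z"
    using noncommuting_square assms by blast
  have "cm v u \<noteq> 1" "cm (u * v) v \<noteq> 1"
    using assms(3) by (auto simp: cm_eq_one_iff simp flip: mult.assoc)
  then have v: "v ^ 2 = z" and uv: "(u * v) ^ 2 = z"
    using noncommuting_square assms C_mult by blast+
  have inv: "inverse x = x * z" if "x ^ 2 = z" for x
    by (rule inv_unique) (use that in \<open>simp add: power2_eq_square flip: mult.assoc\<close>)
  have "cm u v = u * (z * v) * z * u * v"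
    using inv [OF u] inv [OF v] by (simp add: cm_def mult.assoc)
  also have "z * v = v * z"
    using z_comm C_G assms by metis
  finally have "cm u v = (u * v) ^ 2"
    by (simp add: power2_eq_square mult.assoc)
  then show "cm u v = z" using uv by simp
qed

end

section \<open>Quotients as groups of permutations\<close>

instance Perm.perm :: (type) grp
  by standard (rule perm.left_inverse)

text \<open>Extension by the identity makes a bijection of a finite set a finitely supported
  permutation, an element of a type of class \<open>grp\<close>.\<close>

definition perm_on :: "'b set \<Rightarrow> ('b \<Rightarrow> 'b) \<Rightarrow> 'b Perm.perm" where
  "perm_on D f = Perm.Perm (\<lambda>x. if x \<in> D then f x else x)"

lemma apply_perm_on:
  assumes "finite D" "bij_betw f D D"
  shows "Perm.apply (perm_on D f) x = (if x \<in> D then f x else x)"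
proof -
  let ?f = "\<lambda>x. if x \<in> D then f x else x"
  have "bij_betw ?f D D"
    using assms(2) by (subst bij_betw_cong [of D _ f]) auto
  moreover have "bij_betw ?f (- D) (- D)"
    by (subst bij_betw_cong [of _ _ id]) auto
  ultimately have "bij_betw ?f (D \<union> - D) (D \<union> - D)"
    by (rule bij_betw_combine) auto
  then have "bij ?f" by simp
  moreover have "finite {x. ?f x \<noteq> x}"
    using assms(1) by (rule rev_finite_subset) auto
  ultimately show ?thesis
    unfolding perm_on_def by (simp add: Perm.Perm_inverse)
qed

lemma perm_on_mult:
  assumes "finite D" "bij_betw f D D" "bij_betw g D D" "\<And>x. x \<in> D \<Longrightarrow> k x = f (g x)"
  shows "perm_on D k = perm_on D f * perm_on D g"
proof (rule perm_eqI)
  fix x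
  have "bij_betw (f \<circ> g) D D"
    using assms bij_betw_trans by blast
  then have "bij_betw k D D"
    using assms(4) by (subst bij_betw_cong [of D _ "f \<circ> g"]) auto
  moreover have "g x \<in> D" if "x \<in> D"
    using that assms(3) bij_betwE by blast
  ultimately show "Perm.apply (perm_on D k) x = Perm.apply (perm_on D f * perm_on D g) x"
    using assms by (simp add: apply_perm_on apply_times)
qed

context grp begin

lemma nz_finite:
  assumes "finite H" "\<And>r. r \<in> H \<Longrightarrow> cj x r \<in> H"
  shows "nz x H"
proof -
  have "inj_on (cj x) H"
    by (simp add: inj_on_def)
  then have im: "cj x ` H = H"
    using assms endo_inj_surj [of H "cj x"] by blast
  have "x * r * inverse x \<in> H" if "r \<in> H" for r
  proof -
    have "r \<in> cj x ` H"
      using im that by simp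
    then obtain s where "s \<in> H" "r = cj x s"
      by (rule imageE)
    then show ?thesis by (simp add: cj_def mult.assoc)
  qed
  then show ?thesis
    using assms(2) by (simp add: nz_def cj_def)
qed

end

context pgrp begin

text \<open>\<open>G\<close> acts on the left cosets of \<open>R\<close> by left multiplication,
  with kernel \<open>R\<close> because \<open>R\<close> is normal. The target type depends only on
  the type of the elements of \<open>G\<close>.\<close>

lemma quotient_hom:
  assumes R: "sgp R" "R \<subseteq> G" "\<And>x. x \<in> G \<Longrightarrow> nz x R"
  obtains f :: "'a \<Rightarrow> ('a set) Perm.perm"
  where "\<And>x y. x \<in> G \<Longrightarrow> y \<in> G \<Longrightarrow> f (x * y) = f x * f y"
    and "\<And>x. x \<in> G \<Longrightarrow> f x = 1 \<longleftrightarrow> x \<in> R"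
proof -
  define D where "D = (\<lambda>x. (*) x ` R) ` G"
  define f where "f g = perm_on D (\<lambda>S. (*) g ` S)" for g
  have fin: "finite D"
    using fin_G by (simp add: D_def)
  have im: "(*) g ` (*) x ` R = (*) (g * x) ` R" for g x
    by (simp add: image_image mult.assoc)
  have DD: "(*) g ` S \<in> D" if "g \<in> G" "S \<in> D" for g S
  proof -
    obtain x where "x \<in> G" "S = (*) x ` R"
      using \<open>S \<in> D\<close> by (auto simp: D_def)
    then show ?thesis
      using im [of g x] G_mult [OF \<open>g \<in> G\<close>] by (auto simp: D_def)
  qed
  have bij: "bij_betw (\<lambda>S. (*) g ` S) D D" if "g \<in> G" for g
  proof (rule bij_betw_byWitness [of _ "\<lambda>S. (*) (inverse g) ` S"])
    show "\<forall>S\<in>D. (*) (inverse g) ` (*) g ` S = S" "\<forall>S\<in>D. (*) g ` (*) (inverse g) ` S = S"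
      by (simp_all add: image_image)
  qed (use DD that G_inv in auto)
  have 1: "f (x * y) = f x * f y" if "x \<in> G" "y \<in> G" for x y
    unfolding f_def by (rule perm_on_mult [OF fin bij bij]) (simp_all add: that image_image mult.assoc)
  have "f x = 1 \<longleftrightarrow> x \<in> R" if x: "x \<in> G" for x
  proof
    assume "f x = 1"
    then have "Perm.apply (f x) R = R" by simp
    moreover have RX: "R \<in> D"
      unfolding D_def using G_one by (intro image_eqI [of _ _ 1]) auto
    ultimately have "(*) x ` R = R"
      using apply_perm_on [OF fin bij [OF x]] by (simp add: f_def)
    moreover have "x * 1 \<in> (*) x ` R"
      using sgp_one [OF R(1)] by blast
    ultimately show "x \<in> R" by simp
  next
    assume xR: "x \<in> R"
    show "f x = 1"
    proof (rule perm_eqI)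
      fix S
      have "(*) x ` S = S" if "S \<in> D"
      proof -
        obtain y where y: "y \<in> G" "S = (*) y ` R"
          using \<open>S \<in> D\<close> by (auto simp: D_def)
        have "x * y = y * cj y x"
          by (simp add: mult_cj)
        moreover have r: "cj y x \<in> R"
          using cj_nz R(3) y xR by blast
        moreover have "(*) (cj y x) ` R = R"
        proof
          show "(*) (cj y x) ` R \<subseteq> R"
            using sgp_mult [OF R(1) r] by blast
          show "R \<subseteq> (*) (cj y x) ` R"
          proof
            fix s assume "s \<in> R"
            then have "inverse (cj y x) * s \<in> R"
              using sgp_mult sgp_inv R(1) r by blast
            moreover have "s = cj y x * (inverse (cj y x) * s)" by simp
            ultimately show "s \<in> (*) (cj y x) ` R" by blast
          qed
        qed
        ultimately show ?thesis
          using y(2) im by metis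
      qed
      then show "Perm.apply (f x) S = Perm.apply 1 S"
        using apply_perm_on [OF fin bij [OF x]] by (simp add: f_def)
    qed
  qed
  then show thesis
    using that [of f] 1 by blast
qed

end

locale pgrp_hom = pgrp G p n for G :: "'a::grp set" and p n +
  fixes f :: "'a \<Rightarrow> 'b::grp"
  assumes f_mult: "\<And>x y. x \<in> G \<Longrightarrow> y \<in> G \<Longrightarrow> f (x * y) = f x * f y"
begin

lemma f_one: "f 1 = 1"
proof -
  have "f 1 * f 1 = f 1 * 1"
    using f_mult [OF G_one G_one] by simp
  then show ?thesis
    by (simp only: left_cancel)
qed

lemma f_inv: "x \<in> G \<Longrightarrow> f (inverse x) = inverse (f x)"
  using f_mult [of x "inverse x"] G_inv [of x] f_one inv_unique [of "f x" "f (inverse x)"] by simp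

lemma f_power: "x \<in> G \<Longrightarrow> f (x ^ k) = f x ^ k"
  by (induction k) (simp_all add: f_one f_mult G_power)

lemma f_cj: "x \<in> G \<Longrightarrow> y \<in> G \<Longrightarrow> f (cj y x) = cj (f y) (f x)"
  by (simp add: cj_def f_mult f_inv G_mult G_inv)

lemma f_cm: "x \<in> G \<Longrightarrow> y \<in> G \<Longrightarrow> f (cm x y) = cm (f x) (f y)"
  by (simp add: cm_def f_mult f_inv G_mult G_inv)

lemma sgp_image: "sgp H \<Longrightarrow> H \<subseteq> G \<Longrightarrow> sgp (f ` H)"
  unfolding sgp_def [of "f ` H"]
proof (intro conjI ballI)
  assume H: "sgp H" "H \<subseteq> G"
  show "1 \<in> f ` H"
    using sgp_one [OF H(1)] f_one by (metis imageI)
  show "x * y \<in> f ` H" if "x \<in> f ` H" "y \<in> f ` H" for x y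
  proof -
    obtain a b where ab: "a \<in> H" "b \<in> H" "x = f a" "y = f b"
      using \<open>x \<in> f ` H\<close> \<open>y \<in> f ` H\<close> by blast
    then have "x * y = f (a * b)"
      using f_mult [of a b] H(2) by (metis in_mono)
    then show ?thesis
      using sgp_mult [OF H(1)] ab by blast
  qed
  show "inverse x \<in> f ` H" if "x \<in> f ` H" for x
  proof -
    obtain a where a: "a \<in> H" "x = f a"
      using \<open>x \<in> f ` H\<close> by blast
    then have "inverse x = f (inverse a)"
      using f_inv [of a] H(2) by auto
    then show ?thesis
      using sgp_inv [OF H(1)] a by blast
  qed
qed

lemma sgp_vimage: "sgp H \<Longrightarrow> sgp {x \<in> G. f x \<in> H}"
  by (simp add: sgp_def [of "{x \<in> G. f x \<in> H}"] f_mult f_inv f_one G_mult G_inv G_one sgp_one sgp_mult sgp_inv)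

lemma nz_image:
  assumes "H \<subseteq> f ` G" "x \<in> G" "nz x {x \<in> G. f x \<in> H}"
  shows "nz (f x) H"
  unfolding nz_def
proof (intro conjI ballI)
  fix y assume "y \<in> H"
  then obtain g where g: "g \<in> G" "y = f g"
    using assms(1) by blast
  then have m: "g \<in> {x \<in> G. f x \<in> H}"
    using \<open>y \<in> H\<close> by simp
  show "inverse (f x) * y * f x \<in> H"
    using nzD [OF assms(3) m] g assms(2) by (simp add: f_mult f_inv G_mult G_inv)
  show "f x * y * inverse (f x) \<in> H"
    using nzD' [OF assms(3) m] g assms(2) by (simp add: f_mult f_inv G_mult G_inv)
qed

lemma pgrp_image: "pgrp (f ` G) p n"
proof
  show "x ^ p ^ n = 1" if "x \<in> f ` G" for x
    using that exp_G f_one by (auto simp flip: f_power)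
qed (use prime_p sgp_image [OF sgp_G] fin_G in auto)

end

locale few_conj_hom = pgrp_hom + few_conj
begin

text \<open>Every condition asks whether certain elements normalise a subgroup, and this is tested
  on the preimage of that subgroup.\<close>

lemma few_conj_image: "few_conj (f ` G) p n"
proof (rule few_conj.intro [OF pgrp_image], unfold_locales)
  fix H :: "'b set" and x y
  assume H: "sgp H" "H \<subseteq> f ` G" and xy: "x \<in> f ` G" "y \<in> f ` G"
  obtain g where g: "g \<in> G" "x = f g" using xy by blast
  obtain k where k: "k \<in> G" "y = f k" using xy by blast
  let ?H = "{x \<in> G. f x \<in> H}"
  have S: "sgp ?H" "?H \<subseteq> G"
    using sgp_vimage H by auto
  show "nz (cm x y) H"
    using nz_image [OF H(2) _ P2 [OF S g(1) k(1)]] g k G_cm by (simp add: f_cm)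
  show "\<exists>i<p. nz (x ^ i * y) H" if n: "\<not> nz x H"
  proof -
    have "\<not> nz g ?H"
      using nz_image [OF H(2) g(1)] n g by blast
    then obtain i where "i < p" "nz (g ^ i * k) ?H"
      using P3 [OF S g(1) k(1)] by blast
    then show ?thesis
      using nz_image [OF H(2), of "g ^ i * k"] g k G_mult G_power by (auto simp: f_mult f_power)
  qed
next
  fix H :: "'b set" and x
  assume H: "sgp H" "H \<subseteq> f ` G" and xy: "x \<in> f ` G"
  obtain g where g: "g \<in> G" "x = f g" using xy by blast
  let ?H = "{x \<in> G. f x \<in> H}"
  have S: "sgp ?H" "?H \<subseteq> G"
    using sgp_vimage H by auto
  show "nz (x ^ p) H"
    using nz_image [OF H(2) _ P1 [OF S g(1)]] g G_power by (simp add: f_power)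
qed

end

section \<open>Transfer from tight quotients\<close>

context socle2 begin

text \<open>It suffices to keep the involution \<open>w0\<close> in \<open>cyc w\<close>, or its
  conjugate, out of \<open>Y\<close>. For \<open>w0\<close> among \<open>h\<close>,
  \<open>z\<close>, \<open>h * z\<close> this follows from \<open>h \<in> Y\<close> and
  \<open>z \<notin> Y\<close>; otherwise \<open>w0 * z\<close> is put into \<open>Y\<close>, and
  \<open>w0\<close> cannot be there as well.\<close>

lemma maximal_avoiding:
  assumes w: "w \<in> C" "w \<noteq> 1"
  obtains Y where "sgp Y" "Y \<subseteq> C" "h \<in> Y" "z \<notin> Y" "\<not> (w \<in> Y \<and> cj t w \<in> Y)"
    "\<And>S. sgp S \<Longrightarrow> Y \<subseteq> S \<Longrightarrow> S \<subseteq> C \<Longrightarrow> S \<noteq> Y \<Longrightarrow> z \<in> S"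
proof -
  define w0 where "w0 = w ^ 2 ^ (ht w - 1)"
  have wG: "w \<in> G" using w C_G by blast
  have w0: "w0 \<noteq> 1" "w0 ^ 2 = 1" "w0 \<in> C" "w0 \<in> G"
    using bottom [OF wG w(2)] C_power [OF w(1)] C_G by (auto simp: w0_def)
  have ww [simp]: "w0 * w0 = 1" "w0 * (w0 * x) = x" for x
    using w0(2) by (simp_all add: power2_eq_square flip: mult.assoc)
  have wz: "z * w0 = w0 * z" and wh: "w0 * h = h * w0" and hz: "z * h = h * z"
    using z_comm w0 C_h h by auto
  have comm: "z * (w0 * x) = w0 * (z * x)" "w0 * (h * x) = h * (w0 * x)" "z * (h * x) = h * (z * x)" for x
    using wz wh hz by (metis mult.assoc)+
  have iw: "inverse w0 = w0"
    using inverse_involution w0 by blast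
  define u where "u = w0 * z"
  define S0 where "S0 = (if w0 \<in> {h, z, h * z} then {1, h} else {1, h, u, h * u})"
  have "sgp S0 \<and> S0 \<subseteq> C \<and> h \<in> S0 \<and> z \<notin> S0"
  proof (cases "w0 \<in> {h, z, h * z}")
    case True
    then show ?thesis
      using C_mem h1 z(2) sgp_one [OF sgp_C] inv_h by (auto simp: S0_def sgp_def)
  next
    case False
    have "z \<noteq> u"
      using w0(1) wz by (metis left_cancel mult.right_neutral u_def)
    moreover have "z \<noteq> h * u"
    proof
      assume "z = h * u"
      then have "1 * z = (h * w0) * z"
        by (simp add: u_def mult.assoc)
      then have "h * w0 = 1"
        by (simp only: right_cancel)
      then have "h * (h * w0) = h" by simp
      then show False using False by simp
    qed
    moreover have "sgp {1, h, u, h * u}"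
      unfolding sgp_def by (simp add: u_def mult.assoc comm wz wh hz iw inv_h inv_z)
    moreover have "u \<in> C" "h * u \<in> C"
      using w0 C_mem C_mult by (auto simp: u_def)
    ultimately show ?thesis
      using False C_mem h1 z(2) sgp_one [OF sgp_C] by (simp add: S0_def)
  qed
  define \<A> where "\<A> = {S. sgp S \<and> S0 \<subseteq> S \<and> S \<subseteq> C \<and> z \<notin> S}"
  have "finite \<A>"
    using fin_G CG by (intro finite_subset [of \<A> "Pow G"]) (auto simp: \<A>_def)
  moreover have "S0 \<in> \<A>"
    using \<open>sgp S0 \<and> _\<close> by (simp add: \<A>_def)
  ultimately obtain Y where Y: "Y \<in> \<A>" "\<And>S. S \<in> \<A> \<Longrightarrow> Y \<subseteq> S \<Longrightarrow> Y = S"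
    using finite_has_maximal [of \<A>] by blast
  have Yp: "sgp Y" "S0 \<subseteq> Y" "Y \<subseteq> C" "z \<notin> Y" "h \<in> Y"
    using Y(1) \<open>sgp S0 \<and> _\<close> by (auto simp: \<A>_def)
  show thesis
  proof (rule that [of Y])
    show "z \<in> S" if "sgp S" "Y \<subseteq> S" "S \<subseteq> C" "S \<noteq> Y" for S
      using Y(2) [of S] that Yp by (auto simp: \<A>_def)
    show "\<not> (w \<in> Y \<and> cj t w \<in> Y)"
    proof
      assume "w \<in> Y \<and> cj t w \<in> Y"
      then have w0Y: "w0 \<in> Y" "cj t w0 \<in> Y"
        using sgp_power [OF Yp(1)] by (auto simp: w0_def cj_power)
      have hzY: "h * z \<notin> Y"
        using sgp_mult_left [OF Yp(1,5)] Yp(4) by simp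
      show False
      proof (cases "w0 \<in> {h, z, h * z}")
        case True
        then show ?thesis
          using w0Y hzY Yp(4) cj_h [OF t C_mem(3)] by auto
      next
        case False
        then have "w0 * z \<in> Y"
          using Yp(2) by (auto simp: S0_def u_def)
        then show ?thesis
          using sgp_mult_left [OF Yp(1) w0Y(1)] Yp(4) by simp
      qed
    qed
  qed (use Yp in auto)
qed

text \<open>The quotient by the core \<open>R\<close> of \<open>Y\<close> is tight, so its
  noncommuting elements satisfy the quaternion relations, which lift to relations modulo
  \<open>R\<close>. Choosing \<open>Y\<close> according to \<open>w\<close> makes \<open>R\<close>
  miss \<open>w\<close>.\<close>

lemma quotient_pairs:
  assumes w: "w \<in> C" "w \<noteq> 1"
  obtains R where "sgp R" "R \<subseteq> C" "z \<notin> R" "w \<notin> R"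
    "\<And>u v. u \<in> C \<Longrightarrow> v \<in> C \<Longrightarrow> cm u v \<notin> R \<Longrightarrow> u ^ 2 * z \<in> R \<and> cm u v * z \<in> R"
proof -
  obtain Y where Y: "sgp Y" "Y \<subseteq> C" "h \<in> Y" "z \<notin> Y" "\<not> (w \<in> Y \<and> cj t w \<in> Y)"
    and Ymax: "\<And>S. sgp S \<Longrightarrow> Y \<subseteq> S \<Longrightarrow> S \<subseteq> C \<Longrightarrow> S \<noteq> Y \<Longrightarrow> z \<in> S"
    using maximal_avoiding [OF w] by blast
  have nzY: "nz c Y" if "c \<in> C" for c
    by (rule nz_avoiding [OF Y(1,2,4) that])
  define R where "R = {y \<in> Y. cj t y \<in> Y}"
  have RY: "R \<subseteq> Y" and RG: "R \<subseteq> G" and zR: "z \<notin> R" and wR: "w \<notin> R"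
    using Y CG by (auto simp: R_def)
  have sR: "sgp R"
    using Y(1) by (simp add: sgp_def R_def cj_mult cj_inv)
  \<comment> \<open>\<open>C\<close> normalises \<open>Y\<close>, and since \<open>t ^ 2\<close>
    lies in \<open>C\<close>, conjugation by \<open>t\<close> preserves the condition defining
    \<open>R\<close>.\<close>
  have nzR: "nz x R" if x: "x \<in> G" for x
  proof -
    have fR: "finite R"
      using RG fin_G finite_subset by blast
    have nc: "nz c R" if c: "c \<in> C" for c
    proof (rule nz_finite [OF fR])
      fix y assume "y \<in> R"
      then have "cj c y \<in> Y" "cj (cj t c) (cj t y) \<in> Y"
        using cj_nz [OF nzY [OF c]] cj_nz [OF nzY [OF cj_C [OF c t]]] by (auto simp: R_def)
      then show "cj c y \<in> R"
        by (simp add: R_def cj_cj [of t])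
    qed
    have nt: "nz t R"
    proof (rule nz_finite [OF fR])
      fix y assume y: "y \<in> R"
      have "cj (t ^ 2) y \<in> Y"
        using cj_nz [OF nzY [OF square_C [OF t]]] y by (simp add: R_def)
      then show "cj t y \<in> R"
        using y by (simp add: R_def power2_eq_square cj_comp)
    qed
    show ?thesis
    proof (cases "x \<in> C")
      case False
      then obtain c where "c \<in> C" "x = t * c"
        using outside_t x by blast
      then show ?thesis using nz_mult [OF nt nc] by simp
    qed (rule nc)
  qed
  obtain f :: "'a \<Rightarrow> ('a set) Perm.perm"
    where f: "\<And>x y. x \<in> G \<Longrightarrow> y \<in> G \<Longrightarrow> f (x * y) = f x * f y"
      and ker: "\<And>x. x \<in> G \<Longrightarrow> f x = 1 \<longleftrightarrow> x \<in> R"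
    using quotient_hom [OF sR RG nzR] by blast
  interpret F: few_conj_hom G 2 n f
    by unfold_locales (rule f)
  have feq: "f x = f y \<longleftrightarrow> inverse x * y \<in> R" if "x \<in> G" "y \<in> G" for x y
  proof -
    have "f (inverse x * y) = inverse (f x) * f y"
      using that by (simp add: f F.f_inv G_inv)
    moreover have "inverse (f x) * f y = 1 \<longleftrightarrow> f x = f y"
      by (metis left_cancel left_inv)
    ultimately show ?thesis
      using ker that G_mult G_inv by metis
  qed
  have fz: "f z \<noteq> 1" using ker z zR by simp
  interpret Q: few_conj "f ` G" 2 n by (rule F.few_conj_image)
  have cmf: "cm (f h) (f t) = f z"
    using F.f_cm [OF h(1) t] by (simp add: z_def)
  interpret Q: socle2 "f ` G" n "f h" "f t"
  proof unfold_locales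
    show "f h ^ 2 = 1"
      using h F.f_one by (simp flip: F.f_power)
    show "cm (f h) (f t) \<in> Q.Z"
      unfolding cmf
    proof (rule Q.Z_I)
      show "f z * x = x * f z" if "x \<in> f ` G" for x
        using that z Z_commute by (auto simp flip: f)
    qed (use z in blast)
    show "cm (f h) (f t) \<noteq> 1"
      unfolding cmf by (rule fz)
  qed (use h t in auto)
  have Qz: "Q.z = f z"
    by (simp add: Q.z_def cmf)
  have QC: "f x \<in> Q.C \<longleftrightarrow> x \<in> C" if x: "x \<in> G" for x
  proof
    assume "x \<in> C"
    then show "f x \<in> Q.C"
      using x h by (auto simp: Q.C_iff C_iff simp flip: f)
  next
    assume a: "f x \<in> Q.C"
    show "x \<in> C"
    proof (rule ccontr)
      assume "x \<notin> C"
      then have "cm h x = z"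
        using cj_h [OF x] inv_h by (simp add: cm_cj)
      then have "cm (f h) (f x) = f z"
        using F.f_cm [OF h(1) x] by simp
      moreover have "cm (f h) (f x) = 1"
        using a by (simp add: Q.C_iff cm_eq_one_iff)
      ultimately show False using fz by simp
    qed
  qed
  have fY: "f x \<in> f ` Y \<longleftrightarrow> x \<in> Y" if x: "x \<in> G" for x
  proof
    assume "f x \<in> f ` Y"
    then obtain y where y: "y \<in> Y" "f y = f x" by force
    then have "inverse y * x \<in> Y"
      using feq [of y x] x Y(2) CG RY by blast
    then show "x \<in> Y"
      using sgp_mult_left [OF Y(1) sgp_inv [OF Y(1) y(1)]] by simp
  qed simp
  interpret Q: tight "f ` G" n "f h" "f t" "f ` Y"
  proof unfold_locales
    show "sgp (f ` Y)"
      by (rule F.sgp_image) (use Y CG in auto)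
    show "f ` Y \<subseteq> Q.C"
      using QC Y(2) CG by blast
    show "f h \<in> f ` Y" using Y by blast
    show "Q.z \<notin> f ` Y"
      using fY [OF z(3)] Y Qz by simp
    show "Q.z \<in> S" if S: "sgp S" "f ` Y \<subseteq> S" "S \<subseteq> Q.C" "S \<noteq> f ` Y" for S
    proof -
      define S' where "S' = {x \<in> G. f x \<in> S}"
      have SS: "f ` S' = S"
        using S(3) Q.CG by (auto simp: S'_def)
      have "z \<in> S'"
      proof (rule Ymax)
        show "sgp S'" unfolding S'_def by (rule F.sgp_vimage [OF S(1)])
        show "Y \<subseteq> S'" using S(2) Y CG by (auto simp: S'_def)
        show "S' \<subseteq> C" using S(3) QC by (auto simp: S'_def)
        show "S' \<noteq> Y" using SS S(4) by blast
      qed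
      then show ?thesis by (simp add: S'_def Qz)
    qed
    show "y = 1" if y: "y \<in> f ` Y" "cj (f t) y \<in> f ` Y" for y
    proof -
      obtain x where x: "x \<in> Y" "y = f x" using y by blast
      have xG: "x \<in> G" using x Y CG by blast
      have "f (cj t x) \<in> f ` Y"
        using y x F.f_cj [OF xG t] by simp
      moreover have "cj t x \<in> G"
        using xG t G_mult G_inv by (simp add: cj_def)
      ultimately have "x \<in> R"
        using fY x by (simp add: R_def)
      then show ?thesis using ker xG x by simp
    qed
  qed
  show thesis
  proof (rule that [OF sR _ zR wR])
    show "R \<subseteq> C" using RY Y by blast
    fix u v assume uv: "u \<in> C" "v \<in> C" "cm u v \<notin> R"
    have G: "u \<in> G" "v \<in> G" "cm u v \<in> G" using uv C_G G_cm by auto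
    have n: "cm (f u) (f v) \<noteq> 1"
      using ker [OF G(3)] uv(3) by (simp add: F.f_cm G)
    have q: "f u ^ 2 = f z" "cm (f u) (f v) = f z"
      using Q.noncommuting_pair [OF _ _ n] QC G uv Qz by auto
    have zz': "f z * f z = 1"
      using z2 F.f_one z(3) by (simp add: power2_eq_square flip: f)
    have "f (u ^ 2 * z) = 1" "f (cm u v * z) = 1"
      using q zz' G z by (simp_all add: f F.f_power F.f_cm G_power)
    then show "u ^ 2 * z \<in> R \<and> cm u v * z \<in> R"
      using ker G z G_mult G_power by simp
  qed
qed

text \<open>Two kernels \<open>R\<close> are used. One missing the square of the commutator
  \<open>w\<close> gives a contradiction, since \<open>w * z\<close> lies in it and has the same
  square. Modulo one missing \<open>w\<close> itself, \<open>u ^ 2\<close> agrees with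
  \<open>z\<close>; now \<open>u ^ 2\<close> is \<open>z\<close> if \<open>cyc u\<close> contains
  \<open>z\<close>, and otherwise \<open>v\<close> normalises \<open>cyc u\<close> and
  \<open>u ^ 2\<close> is \<open>w\<close>.\<close>

lemma noncommuting_structure:
  assumes u: "u \<in> C" and v: "v \<in> C" and w: "cm u v \<noteq> 1"
  shows "cm u v ^ 2 = 1" "u ^ 2 = z \<or> u ^ 2 = cm u v"
proof -
  define w where "w = cm u v"
  have wC: "w \<in> C" "w \<noteq> 1"
    using u v w sgp_cm [OF sgp_C] by (auto simp: w_def)
  have uG: "u \<in> G" using u C_G by blast
  show w2: "cm u v ^ 2 = 1"
    unfolding w_def [symmetric]
  proof (rule ccontr)
    assume "w ^ 2 \<noteq> 1"
    then obtain R where R: "sgp R" "w ^ 2 \<notin> R"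
      "\<And>u v. u \<in> C \<Longrightarrow> v \<in> C \<Longrightarrow> cm u v \<notin> R \<Longrightarrow> u ^ 2 * z \<in> R \<and> cm u v * z \<in> R"
      using quotient_pairs [of "w ^ 2"] C_power wC by metis
    have "w \<notin> R"
      using sgp_power [OF R(1)] R(2) by blast
    then have "w * z \<in> R"
      using R(3) u v by (simp add: w_def)
    then have "(w * z) ^ 2 \<in> R"
      using sgp_power R(1) by blast
    moreover have "(w * z) ^ 2 = w ^ 2"
      using power_mult_commute [OF z_comm [OF C_G [OF wC(1)]], of 2] z2 by simp
    ultimately show False using R(2) by simp
  qed
  obtain R where R: "sgp R" "z \<notin> R" "w \<notin> R"
    "\<And>u v. u \<in> C \<Longrightarrow> v \<in> C \<Longrightarrow> cm u v \<notin> R \<Longrightarrow> u ^ 2 * z \<in> R \<and> cm u v * z \<in> R"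
    using quotient_pairs [OF wC] by metis
  define r where "r = u ^ 2 * z"
  have r: "r \<in> R" "w * z \<in> R"
    using R u v by (auto simp: r_def w_def)
  have u2: "u ^ 2 = r * z"
    by (simp add: r_def mult.assoc)
  have rz: "r * z = z * r"
    using z_comm G_mult G_power uG z by (simp add: r_def)
  have u21: "u ^ 2 \<noteq> 1"
    using involution_central [OF u _ v] w by (auto simp: cm_eq_one_iff)
  show "u ^ 2 = z \<or> u ^ 2 = cm u v"
  proof (cases "z \<in> cyc u")
    case True
    have "u \<noteq> 1" "u \<noteq> z"
      using u21 z2 by auto
    then obtain r4 where r4: "r4 \<in> cyc u" "r4 ^ 2 = z" "r4 = u \<or> (\<exists>q\<in>cyc u. r4 = q ^ 2)"
      using order4_in_cyc [OF uG _ _ True] by blast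
    show ?thesis
    proof (cases "r4 = u")
      case False
      then obtain i where "r4 = (u ^ i) ^ 2"
        using r4(3) by (auto simp: cyc_def)
      then have "z = (u ^ 2) ^ (2 * i)"
        using r4(2) by (simp add: mult.commute flip: power_mult)
      also have "\<dots> = r ^ (2 * i) * z ^ (2 * i)"
        unfolding u2 by (rule power_mult_commute [OF rz])
      also have "z ^ (2 * i) = 1"
        using z2 by (simp add: power_mult)
      finally have "z \<in> R"
        using sgp_power [OF R(1) r(1)] by (metis mult.right_neutral)
      then show ?thesis using R by blast
    qed (use r4 in simp)
  next
    case False
    have cu: "sgp (cyc u)" "cyc u \<subseteq> G"
      using uG sgp_cyc_G cyc_G by auto
    have "nz v (cyc u)"
      by (rule nz_avoiding) (use cu False v cyc_sub [OF sgp_C u] in auto)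
    then have "u * w \<in> cyc u"
      using cj_nz cyc_self unfolding w_def cj_cm [symmetric] by blast
    then have "w \<in> cyc u"
      using sgp_mult_left [OF cu(1) cyc_self] by blast
    then obtain k where k: "w = u ^ k"
      by (auto simp: cyc_def)
    have w21: "w ^ 2 = 1" using w2 by (simp add: w_def)
    have "even k"
    proof (rule ccontr)
      assume "odd k"
      then have "u \<in> cyc w"
        using coprime_cyc [OF uG, of k] k by simp
      then have "u ^ 2 = 1"
        using cyc_power_one w21 by blast
      then show False using u21 by simp
    qed
    then obtain j where j: "k = 2 * j" by (rule evenE)
    have wj: "w = r ^ j * z ^ j"
      using k j u2 power_mult_commute [OF rz] by (simp add: power_mult)
    have oj: "odd j"
    proof
      assume "even j"
      then have "z ^ j = 1"
        using z2 by (auto simp: power_mult elim!: evenE)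
      then have "w \<in> R"
        using wj sgp_power [OF R(1) r(1)] by simp
      then show False using R by blast
    qed
    have "u ^ (k * 2) = 1"
      using w21 k by (simp add: power_mult)
    then have "2 ^ ht u dvd 2 ^ 2 * j"
      using ht_dvd [OF uG] j by (metis mult.assoc mult.commute power2_eq_square)
    then have "2 ^ ht u dvd (2 ^ 2 :: nat)"
      using oj by (metis coprime_dvd_mult_left_iff coprime_power_left_iff coprime_left_2_iff_odd)
    then obtain q where "(2 ^ 2 :: nat) = 2 ^ ht u * q" ..
    then have u4: "u ^ (2 ^ 2) = 1"
      using power_ht [OF uG] by (metis power_mult power_one)
    obtain i where "j = 2 * i + 1"
      using oj by (rule oddE)
    then have "k = 2 ^ 2 * i + 2"
      using j by simp
    then have "w = u ^ 2"
      using k u4 by (simp only: power_add power_mult power_one mult.left_neutral)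
    then show ?thesis by (simp add: w_def)
  qed
qed

end

section \<open>The bound for \<open>p = 2\<close>\<close>

context grp begin

lemma cov2:
  assumes "\<And>a. a \<in> A \<Longrightarrow> a \<in> B \<or> g * a \<in> B"
  shows "cov A B 2"
proof (rule covI_power [of _ _ g])
  fix a assume "a \<in> A"
  then have "g ^ 0 * a \<in> B \<or> g ^ 1 * a \<in> B"
    using assms by simp
  then show "\<exists>i<2. g ^ i * a \<in> B"
    by (metis one_less_numeral_iff semiring_norm(76) zero_less_numeral)
qed

text \<open>All commutators are 1 or \<open>w\<close>, so the centraliser of a noncentral
  \<open>u\<close> has index at most 2, and an element of it is central either itself or after
  multiplication by \<open>u\<close>.\<close>

lemma cov_center_4:
  assumes Q: "sgp Q" and w: "w ^ 2 = 1" "\<And>a. a \<in> Q \<Longrightarrow> w * a = a * w"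
    and cm: "\<And>a b. a \<in> Q \<Longrightarrow> b \<in> Q \<Longrightarrow> cm a b \<noteq> 1 \<Longrightarrow> cm a b = w"
    and comm: "\<And>a b. a \<in> Q \<Longrightarrow> b \<in> Q \<Longrightarrow> a \<notin> centr Q \<Longrightarrow> b \<notin> centr Q \<Longrightarrow> a * b = b * a
      \<Longrightarrow> a * b \<in> centr Q"
  shows "cov Q (Q \<inter> centr Q) 4"
proof (cases "Q \<subseteq> centr Q")
  case True
  then show ?thesis by (intro cov_triv) auto
next
  case False
  then obtain u v where uv: "u \<in> Q" "v \<in> Q" "u \<notin> centr Q" "u * v \<noteq> v * u"
    by (auto simp: centr_def)
  have 1: "cov Q (Q \<inter> centr {u}) 2"
  proof (rule cov2 [of _ _ v])
    fix a assume a: "a \<in> Q"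
    show "a \<in> Q \<inter> centr {u} \<or> v * a \<in> Q \<inter> centr {u}"
    proof (cases "a * u = u * a")
      case False
      have "cm u v = w" "cm u a = w"
        using cm [OF uv(1,2)] cm [OF uv(1) a] uv(4) False by (auto simp: cm_eq_one_iff)
      then have "cj v u = u * w" "cj a u = u * w"
        by (simp_all add: cj_cm [of _ u])
      moreover have "cj a w = w"
        using w(2) [OF a] by (simp add: cj_eq_self)
      ultimately have "cj (v * a) u = u * w * w"
        by (simp add: cj_comp cj_mult)
      then have "cj (v * a) u = u"
        using w(1) by (simp add: mult.assoc power2_eq_square)
      then have "(v * a) * u = u * (v * a)"
        by (simp add: cj_eq_self)
      then show ?thesis
        using sgp_mult [OF Q uv(2) a] by (simp add: centr_def)
    qed (use a in \<open>simp add: centr_def\<close>)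
  qed
  have 2: "cov (Q \<inter> centr {u}) (Q \<inter> centr Q) 2"
  proof (rule cov2 [of _ _ u])
    fix a assume a: "a \<in> Q \<inter> centr {u}"
    then have "a * u = u * a" by (simp add: centr_def)
    then show "a \<in> Q \<inter> centr Q \<or> u * a \<in> Q \<inter> centr Q"
      using comm [of u a] uv a sgp_mult [OF Q] by auto
  qed
  show ?thesis
    using cov_trans [OF 1 2] by simp
qed

text \<open>The group \<open>Q\<close> is Hamiltonian up to its centre, like the quaternion group.\<close>

lemma cov_center_hamiltonian:
  assumes Q: "sgp Q"
    and sq: "\<And>a b. a \<in> Q \<Longrightarrow> b \<in> Q \<Longrightarrow> cm a b \<noteq> 1 \<Longrightarrow> a ^ 2 = cm a b \<and> cm a b ^ 2 = 1"
    and inv: "\<And>a. a \<in> Q \<Longrightarrow> a ^ 2 = 1 \<Longrightarrow> a \<in> centr Q"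
  shows "cov Q (Q \<inter> centr Q) 4"
proof (cases "Q \<subseteq> centr Q")
  case True
  then show ?thesis by (intro cov_triv) auto
next
  case False
  then obtain u v where uv: "u \<in> Q" "v \<in> Q" "cm u v \<noteq> 1"
    by (auto simp: centr_def cm_eq_one_iff)
  define w where "w = u ^ 2"
  have w: "cm u v = w" "w ^ 2 = 1" "w \<in> Q"
    using sq [OF uv] sgp_power [OF Q uv(1), of 2] by (auto simp: w_def)
  have step: "cm a b = w" "a ^ 2 = w" if ab: "a \<in> Q" "b \<in> Q" "cm a b \<noteq> 1" "b ^ 2 = w" for a b
  proof -
    have "cm b a \<noteq> 1" using ab(3) by (auto simp: cm_eq_one_iff)
    then have "cm b a = w"
      using sq [OF ab(2,1)] ab(4) by simp
    then show "cm a b = w"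
      using w(2) inverse_involution inv_cm by metis
    then show "a ^ 2 = w"
      using sq [OF ab(1-3)] by simp
  qed
  have u2: "u ^ 2 = w" by (simp add: w_def)
  have vu: "cm v u \<noteq> 1" using uv(3) by (auto simp: cm_eq_one_iff)
  have v2: "v ^ 2 = w"
    using step(2) [OF uv(2,1) vu u2] .
  have all: "x ^ 2 = w" if x: "x \<in> Q" "x \<notin> centr Q" for x
  proof (cases "cm x u = 1 \<and> cm x v = 1")
    case False
    then show ?thesis using step(2) x uv u2 v2 by blast
  next
    case True
    obtain y where y: "y \<in> Q" "cm x y \<noteq> 1"
      using x by (auto simp: centr_def cm_eq_one_iff)
    show ?thesis
    proof (cases "cm y u = 1")
      case False
      then show ?thesis using step(2) x y uv u2 by blast
    next
      case yu: True
      \<comment> \<open>An \<open>x\<close> commuting with both \<open>u\<close> and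
        \<open>v\<close> is reached through \<open>y * v\<close>, which commutes neither with
        \<open>u\<close> nor with \<open>x\<close>.\<close>
      have yv: "y * v \<in> Q" using sgp_mult [OF Q y(1) uv(2)] .
      have "cm (y * v) u \<noteq> 1"
        using yu vu by (simp add: cm_mult_left)
      then have "(y * v) ^ 2 = w"
        using step(2) [OF yv uv(1) _ u2] by blast
      moreover have "cm x (y * v) \<noteq> 1"
        using True y(2) by (simp add: cm_mult_right) (metis cj_def cj_eq_one)
      ultimately show ?thesis using step(2) x yv by blast
    qed
  qed
  have wc: "w * a = a * w" if "a \<in> Q" for a
    using inv [OF w(3,2)] that by (simp add: centr_def)
  show ?thesis
  proof (rule cov_center_4 [OF Q w(2) wc])
    show "cm a b = w" if "a \<in> Q" "b \<in> Q" "cm a b \<noteq> 1" for a b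
    proof -
      have "a \<notin> centr Q" using that by (auto simp: centr_def cm_eq_one_iff)
      then show ?thesis using sq that all by metis
    qed
    show "a * b \<in> centr Q" if "a \<in> Q" "b \<in> Q" "a \<notin> centr Q" "b \<notin> centr Q" "a * b = b * a" for a b
    proof (rule inv)
      show "(a * b) ^ 2 = 1"
        using power_mult_commute [OF that(5), of 2] all that w(2) by (simp add: power2_eq_square)
    qed (use sgp_mult [OF Q] that in blast)
  qed
qed

end

section \<open>The centre of C and normalisers of cyclic groups outside C\<close>

context socle2 begin

definition ZC where "ZC = C \<inter> centr C"

lemma ZC_iff: "a \<in> ZC \<longleftrightarrow> a \<in> C \<and> (\<forall>c\<in>C. a * c = c * a)"
  by (auto simp: ZC_def centr_def)

lemma involution_ZC: "e \<in> C \<Longrightarrow> e ^ 2 = 1 \<Longrightarrow> e \<in> ZC"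
  unfolding ZC_iff using involution_central by metis

lemma cover_outside: "l \<in> G \<Longrightarrow> l \<notin> C \<Longrightarrow> y \<in> G \<Longrightarrow> \<exists>i. l ^ i * y \<in> C"
  using cover by blast

lemma ZC_Z: "a \<in> ZC \<Longrightarrow> l \<in> G \<Longrightarrow> l \<notin> C \<Longrightarrow> a * l = l * a \<Longrightarrow> a \<in> Z"
  by (rule center_by_cover [of a l C]) (auto simp: ZC_iff C_G cover_outside)

lemma pair_facts:
  assumes "u \<in> C" "v \<in> C" "cm u v \<noteq> 1"
  shows "cm u v ^ 2 = 1" "u ^ 2 = z \<or> u ^ 2 = cm u v" "v ^ 2 = z \<or> v ^ 2 = cm u v"
    "cm v u = cm u v" "cm u v \<in> ZC" "cm u v \<in> C" "cm u v \<in> G" "u ^ 2 \<noteq> 1" "v ^ 2 \<noteq> 1"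
proof -
  show 1: "cm u v ^ 2 = 1" and "u ^ 2 = z \<or> u ^ 2 = cm u v"
    using noncommuting_structure assms by blast+
  show s: "cm v u = cm u v"
    using inverse_involution [OF 1] inv_cm by metis
  then show "v ^ 2 = z \<or> v ^ 2 = cm u v"
    using noncommuting_structure [OF assms(2,1)] assms(3) by simp
  show "cm u v \<in> C"
    using sgp_cm sgp_C assms by blast
  then show "cm u v \<in> ZC" "cm u v \<in> G"
    using involution_ZC 1 C_G by auto
  show "u ^ 2 \<noteq> 1" "v ^ 2 \<noteq> 1"
    using involution_central assms by (auto simp: cm_eq_one_iff)
qed

text \<open>\<open>u * a\<close> has the same commutator with \<open>v\<close> as \<open>u\<close>,
  so \<open>u ^ 2\<close> and \<open>u ^ 2 * a ^ 2\<close> both belong to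
  \<open>{z, cm u v}\<close>; their quotient is \<open>a ^ 2\<close>.\<close>

lemma ZC_square:
  assumes uv: "u \<in> C" "v \<in> C" "cm u v \<noteq> 1" and a: "a \<in> ZC"
  shows "a ^ 2 = 1 \<or> a ^ 2 = z * cm u v" "cm (u * a) v = cm u v" "(u * a) ^ 2 = u ^ 2 * a ^ 2" "u * a \<in> C"
proof -
  have ac: "a * c = c * a" if "c \<in> C" for c
    using a that by (simp add: ZC_iff)
  have aC: "a \<in> C" using a by (simp add: ZC_iff)
  show ua: "u * a \<in> C" using C_mult uv aC by blast
  define w where "w = cm u v"
  note w = pair_facts [OF uv, folded w_def]
  have "cj a w = w"
    by (rule cj_commute) (use ac [OF w(6)] in simp)
  then show cmw: "cm (u * a) v = cm u v"
    using ac [OF uv(2)] by (simp add: cm_mult_left cj_def cm_eq_one_iff [THEN iffD2] w_def)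
  show sq: "(u * a) ^ 2 = u ^ 2 * a ^ 2"
    by (rule power_mult_commute) (use ac uv in simp)
  have ww: "w * w = 1" "w * (w * x) = x" for x
    using w(1) by (simp_all add: power2_eq_square flip: mult.assoc)
  have wz: "w * z = z * w" using z_comm w(7) by simp
  have "u ^ 2 * a ^ 2 = z \<or> u ^ 2 * a ^ 2 = w"
    using pair_facts(2) [OF ua uv(2)] cmw uv(3) sq by (simp add: w_def)
  moreover have "a ^ 2 = u ^ 2 * (u ^ 2 * a ^ 2)"
    using w(2) by (elim disjE) (simp_all only: zz ww)
  ultimately have "a ^ 2 = u ^ 2 * z \<or> a ^ 2 = u ^ 2 * w"
    by metis
  then have "a ^ 2 = 1 \<or> a ^ 2 = z * w"
    using w(2) wz ww(1) zz(1) by metis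
  then show "a ^ 2 = 1 \<or> a ^ 2 = z * cm u v"
    by (simp add: w_def)
qed

text \<open>\<open>f\<close> is meant to be a square or a commutator, so that it normalises every subgroup.\<close>

lemma normaliser_pair:
  assumes f: "f \<in> C" "nz f (cyc v)" and v: "v \<in> C" "cm f v \<noteq> 1"
  shows "v ^ 2 = cm f v"
proof -
  define w where "w = cm f v"
  note w = pair_facts [OF f(1) v, folded w_def]
  have vG: "v \<in> G" using v C_G by blast
  have "w \<in> cyc v"
    unfolding w_def by (rule cm_in_normalised [OF sgp_cyc_G [OF vG] f(2) cyc_self])
  show ?thesis
  proof (cases "v ^ 2 = z")
    case True
    then have "w \<in> {1, v, z, v * z}"
      using cyc_square \<open>w \<in> cyc v\<close> z2 by blast
    moreover have "w \<noteq> 1" using v by (simp add: w_def)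
    moreover have "w \<noteq> v" using w by auto
    moreover have "w \<noteq> v * z"
    proof
      assume "w = v * z"
      then have "w ^ 2 = v ^ 2 * z ^ 2"
        using power_mult_commute [OF z_comm [OF vG], of 2] by simp
      then show False using w(1,9) z2 by simp
    qed
    ultimately show ?thesis using True by (simp add: w_def)
  qed (use w(3) in \<open>simp add: w_def\<close>)
qed

lemma fourth_power_mod:
  assumes "s \<in> G" "s ^ 2 \<noteq> 1" "s ^ 4 = 1" "s ^ k = inverse s"
  shows "4 dvd k + 1"
proof -
  have "s ^ (k + 1) = 1"
    using assms(4) by (simp add: power_commutes)
  then have d: "2 ^ ht s dvd k + 1"
    using ht_dvd assms(1) by blast
  have "ht s \<noteq> 0" "ht s \<noteq> 1"
    using power_ht [OF assms(1)] assms(2) ht_eq_0 [OF assms(1)] by auto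
  then have "2 \<le> ht s" by simp
  then have "(2::nat) ^ 2 dvd 2 ^ ht s"
    by (rule le_imp_power_dvd)
  then show ?thesis using d dvd_trans by fastforce
qed

text \<open>\<open>v\<close> inverts \<open>l ^ 2\<close>, which has order 4, so it raises
  \<open>l\<close> to a power \<open>k\<close> congruent to -1 modulo 4. Hence
  \<open>(l * v) ^ 2 = v ^ 2 * l ^ (k + 1)\<close> is a power of the involution
  \<open>l ^ 4\<close>.\<close>

lemma inverting_square:
  assumes l: "l \<in> G" and v: "v \<in> C" "nz v (cyc l)"
    and s: "(l ^ 2) ^ 2 \<noteq> 1" "(l ^ 2) ^ 4 = 1" "cm (l ^ 2) v = (l ^ 2) ^ 2" "v ^ 2 = (l ^ 2) ^ 2"
  shows "(l * v) ^ 2 = 1 \<or> (l * v) ^ 2 = (l ^ 2) ^ 2"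
proof -
  define s where "s = l ^ 2"
  define w where "w = s ^ 2"
  have sG: "s \<in> G" using l G_power by (simp add: s_def)
  obtain k where k: "cj v l = l ^ k"
    using cj_nz [OF v(2) cyc_self] by (auto simp: cyc_def)
  have "s ^ k = cj v s"
    using k by (simp add: s_def cj_power mult.commute flip: power_mult)
  also have "\<dots> = s * s ^ 2"
    using s(3) by (simp add: cj_cm s_def)
  also have "\<dots> = inverse s"
  proof (rule inv_unique [symmetric])
    show "s * (s * s ^ 2) = 1"
      using s(2) by (simp add: s_def numeral_eq_Suc)
  qed
  finally have "4 dvd k + 1"
    using fourth_power_mod [OF sG] s by (simp add: s_def)
  then obtain q where q: "k + 1 = 4 * q" ..
  have lw: "l * w = w * l"
    by (simp add: w_def s_def power_commutes flip: power_mult)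
  have lv: "l * v = v * l ^ k"
    using mult_cj [of v l] k by simp
  have "(l * v) ^ 2 = l * v * (v * l ^ k)"
    by (simp add: power2_eq_square lv [symmetric])
  also have "\<dots> = l * v ^ 2 * l ^ k"
    by (simp add: power2_eq_square mult.assoc)
  also have "v ^ 2 = w"
    using s(4) by (simp add: w_def s_def)
  also have "l * w * l ^ k = w * l ^ (k + 1)"
    by (simp add: lw mult.assoc)
  also have "l ^ (k + 1) = w ^ q"
    unfolding q by (simp add: w_def s_def flip: power_mult)
  finally have lvq: "(l * v) ^ 2 = w ^ Suc q" by simp
  have "w ^ 2 = 1"
    using s(2) by (simp add: w_def s_def flip: power_mult)
  moreover have "w ^ Suc q \<in> cyc w" by (rule power_cyc)
  ultimately have "w ^ Suc q = 1 \<or> w ^ Suc q = w"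
    using involution_cyc by blast
  then show ?thesis
    using lvq by (simp add: w_def s_def)
qed

text \<open>If \<open>s = l ^ 2\<close> is not central in \<open>C\<close>, some \<open>v\<close> in
  \<open>C\<close> normalises \<open>cyc l\<close> without commuting with \<open>s\<close>:
  \<open>h\<close> does not normalise \<open>cyc l\<close>, so \<open>P3\<close> corrects
  \<open>v0\<close> by a power of \<open>h\<close>, which \<open>s\<close> does not notice. Then
  \<open>v\<close> inverts \<open>s\<close>, and \<open>l * v\<close> takes the place of
  \<open>l\<close>.\<close>

lemma avoiding_outside:
  assumes "l \<in> G" "l \<notin> C" "z \<notin> cyc l"
  obtains l' where "l' \<in> G" "l' \<notin> C" "z \<notin> cyc l'" "l' ^ 2 \<in> ZC"
proof (cases "l ^ 2 \<in> ZC")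
  case False
  define s where "s = l ^ 2"
  have s: "s \<in> C" "s \<in> G"
    using square_C assms C_G by (auto simp: s_def)
  obtain v0 where v0: "v0 \<in> C" "cm s v0 \<noteq> 1"
    using False s by (auto simp: s_def ZC_iff cm_eq_one_iff)
  have cl: "sgp (cyc l)" "cyc l \<subseteq> G"
    using assms sgp_cyc_G cyc_G by auto
  have "\<not> nz h (cyc l)"
  proof
    assume "nz h (cyc l)"
    then have "cm h l \<in> cyc l"
      using cm_in_normalised cl cyc_self by blast
    then show False
      using cj_h assms inv_h by (simp add: cm_cj)
  qed
  then obtain i where i: "nz (h ^ i * v0) (cyc l)"
    using P3 [OF cl h(1) C_G [OF v0(1)]] by blast
  define v where "v = h ^ i * v0"
  have vC: "v \<in> C"
    using C_mult C_power C_mem v0 by (simp add: v_def)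
  have "cm s (h ^ i) = 1"
    using commute_power [of h s i] C_h [OF s(1)] by (simp add: cm_eq_one_iff)
  then have sv: "cm s v \<noteq> 1"
    using v0(2) by (simp add: v_def cm_mult_right)
  note w = pair_facts [OF s(1) vC sv]
  have v2: "v ^ 2 = cm s v"
    by (rule normaliser_pair [OF s(1) _ vC sv])
       (use nz_square sgp_cyc_G cyc_G vC C_G assms in \<open>simp add: s_def\<close>)
  have "s ^ 2 \<in> cyc l"
    by (simp add: s_def power_cyc flip: power_mult)
  then have s2: "s ^ 2 = cm s v"
    using w(2) assms(3) by auto
  have s4: "s ^ 4 = 1"
  proof -
    have "s ^ 4 = (s ^ 2) ^ 2"
      by (simp flip: power_mult)
    then show ?thesis using w(1) s2 by simp
  qed
  have nzv: "nz v (cyc l)"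
    using i by (simp add: v_def)
  have "(l * v) ^ 2 = 1 \<or> (l * v) ^ 2 = s ^ 2"
    unfolding s_def
    by (rule inverting_square [OF assms(1) vC nzv]; fold s_def) (use s2 s4 v2 sv in auto)
  then have lv2: "(l * v) ^ 2 = 1 \<or> (l * v) ^ 2 = cm s v"
    using s2 by simp
  have lv: "l * v \<in> G" "l * v \<notin> C"
    using assms vC C_G G_mult outside_right by auto
  have "z \<notin> cyc (l * v)"
  proof
    assume "z \<in> cyc (l * v)"
    then have "z \<in> cyc ((l * v) ^ 2)"
      using cyc_outside_C lv C_mem by blast
    then have "z = (l * v) ^ 2"
      using involution_cyc lv2 w(1) z(2) by (metis power_one)
    then have "z = s ^ 2"
      using lv2 s2 z(2) by auto
    then show False
      using \<open>s ^ 2 \<in> cyc l\<close> assms(3) by simp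
  qed
  moreover have "(l * v) ^ 2 \<in> ZC"
    using lv2 w(5) involution_ZC sgp_one [OF sgp_C] by auto
  ultimately show thesis
    using that [of "l * v"] lv by blast
qed (use that assms in blast)

end

section \<open>An element outside C whose powers avoid z\<close>

locale avoiding = socle2 +
  fixes l
  assumes l: "l \<in> G" "l \<notin> C" and zl: "z \<notin> cyc l" and sZC: "l ^ 2 \<in> ZC"
begin

definition s where "s = l ^ 2"

definition N where "N = {u \<in> C. nz u (cyc l)}"

lemma sgp_N: "sgp N"
  using sgp_Int [OF sgp_C sgp_nz [of "cyc l"]] by (simp add: N_def Int_def)

lemma N_C: "u \<in> N \<Longrightarrow> u \<in> C" and N_G: "u \<in> N \<Longrightarrow> u \<in> G"
  using C_G by (auto simp: N_def)

lemma s_Z: "s \<in> Z" "s \<in> C" "s \<in> G"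
proof -
  show "s \<in> Z"
    unfolding s_def by (rule ZC_Z [OF sZC l]) (simp add: power_commutes)
  then show "s \<in> C" "s \<in> G" using C_mem Z_G by auto
qed

lemma outside_normaliser:
  assumes x: "x \<in> G" "x \<notin> C" "z \<notin> cyc x" and y: "y \<in> G"
  shows "nz y (cyc x) \<or> nz (h * y) (cyc x)"
proof -
  have cx: "sgp (cyc x)" "cyc x \<subseteq> G"
    using x sgp_cyc_G cyc_G by auto
  have "\<not> nz h (cyc x)"
  proof
    assume "nz h (cyc x)"
    then have "cm h x \<in> cyc x"
      using cm_in_normalised cx cyc_self by blast
    then show False
      using cj_h x inv_h by (simp add: cm_cj)
  qed
  then obtain i where "i < 2" "nz (h ^ i * y) (cyc x)"
    using P3 [OF cx h(1) y] by blast
  then show ?thesis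
    by (auto simp: less_2_cases_iff)
qed

lemma cov_G_C: "cov G C 2"
  by (rule covI_power) (rule cover [OF l])

lemma C_N: "c \<in> C \<Longrightarrow> c \<in> N \<or> h * c \<in> N"
  using outside_normaliser [OF l zl] C_mult C_mem C_G by (simp add: N_def)

text \<open>Conjugation by \<open>u\<close> fixes the central \<open>s\<close> and sends
  \<open>l\<close> to \<open>l * cm l u\<close>; the factors commute, so comparing squares leaves
  \<open>cm l u\<close> with square 1. Being a commutator in \<open>C\<close>, it is an even power
  of \<open>l\<close>.\<close>

lemma d_facts:
  assumes u: "u \<in> N"
  shows "cm l u ^ 2 = 1" "cm l u \<in> cyc s" "cm l u \<in> Z"
proof -
  define d where "d = cm l u"
  have uC: "u \<in> C" "u \<in> G" using N_C N_G u by auto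
  have cl: "sgp (cyc l)" using l sgp_cyc_G by blast
  have "nz u (cyc l)" using u by (simp add: N_def)
  then have "cj u l \<in> cyc l"
    by (rule cj_nz [OF _ cyc_self])
  then have dl: "d \<in> cyc l"
    using sgp_mult_left [OF cl cyc_self] by (simp add: d_def cj_cm)
  then have ld: "l * d = d * l"
    using cyc_commute by metis
  have "(l * d) ^ 2 = cj u s"
    by (simp add: d_def s_def cj_cm [symmetric] cj_power)
  also have "\<dots> = s"
    by (rule cj_commute) (use s_Z uC Z_commute in blast)
  finally have "s * d ^ 2 = s * 1"
    using power_mult_commute [OF ld, of 2] by (simp add: s_def)
  then have d2: "d ^ 2 = 1" by (simp only: left_cancel)
  have "d \<in> C"
    unfolding d_def by (rule cm_C [OF l(1) uC(2)])
  then have ds: "d \<in> cyc s"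
    unfolding s_def by (rule cyc_outside_C [OF l dl])
  show "cm l u ^ 2 = 1" "cm l u \<in> cyc s" "cm l u \<in> Z"
    using d2 ds cyc_Z [OF s_Z(1)] by (auto simp: d_def)
qed

lemma cov_ZC:
  assumes d: "\<And>a. a \<in> ZC \<Longrightarrow> a \<in> N \<Longrightarrow> cm l a = 1"
  shows "cov ZC Z 2"
proof (rule cov2 [of _ _ h])
  fix a assume a: "a \<in> ZC"
  have hZC: "h \<in> ZC" using involution_ZC C_mem h2 by blast
  have "h * a \<in> ZC"
    using a hZC sgp_mult [OF sgp_Int [OF sgp_C sgp_centr]] unfolding ZC_def by blast
  moreover have "a \<in> N \<or> h * a \<in> N"
    using C_N a by (simp add: ZC_iff)
  moreover have "b \<in> Z" if "b \<in> ZC" "b \<in> N" for b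
    by (rule ZC_Z [OF that(1) l]) (use d [OF that] in \<open>simp add: cm_eq_one_iff\<close>)
  ultimately show "a \<in> Z \<or> h * a \<in> Z"
    using a by blast
qed

text \<open>\<open>s ^ 2\<close> is the product of \<open>z\<close> with any nontrivial commutator
  of \<open>C\<close>, so there is only one such commutator \<open>w\<close>. The bound is 2 for
  \<open>C\<close>, 4 for the centre of \<open>C\<close> and 2 for \<open>Z\<close>.\<close>

lemma bound_order_8:
  assumes uv: "u \<in> C" "v \<in> C" "cm u v \<noteq> 1" and s2: "s ^ 2 \<noteq> 1"
  shows "cov G Z 16"
proof -
  define w where "w = z * s ^ 2"
  have cmw: "cm a b = w" if ab: "a \<in> C" "b \<in> C" "cm a b \<noteq> 1" for a b
  proof -
    have "s ^ 2 = z * cm a b"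
      using ZC_square(1) [OF ab sZC] s2 by (simp add: s_def)
    then show ?thesis by (simp add: w_def)
  qed
  have w: "w ^ 2 = 1" "w \<in> ZC" "w \<noteq> 1"
    using pair_facts [OF uv] cmw [OF uv] uv by auto
  have zw: "z * w = s ^ 2" by (simp add: w_def)
  have wz: "w \<noteq> z"
    using zw s2 by auto
  have ww: "w * w = 1" using w(1) by (simp add: power2_eq_square)
  have toggle: "(a * s) ^ 2 = a ^ 2 * (z * w)" if "a \<in> G" for a
    using power_mult_commute [of a s 2] Z_commute [OF s_Z(1) that] by (simp add: zw)
  have wG: "w \<in> G" using w(2) C_G by (simp add: ZC_iff)
  have sq: "a ^ 2 = z \<or> a ^ 2 = w" if a: "a \<in> C" "a \<notin> ZC" for a
  proof -
    obtain b where "b \<in> C" "cm a b \<noteq> 1"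
      using a by (auto simp: ZC_iff cm_eq_one_iff)
    then show ?thesis using pair_facts(2) a cmw by metis
  qed
  \<comment> \<open>Multiplication by \<open>s\<close> exchanges the squares \<open>z\<close> and
    \<open>w\<close>, so every noncentral element can be adjusted to have square
    \<open>w\<close>.\<close>
  have adj: "\<exists>\<sigma>\<in>ZC. (a * \<sigma>) ^ 2 = w" if a: "a \<in> C" "a \<notin> ZC" for a
  proof (cases "a ^ 2 = w")
    case True
    then show ?thesis
      using involution_ZC sgp_one [OF sgp_C] by (intro bexI [of _ 1]) auto
  next
    case False
    then have "a ^ 2 = z" using sq a by blast
    then have "(a * s) ^ 2 = w"
      using toggle a C_G by simp
    then show ?thesis using sZC by (auto simp: s_def)
  qed
  have sgpZC: "sgp ZC"
    unfolding ZC_def by (rule sgp_Int [OF sgp_C sgp_centr])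
  have "cov C (C \<inter> centr C) 4"
  proof (rule cov_center_4 [OF sgp_C w(1) _ cmw])
    show "w * a = a * w" if "a \<in> C" for a
      using w(2) that by (simp add: ZC_iff)
    show "a * b \<in> centr C" if ab: "a \<in> C" "b \<in> C" "a \<notin> centr C" "b \<notin> centr C" "a * b = b * a" for a b
    proof -
      obtain \<alpha> where \<alpha>: "\<alpha> \<in> ZC" "(a * \<alpha>) ^ 2 = w"
        using adj [OF ab(1)] ab(3) by (auto simp: ZC_def)
      obtain \<beta> where \<beta>: "\<beta> \<in> ZC" "(b * \<beta>) ^ 2 = w"
        using adj [OF ab(2)] ab(4) by (auto simp: ZC_def)
      have c: "\<alpha> * c = c * \<alpha>" "\<beta> * c = c * \<beta>" if "c \<in> C" for c
        using \<alpha> \<beta> that by (auto simp: ZC_iff)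
      have \<alpha>\<beta>C: "\<alpha> \<in> C" "\<beta> \<in> C" using \<alpha> \<beta> by (auto simp: ZC_iff)
      have mm: "a * \<alpha> \<in> C" "b * \<beta> \<in> C" using ab \<alpha>\<beta>C C_mult by auto
      have "(a * \<alpha>) * b = b * (a * \<alpha>)"
        using commute_mult [of a b \<alpha>] ab(5) c(1) [OF ab(2)] by simp
      then have "(b * \<beta>) * (a * \<alpha>) = (a * \<alpha>) * (b * \<beta>)"
        using commute_mult [of b "a * \<alpha>" \<beta>] c(2) [OF mm(1)] by simp
      then have "((a * \<alpha>) * (b * \<beta>)) ^ 2 = (a * \<alpha>) ^ 2 * (b * \<beta>) ^ 2"
        by (intro power_mult_commute) simp
      then have "((a * \<alpha>) * (b * \<beta>)) ^ 2 = 1"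
        using \<alpha> \<beta> ww by simp
      then have "(a * \<alpha>) * (b * \<beta>) \<in> ZC"
        using involution_ZC C_mult mm by blast
      moreover have "(a * \<alpha>) * (b * \<beta>) = (a * b) * (\<alpha> * \<beta>)"
      proof -
        have "\<alpha> * (b * \<beta>) = b * (\<alpha> * \<beta>)"
          using c(1) [OF ab(2)] by (simp flip: mult.assoc)
        then show ?thesis by (simp add: mult.assoc)
      qed
      ultimately have "a * b \<in> ZC"
        using sgp_mult_right [OF sgpZC] sgp_mult [OF sgpZC \<alpha>(1) \<beta>(1)] by metis
      then show ?thesis by (simp add: ZC_def)
    qed
  qed
  then have 1: "cov C ZC 4" by (simp add: ZC_def)
  have 2: "cov ZC Z 2"
  proof (rule cov_ZC, rule ccontr)
    fix a assume a: "a \<in> ZC" "a \<in> N" and d: "cm l a \<noteq> 1"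
    have "(z * w) ^ 2 = z ^ 2 * w ^ 2"
      by (rule power_mult_commute) (use z_comm [OF wG] in simp)
    then have s4: "(s ^ 2) ^ 2 = 1"
      unfolding zw using w(1) z2 by simp
    have "cm l a \<in> cyc (s ^ 2)"
      by (rule omega_line [OF s_Z(3) d_facts(2) _ power_cyc]) (use d_facts a s4 s2 in auto)
    then have ds: "cm l a = s ^ 2"
      using involution_cyc s4 d by blast
    \<comment> \<open>Adjusted by \<open>s\<close> if necessary, \<open>a\<close> becomes an
      involution \<open>b\<close> that forms with \<open>l\<close> a second socle pair, with
      \<open>s ^ 2\<close> in place of \<open>z\<close> and \<open>C\<close> inside the new
      centraliser. Both structures together leave only \<open>w\<close> for the squares of
      \<open>u\<close> and of \<open>u * s\<close>, although these differ by
      \<open>z * w\<close>.\<close>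
    obtain b where b: "b \<in> ZC" "b ^ 2 = 1" "cm l b = s ^ 2"
    proof (cases "a ^ 2 = 1")
      case False
      then have "a ^ 2 = z * w"
        using ZC_square(1) [OF uv a(1)] cmw [OF uv] by simp
      then have "(a * s) ^ 2 = 1"
        using toggle [of a] a(2) N_G zw s4 by (simp add: power2_eq_square)
      moreover have "cm l (a * s) = s ^ 2"
      proof -
        have "cm l s = 1" by (simp add: cm_eq_one_iff s_def power_commutes)
        moreover have "cj s (cm l a) = cm l a"
          unfolding ds by (simp add: cj_eq_self power_commutes)
        ultimately show ?thesis
          using ds by (simp add: cm_mult_right cj_def)
      qed
      moreover have "a * s \<in> ZC"
        using sgp_mult [OF sgpZC a(1)] sZC by (simp add: s_def)
      ultimately show thesis using that by blast
    qed (use a ds that in blast)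
    have bG: "b \<in> G" "b \<in> C" using b C_G by (auto simp: ZC_iff)
    have bl: "cm b l = s ^ 2"
      using b(3) inverse_involution [OF s4] inv_cm by metis
    interpret b: socle2 G n b l
      by unfold_locales (use bG b l bl s2 sgp_power [OF sgp_Z s_Z(1)] in auto)
    have bC: "c \<in> b.C" if "c \<in> C" for c
      using that b(1) C_G by (auto simp: b.C_iff ZC_iff)
    have bz: "b.z = s ^ 2" by (simp add: b.z_def bl)
    have zs: "z \<noteq> s ^ 2"
      using zl by (metis power_cyc power_mult s_def)
    have "u ^ 2 = s ^ 2 \<or> u ^ 2 = w"
      using b.noncommuting_structure(2) [OF bC bC uv(3)] uv cmw bz by metis
    moreover have "(u * s) ^ 2 = s ^ 2 \<or> (u * s) ^ 2 = w"
      using b.noncommuting_structure(2) [of "u * s" v] bC uv cmw bz ZC_square [OF uv sZC] by (metis s_def)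
    moreover have "u ^ 2 = z \<or> u ^ 2 = w"
      using pair_facts(2) [OF uv] cmw [OF uv] by simp
    moreover have "(u * s) ^ 2 = u ^ 2 * (z * w)"
      using toggle uv C_G by blast
    moreover have "w * (z * w) = z"
      using z_comm [OF wG] ww by (metis mult.assoc mult.right_neutral)
    ultimately show False using zs wz by auto
  qed
  show ?thesis
    using cov_trans [OF cov_trans [OF cov_G_C 1] 2] by simp
qed

lemma outside_square:
  assumes u: "u \<in> N"
  shows "(l * u) ^ 2 = s * cm l u * u ^ 2"
proof -
  have "u * (l * cm l u) = l * u"
    using mult_cj [of u l] by (simp add: cj_cm)
  then have "u * l * cm l u * cm l u = l * u * cm l u"
    by (simp add: mult.assoc)
  then have ul: "u * l = l * u * cm l u"
    using d_facts(1) [OF u] by (simp add: mult.assoc power2_eq_square)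
  have "(l * u) ^ 2 = l * (u * l) * u"
    by (simp add: power2_eq_square mult.assoc)
  also have "\<dots> = l * l * (u * cm l u) * u"
    by (simp add: ul mult.assoc)
  also have "u * cm l u = cm l u * u"
    using Z_commute [OF d_facts(3) [OF u] N_G [OF u]] by simp
  finally show ?thesis
    by (simp add: s_def power2_eq_square mult.assoc)
qed

text \<open>If \<open>u ^ 2 = z\<close>, then \<open>x = l * u * h\<close> has square 1 or
  \<open>s\<close>, so its powers avoid \<open>z\<close> and \<open>v\<close> or
  \<open>h * v\<close> normalises \<open>cyc x\<close>; this forces the commutator to be
  \<open>s\<close> or \<open>s * z\<close>. Then \<open>s \<noteq> 1\<close>, so
  \<open>noinv\<close> excludes involutions outside \<open>C\<close>, and the squares of
  \<open>l * y\<close> and \<open>l * y * h\<close> for \<open>y\<close> among \<open>u\<close>,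
  \<open>v\<close>, \<open>u * v\<close> leave no possibility.\<close>

lemma hamiltonian_N:
  assumes s2: "s ^ 2 = 1" and noinv: "s = 1 \<or> (\<forall>x\<in>G. x \<notin> C \<longrightarrow> x ^ 2 \<noteq> 1)"
    and uv: "u \<in> N" "v \<in> N" "cm u v \<noteq> 1"
  shows "u ^ 2 = cm u v"
proof (rule ccontr)
  assume neg: "u ^ 2 \<noteq> cm u v"
  define w where "w = cm u v"
  have C: "u \<in> C" "v \<in> C" "u \<in> G" "v \<in> G" using N_C N_G uv by auto
  note w = pair_facts [OF C(1,2) uv(3), folded w_def]
  have u2: "u ^ 2 = z" and wz: "w \<noteq> z" and w1: "w \<noteq> 1"
    using w(2) neg uv by (auto simp: w_def)
  have ss: "s * s = 1" "s * (s * x) = x" for x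
    using s2 by (simp_all add: power2_eq_square flip: mult.assoc)
  have ww: "w * w = 1" "w * (w * x) = x" for x
    using w(1) by (simp_all add: power2_eq_square flip: mult.assoc)
  have d: "cm l x = 1 \<or> cm l x = s" if "x \<in> N" for x
    using d_facts(2) [OF that] involution_cyc s2 by blast
  have zs: "z \<noteq> s" "z * s = s * z"
    using zl power_cyc [of l 2] z_comm s_Z by (auto simp: s_def)
  have sz: "s * z = z * s" "s * (z * x) = z * (s * x)" for x
    using zs(2) by (simp, metis mult.assoc)
  define x where "x = l * u * h"
  define s' where "s' = s * cm l u"
  have lu: "l * u \<in> G" "l * u \<notin> C"
    using l C G_mult outside_right by auto
  have x: "x \<in> G" "x \<notin> C"
    using lu C_mem h G_mult outside_right by (auto simp: x_def)
  have x2: "x ^ 2 = s'"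
    using square_h [OF lu] outside_square [OF uv(1)] u2 by (simp add: x_def s'_def mult.assoc)
  have s': "s' = 1 \<or> s' = s"
    using d [OF uv(1)] ss by (auto simp: s'_def)
  have in_x: "y = 1 \<or> y = s'" if "y \<in> cyc x" "y \<in> C" for y
  proof -
    have "s' ^ 2 = 1" using s' s2 by auto
    then show ?thesis
      using involution_cyc [of y s'] cyc_outside_C [OF x that] x2 by auto
  qed
  have zx: "z \<notin> cyc x"
    using in_x [of z] C_mem z(2) s' zs by auto
  have cx: "sgp (cyc x)" using x sgp_cyc_G by blast
  have cjv: "cj v x = x * (w * cm l v)"
  proof -
    have "cj v h = h" using C_h [OF C(2)] by (simp add: cj_eq_self)
    then have "cj v x = l * cm l v * (u * w) * h"
      by (simp add: x_def cj_mult cj_cm [of v l] cj_cm [of v u] w_def)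
    also have "\<dots> = l * (cm l v * (u * w * h))"
      by (simp add: mult.assoc)
    also have "cm l v * (u * w * h) = u * w * h * cm l v"
      using Z_commute [OF d_facts(3) [OF uv(2)]] C(3) w(7) h(1) G_mult by blast
    also have "u * w * h = u * h * w"
      using C_h [OF w(6)] by (simp add: mult.assoc)
    finally show ?thesis by (simp add: x_def mult.assoc)
  qed
  have "w * cm l v \<in> {1, s', z, s' * z}"
  proof -
    have dw: "w * cm l v \<in> C"
      using w(6) d_facts(3) [OF uv(2)] C_mem C_mult by blast
    consider "nz v (cyc x)" | "nz (h * v) (cyc x)"
      using outside_normaliser [OF x zx C(4)] by blast
    then show ?thesis
    proof cases
      case 1
      then have "x * (w * cm l v) \<in> cyc x"
        using cj_nz cyc_self cjv by metis
      then have "w * cm l v \<in> cyc x"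
        using sgp_mult_left [OF cx cyc_self] by blast
      then show ?thesis using in_x dw by blast
    next
      case 2
      have "cm h x = z" using cj_h [OF x] inv_h by (simp add: cm_cj)
      then have "cj h x = x * z"
        by (metis cj_cm inv_cm inv_z)
      then have "cj (h * v) x = x * (w * cm l v) * z"
        using cj_z [OF C(4)] cjv by (simp add: cj_comp cj_mult)
      then have "x * (w * cm l v * z) \<in> cyc x"
        using cj_nz [OF 2 cyc_self] by (simp add: mult.assoc)
      then have "w * cm l v * z \<in> cyc x"
        using sgp_mult_left [OF cx cyc_self] by blast
      then have "w * cm l v * z = 1 \<or> w * cm l v * z = s'"
        using in_x dw C_mem C_mult by blast
      then have "w * cm l v * z * z = z \<or> w * cm l v * z * z = s' * z" by auto
      then show ?thesis by (auto simp: mult.assoc)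
    qed
  qed
  then have "w * cm l v * cm l v \<in> {cm l v, s' * cm l v, z * cm l v, s' * z * cm l v}"
    by auto
  moreover have "w * cm l v * cm l v = w"
    using d_facts(1) [OF uv(2)] by (simp add: mult.assoc power2_eq_square)
  ultimately have w_cases: "w = s \<or> w = s * z"
    using d [OF uv(2)] s' w1 wz ss sz by (auto simp: mult.assoc)
  then have "s \<noteq> 1" using w1 wz by auto
  then have noinv': "y ^ 2 \<noteq> 1" if "y \<in> G" "y \<notin> C" for y
    using noinv that by blast
  have avoid: "s * cm l y * y ^ 2 \<noteq> 1" "s * cm l y * y ^ 2 \<noteq> z" if y: "y \<in> N" for y
  proof -
    have ly: "l * y \<in> G" "l * y \<notin> C"
      using l N_C N_G y G_mult outside_right by auto
    have lyh: "l * y * h \<in> G" "l * y * h \<notin> C"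
      using ly C_mem h G_mult outside_right by auto
    show "s * cm l y * y ^ 2 \<noteq> 1"
      using noinv' [OF ly] outside_square [OF y] by simp
    show "s * cm l y * y ^ 2 \<noteq> z"
      using noinv' [OF lyh] square_h [OF ly] outside_square [OF y] by auto
  qed
  have du: "cm l u = 1"
    using d [OF uv(1)] avoid(2) [OF uv(1)] u2 ss by auto
  have uvN: "u * v \<in> N" using sgp_mult [OF sgp_N] uv by blast
  have duv: "cm l (u * v) = cm l v"
    using du by (simp add: cm_mult_right)
  have "(u * v) ^ 2 = u ^ 2 * cj u v * v"
    by (rule square_mult)
  also have "cj u v = v * w"
    using w(4) by (simp add: cj_cm w_def)
  also have "u ^ 2 * (v * w) * v = z * v ^ 2 * w"
    using w(5) C u2 by (simp add: ZC_iff power2_eq_square mult.assoc)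
  finally have uv2: "(u * v) ^ 2 = z * v ^ 2 * w" .
  have ws: "s * w = 1 \<or> s * w = z"
    using w_cases ss by auto
  show False
  proof (cases "cm l v = 1")
    case True
    then have "s * v ^ 2 \<noteq> 1" "s * v ^ 2 \<noteq> z" "s * (u * v) ^ 2 \<noteq> 1" "s * (u * v) ^ 2 \<noteq> z"
      using avoid [OF uv(2)] avoid [OF uvN] duv by simp_all
    moreover have "v ^ 2 = z \<or> v ^ 2 = w" using w(3) .
    ultimately show False
      using uv2 ws by auto
  next
    case False
    then have dv: "cm l v = s" using d [OF uv(2)] by blast
    then have "v ^ 2 \<noteq> z" "(u * v) ^ 2 \<noteq> z"
      using avoid(2) [OF uv(2)] avoid(2) [OF uvN] duv ss by simp_all
    then have "v ^ 2 = w" using w(3) by blast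
    then show False
      using uv2 \<open>(u * v) ^ 2 \<noteq> z\<close> ww by (simp add: mult.assoc)
  qed
qed

text \<open>The factors 2, 2 and 4 belong to \<open>C\<close>, \<open>N\<close> and the centre of
  \<open>N\<close>. That centre is central in \<open>G\<close>: \<open>N\<close> and
  \<open>h\<close> exhaust \<open>C\<close>, and an element \<open>a\<close> of it moved by
  \<open>l\<close> would have the nontrivial square \<open>z * cm u v\<close>, which is incompatible
  with \<open>hamiltonian_N\<close> for \<open>u\<close> and \<open>u * a\<close>.\<close>

lemma bound_order_4:
  assumes uv: "u0 \<in> C" "v0 \<in> C" "cm u0 v0 \<noteq> 1"
    and s2: "s ^ 2 = 1" and noinv: "s = 1 \<or> (\<forall>x\<in>G. x \<notin> C \<longrightarrow> x ^ 2 \<noteq> 1)"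
  shows "cov G Z 16"
proof -
  have NC: "N \<subseteq> C" using N_C by blast
  have 1: "cov C N 2"
    by (rule cov2) (rule C_N)
  have 2: "cov N (N \<inter> centr N) 4"
  proof (rule cov_center_hamiltonian [OF sgp_N])
    show "a ^ 2 = cm a b \<and> cm a b ^ 2 = 1" if "a \<in> N" "b \<in> N" "cm a b \<noteq> 1" for a b
      using hamiltonian_N [OF s2 noinv that] pair_facts(1) that N_C by blast
    show "a \<in> centr N" if "a \<in> N" "a ^ 2 = 1" for a
      using involution_ZC that NC N_C by (auto simp: ZC_iff centr_def)
  qed
  have hN: "c * h = h * c" if "c \<in> N" for c
    using C_h N_C that by blast
  have NZC: "a \<in> ZC" if a: "a \<in> N" "a \<in> centr N" for a
  proof -
    have "a * c = c * a" if c: "c \<in> C" for c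
    proof (cases "c \<in> N")
      case True
      then show ?thesis using a by (simp add: centr_def)
    next
      case False
      then have "a * (h * c) = h * c * a"
        using C_N [OF c] a by (auto simp: centr_def)
      then have "h * (a * c) = h * (c * a)"
        using hN [OF a(1)] by (metis mult.assoc)
      then show ?thesis by simp
    qed
    then show ?thesis using N_C a by (simp add: ZC_iff)
  qed
  obtain u v where UV: "u \<in> N" "v \<in> N" "cm u v \<noteq> 1"
  proof -
    have h_comm: "h * c = c * h" if "c \<in> C" for c using C_h that by simp
    have "\<exists>u\<in>N. cm u v0 \<noteq> 1"
    proof (cases "u0 \<in> N")
      case False
      have "cm (h * u0) v0 = cm u0 v0"
        using h_comm [OF uv(2)] by (simp add: cm_mult_left cm_eq_one_iff [THEN iffD2])
      then show ?thesis using C_N [OF uv(1)] False uv(3) by metis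
    qed (use uv in blast)
    then obtain u where u: "u \<in> N" "cm u v0 \<noteq> 1" by blast
    show thesis
    proof (cases "v0 \<in> N")
      case False
      have "cm u (h * v0) = cm u v0"
        using hN [OF u(1)] by (simp add: cm_mult_right cm_eq_one_iff [THEN iffD2])
      then show ?thesis using C_N [OF uv(2)] False u that by metis
    qed (use u that in blast)
  qed
  have UVC: "u \<in> C" "v \<in> C" using UV N_C by auto
  note w = pair_facts [OF UVC UV(3)]
  have 3: "N \<inter> centr N \<subseteq> Z"
  proof
    fix a assume a: "a \<in> N \<inter> centr N"
    then have aZC: "a \<in> ZC" using NZC by blast
    have "cm l a = 1"
    proof (rule ccontr)
      assume "cm l a \<noteq> 1"
      have "cm l a \<in> cyc s"
        using d_facts(2) a by blast
      then have "cm l a = s"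
        using involution_cyc s2 \<open>cm l a \<noteq> 1\<close> by blast
      then have ds: "cm l a = s" "s \<noteq> 1"
        using \<open>cm l a \<noteq> 1\<close> by auto
      then have ni: "x ^ 2 \<noteq> 1" if "x \<in> G" "x \<notin> C" for x
        using noinv that by blast
      have la: "l * a \<in> G" "l * a \<notin> C"
        using l N_G N_C a G_mult outside_right by auto
      have "(l * a) ^ 2 = a ^ 2"
        using outside_square [of a] a ds s2 by (simp add: power2_eq_square)
      then have "a ^ 2 \<noteq> 1" using ni la by metis
      then have a2: "a ^ 2 = z * cm u v"
        using ZC_square(1) [OF UVC UV(3) aZC] by blast
      have "u ^ 2 = cm u v"
        by (rule hamiltonian_N [OF s2 noinv UV])
      then have "(u * a) ^ 2 = cm u v * (z * cm u v)"
        using ZC_square(3) [OF UVC UV(3) aZC] a2 by simp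
      also have "\<dots> = cm u v * cm u v * z"
        using z_comm [OF w(7)] by (simp add: mult.assoc)
      also have "\<dots> = z"
        using w(1) by (simp add: power2_eq_square)
      finally have "(u * a) ^ 2 = z" .
      moreover have "(u * a) ^ 2 = cm (u * a) v"
        by (rule hamiltonian_N [OF s2 noinv])
           (use sgp_mult [OF sgp_N UV(1)] a UV ZC_square(2) [OF UVC UV(3) aZC] in auto)
      ultimately have "cm u v = z"
        using ZC_square(2) [OF UVC UV(3) aZC] by simp
      then show False using a2 \<open>a ^ 2 \<noteq> 1\<close> by simp
    qed
    then show "a \<in> Z"
      by (intro ZC_Z [OF aZC l]) (simp add: cm_eq_one_iff)
  qed
  have "cov G Z (2 * (2 * 4))"
    using cov_trans [OF cov_G_C cov_trans [OF 1 cov_mono [OF 2 subset_refl 3 order_refl]]] .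
  then show ?thesis by simp
qed

end

section \<open>The case where every cyclic subgroup outside C contains z\<close>

context socle2 begin

text \<open>Four steps of index 2 reach the centre: to \<open>C\<close>, to the centraliser of
  \<open>l ^ 2\<close> in \<open>C\<close>, to that of \<open>l\<close>, and to \<open>Z\<close>;
  the translating elements are \<open>l\<close>, \<open>v\<close>, \<open>h\<close> and
  \<open>l ^ 2\<close>. The auxiliary facts hold for every outside element, because the last step
  needs them for \<open>l * v\<close> too.\<close>

lemma bound_containing:
  assumes nc: "u0 \<in> C" "v0 \<in> C" "cm u0 v0 \<noteq> 1"
    and all: "\<And>l. l \<in> G \<Longrightarrow> l \<notin> C \<Longrightarrow> z \<in> cyc l"
  shows "cov G Z 16"
proof -
  have B1: "l ^ 2 \<noteq> 1" if l: "l \<in> G" "l \<notin> C" for l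
    using involution_cyc [OF all [OF l]] z(2) l(2) C_mem(2) by auto
  have B1': "l ^ 2 \<noteq> z" if l: "l \<in> G" "l \<notin> C" for l
  proof
    assume a: "l ^ 2 = z"
    then have "(l * h) ^ 2 = 1"
      using square_h [OF l] by simp
    then show False
      using B1 [of "l * h"] l C_mem h G_mult outside_right by blast
  qed
  have sC: "l ^ 2 \<in> C" "l ^ 2 \<in> G" if l: "l \<in> G" "l \<notin> C" for l
    using square_C l G_power by auto
  have zs: "z \<in> cyc (l ^ 2)" if l: "l \<in> G" "l \<notin> C" for l
    using cyc_outside_C [OF l all [OF l]] C_mem by blast
  \<comment> \<open>Otherwise \<open>s ^ 2\<close> is 1 or \<open>z * w\<close>, an element of
    square 1 different from \<open>z\<close>, and the powers of \<open>s\<close> could not contain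
    \<open>z\<close>.\<close>
  have notZC: "l ^ 2 \<notin> ZC" if l: "l \<in> G" "l \<notin> C" for l
  proof
    assume a: "l ^ 2 \<in> ZC"
    define s where "s = l ^ 2"
    define w where "w = cm u0 v0"
    note w = pair_facts [OF nc, folded w_def]
    have wz: "w * z = z * w" using z_comm [OF w(7)] .
    have zw2: "(z * w) ^ 2 = 1"
      using power_mult_commute [of z w 2] wz w(1) z2 by simp
    have zw: "z * w \<noteq> z" using nc(3) by (metis left_cancel mult.right_neutral w_def)
    consider "s ^ 2 = 1" | "s ^ 2 = z * w"
      using ZC_square(1) [OF nc a] by (auto simp: s_def w_def)
    then show False
    proof cases
      case 1
      then have "z = s"
        using involution_cyc zs [OF l] z(2) unfolding s_def by metis
      then show False using B1' [OF l] by (simp add: s_def)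
    next
      case 2
      obtain r where r: "r ^ 2 = z" "r = s \<or> (\<exists>q\<in>cyc s. r = q ^ 2)"
        using order4_in_cyc [OF sC(2) [OF l] B1 [OF l] B1' [OF l] zs [OF l]] by (metis s_def)
      show False
      proof (cases "r = s")
        case False
        then obtain i where "r = (s ^ i) ^ 2"
          using r(2) by (auto simp: cyc_def)
        then have "r = (z * w) ^ i"
          by (simp add: mult.commute flip: 2 power_mult)
        then have "r ^ 2 = 1"
          using zw2 by (metis mult.commute power_mult power_one)
        then show False using r(1) z(2) by simp
      qed (use r 2 zw in simp)
    qed
  qed
  have s2: "(l ^ 2) ^ 2 = z" if l: "l \<in> G" "l \<notin> C" for l
  proof -
    define s where "s = l ^ 2"
    obtain v where v: "v \<in> C" "cm s v \<noteq> 1"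
      using notZC [OF l] sC [OF l] by (auto simp: s_def ZC_iff cm_eq_one_iff)
    have s: "s \<in> C" using sC l by (simp add: s_def)
    note w = pair_facts [OF s v]
    consider "s ^ 2 = z" | "s ^ 2 = cm s v" using w(2) by blast
    then have "s ^ 2 = z"
    proof cases
      case 2
      have "z \<in> {1, s, cm s v, s * cm s v}"
        using cyc_square [OF zs [OF l, folded s_def] 2 w(1)] .
      moreover have "z \<noteq> s" using B1' [OF l] by (auto simp: s_def)
      moreover have "z \<noteq> s * cm s v"
      proof
        assume "z = s * cm s v"
        then have "z ^ 2 = s ^ 2 * cm s v ^ 2"
          using power_mult_commute [of s "cm s v" 2] w(5) s by (simp add: ZC_iff)
        then show False using w(1,8) z2 by simp
      qed
      ultimately have "z = cm s v" using z(2) by auto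
      then show ?thesis using 2 by simp
    qed
    then show ?thesis by (simp add: s_def)
  qed
  have nzs: "nz (l ^ 2) (cyc v)" if "l \<in> G" "v \<in> G" for l v
    using nz_square sgp_cyc_G cyc_G that by blast
  \<comment> \<open>Neither \<open>v\<close> nor \<open>s * v\<close> commutes with the square
    \<open>s\<close>, so both have square \<open>w\<close> by \<open>normaliser_pair\<close>; direct
    computation gives \<open>z\<close> for the second.\<close>
  have B2: "cm (l ^ 2) v = z" "v ^ 2 = z" if l: "l \<in> G" "l \<notin> C" and v: "v \<in> C" "cm (l ^ 2) v \<noteq> 1" for l v
  proof -
    define s where "s = l ^ 2"
    have s: "s \<in> C" "s \<in> G" using sC l by (auto simp: s_def)
    define w where "w = cm s v"
    have sv: "cm s v \<noteq> 1" using v by (simp add: s_def)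
    note w = pair_facts [OF s(1) v(1) sv, folded w_def]
    have v2: "v ^ 2 = w"
      unfolding w_def by (rule normaliser_pair [OF s(1) _ v(1) sv]) (use nzs l v C_G s_def in auto)
    have svC: "s * v \<in> C" "s * v \<in> G" using C_mult s v C_G by auto
    have "cm s (s * v) = w"
      by (simp add: cm_mult_right w_def cm_eq_one_iff [of s s, THEN iffD2])
    then have "(s * v) ^ 2 = w"
      using normaliser_pair [OF s(1) _ svC(1)] nzs l svC(2) sv by (metis s_def w_def)
    moreover have "(s * v) ^ 2 = z"
    proof -
      have "(s * v) ^ 2 = s ^ 2 * cj s v * v"
        by (rule square_mult)
      also have "cj s v = v * w"
        using w(4) by (simp add: cj_cm [of s v] w_def)
      also have "s ^ 2 * (v * w) * v = z * (v ^ 2 * w)"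
        using w(5) v(1) s2 [OF l] by (simp add: s_def ZC_iff power2_eq_square mult.assoc)
      finally show ?thesis
        using v2 w(1) by (simp add: power2_eq_square)
    qed
    ultimately have "w = z" by simp
    then show "cm (l ^ 2) v = z" "v ^ 2 = z"
      using v2 by (simp_all add: w_def s_def)
  qed
  \<comment> \<open>By \<open>inverting_square\<close> the outside element \<open>l * v\<close>
    would have square 1 or \<open>z\<close>, both excluded.\<close>
  have B3: "\<not> nz v (cyc l)" if l: "l \<in> G" "l \<notin> C" and v: "v \<in> C" "cm (l ^ 2) v \<noteq> 1" for l v
  proof
    assume n: "nz v (cyc l)"
    have "(l ^ 2) ^ 4 = ((l ^ 2) ^ 2) ^ 2" by (simp flip: power_mult)
    then have "(l ^ 2) ^ 4 = 1" using s2 [OF l] z2 by metis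
    moreover have "(l ^ 2) ^ 2 \<noteq> 1" using s2 [OF l] z(2) by simp
    ultimately have "(l * v) ^ 2 = 1 \<or> (l * v) ^ 2 = (l ^ 2) ^ 2"
      using inverting_square [OF l(1) v(1) n] B2 [OF l v] s2 [OF l] by metis
    then have "(l * v) ^ 2 = 1 \<or> (l * v) ^ 2 = z" using s2 [OF l] by simp
    then show False
      using B1 [of "l * v"] B1' [of "l * v"] l v C_G G_mult outside_right by blast
  qed
  \<comment> \<open>Neither \<open>v\<close> nor \<open>v * x\<close> normalises
    \<open>cyc l\<close>, so \<open>P3\<close> applied to \<open>v\<close> leaves \<open>x\<close>
    itself as a normalising element.\<close>
  have B5: "cm l x = 1 \<or> cm l x = z" if l: "l \<in> G" "l \<notin> C" and x: "x \<in> C" "cm (l ^ 2) x = 1" for l x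
  proof -
    have cl: "sgp (cyc l)" "cyc l \<subseteq> G" using l sgp_cyc_G cyc_G by auto
    obtain v where v: "v \<in> C" "cm (l ^ 2) v \<noteq> 1"
      using notZC [OF l] sC [OF l] by (auto simp: ZC_iff cm_eq_one_iff)
    obtain i where i: "i < 2" "nz (v ^ i * x) (cyc l)"
      using P3 [OF cl C_G [OF v(1)] C_G [OF x(1)] B3 [OF l v]] by blast
    have "cm (l ^ 2) (v * x) \<noteq> 1"
      using x(2) v(2) by (simp add: cm_mult_right) (metis cj_def cj_eq_one)
    then have "\<not> nz (v * x) (cyc l)"
      using B3 [OF l] C_mult v x by blast
    then have n: "nz x (cyc l)"
      using i by (auto simp: less_2_cases_iff)
    define d where "d = cm l x"
    have "l * d \<in> cyc l"
      using cj_nz [OF n cyc_self] by (simp add: d_def cj_cm)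
    then have dl: "d \<in> cyc l"
      using sgp_mult_left [OF cl(1) cyc_self] by blast
    then have ld: "l * d = d * l"
      using cyc_commute by metis
    have "(l * d) ^ 2 = cj x (l ^ 2)"
      by (simp add: d_def cj_cm [of x l, symmetric] cj_power)
    also have "\<dots> = l ^ 2"
      using x(2) by (simp add: cm_eq_one_iff cj_eq_self)
    finally have "l ^ 2 * d ^ 2 = l ^ 2 * 1"
      using power_mult_commute [OF ld, of 2] by simp
    then have d2: "d ^ 2 = 1" by (simp only: left_cancel)
    have "d \<in> cyc (l ^ 2)"
      using cyc_outside_C [OF l dl] cm_C [OF l(1) C_G [OF x(1)]] by (simp add: d_def)
    then have "d \<in> {1, l ^ 2, z, l ^ 2 * z}"
      using cyc_square s2 [OF l] z2 by blast
    moreover have "d \<noteq> l ^ 2" using d2 s2 [OF l] z(2) by auto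
    moreover have "d \<noteq> l ^ 2 * z"
    proof
      assume "d = l ^ 2 * z"
      then have "d ^ 2 = (l ^ 2) ^ 2 * z ^ 2"
        using power_mult_commute [OF z_comm [OF sC(2) [OF l]], of 2] by simp
      then show False using d2 s2 [OF l] z2 z(2) by simp
    qed
    ultimately show ?thesis by (auto simp: d_def)
  qed
  define l where "l = t"
  define s where "s = l ^ 2"
  have l: "l \<in> G" "l \<notin> C" using t C_mem by (auto simp: l_def)
  have s: "s \<in> C" "s \<in> G" "s ^ 2 = z" using sC [OF l] s2 [OF l] by (auto simp: s_def)
  obtain v where v: "v \<in> C" "cm s v \<noteq> 1"
    using notZC [OF l] s by (auto simp: s_def ZC_iff cm_eq_one_iff)
  have sv: "cm s v = z" using B2 [OF l] v by (simp add: s_def)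
  \<comment> \<open>Otherwise the nontrivial commutators of \<open>x\<close> all equal
    \<open>w = x ^ 2\<close> and those of \<open>s * x\<close> equal \<open>z * w\<close>, which
    forces \<open>cm x v = w\<close>. Then \<open>x\<close> commutes with the square of
    \<open>k = l * v\<close>, but \<open>cm k x = w\<close> contradicts \<open>B5\<close>.\<close>
  have B6: "x \<in> Z \<or> s * x \<in> Z" if x: "x \<in> C" "cm l x = 1" for x
  proof (rule ccontr)
    assume neg: "\<not> (x \<in> Z \<or> s * x \<in> Z)"
    have lx: "x * l = l * x" using x(2) by (simp add: cm_eq_one_iff)
    have sl: "s * l = l * s" by (simp add: s_def power_commutes)
    have xs: "x * s = s * x"
      using commute_power [of l x 2] lx by (simp add: s_def)
    have xC: "x \<in> C" "s * x \<in> C" using x s C_mult by auto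
    have nZC: "x \<notin> ZC" "s * x \<notin> ZC"
      using neg ZC_Z [OF _ l] lx commute_mult [OF sl lx] by blast+
    obtain y where y: "y \<in> C" "cm x y \<noteq> 1"
      using nZC(1) xC by (auto simp: ZC_iff cm_eq_one_iff)
    obtain y' where y': "y' \<in> C" "cm (s * x) y' \<noteq> 1"
      using nZC(2) xC by (auto simp: ZC_iff cm_eq_one_iff)
    have sx2: "(s * x) ^ 2 = z * x ^ 2"
      using power_mult_commute [of s x 2] xs s(3) by simp
    have xz: "x ^ 2 \<noteq> z"
    proof
      assume "x ^ 2 = z"
      then have "(s * x) ^ 2 = 1" using sx2 by simp
      then show False using nZC(2) involution_ZC xC by blast
    qed
    define w where "w = x ^ 2"
    have cmx: "cm x y = w" if "y \<in> C" "cm x y \<noteq> 1" for y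
      using pair_facts(2) [OF xC(1) that] xz by (simp add: w_def)
    have w: "w ^ 2 = 1" "w \<noteq> 1" "w \<in> C" "w \<in> ZC" "w \<noteq> z"
      using pair_facts [OF xC(1) y] cmx [OF y] y xz by (auto simp: w_def)
    have cmsx: "cm (s * x) y = z * w" if "y \<in> C" "cm (s * x) y \<noteq> 1" for y
    proof -
      have "z * w \<noteq> z" using w(2) by (metis left_cancel mult.right_neutral)
      then show ?thesis
        using pair_facts(2) [OF xC(2) that] sx2 by (simp add: w_def)
    qed
    have "cm (s * x) v = z * cm x v"
      using sv cj_z [OF C_G [OF xC(1)]] by (simp add: cm_mult_left cj_def)
    moreover have "cm x v = 1 \<or> cm x v = w" using cmx v by blast
    moreover have "z * 1 \<noteq> 1" using z by simp
    ultimately have xv: "cm x v = w"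
      using cmsx [OF v(1)] w(2) by (metis left_cancel)
    define k where "k = l * v"
    have k: "k \<in> G" "k \<notin> C" using l v C_G G_mult outside_right by (auto simp: k_def)
    have vx: "cj x v = v * w"
      using pair_facts(4) [OF xC(1) v(1)] xv w(2) by (simp add: cj_cm [of x v])
    have xl: "cj x l = l" using lx by (simp add: cj_eq_self)
    have lw: "cj l w = w"
      using commute_power [OF lx, of 2] by (simp add: w_def cj_eq_self)
    have "cj x (cj l v) = cj l v * w"
    proof -
      have "cj x (cj l v) = cj (l * x) v" by (simp add: cj_comp)
      also have "\<dots> = cj l (cj x v)" by (simp add: lx [symmetric] cj_comp)
      finally show ?thesis by (simp add: vx cj_mult lw)
    qed
    moreover have "k ^ 2 = s * cj l v * v"
      by (simp add: k_def square_mult s_def)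
    moreover have "cj x s = s" using xs by (simp add: cj_eq_self)
    ultimately have "cj x (k ^ 2) = s * (cj l v * w) * (v * w)"
      by (simp add: cj_mult vx)
    also have "\<dots> = s * cj l v * (w * v) * w"
      by (simp add: mult.assoc)
    also have "w * v = v * w"
      using w(4) v(1) by (simp add: ZC_iff)
    also have "s * cj l v * (v * w) * w = s * cj l v * v * (w * w)"
      by (simp add: mult.assoc)
    also have "\<dots> = k ^ 2"
      using w(1) \<open>k ^ 2 = s * cj l v * v\<close> by (simp add: power2_eq_square)
    finally have "cm (k ^ 2) x = 1"
      by (simp add: cj_eq_self cm_eq_one_iff)
    then have "cm k x = 1 \<or> cm k x = z"
      by (rule B5 [OF k xC(1)])
    moreover have "cj x k = k * w"
      by (simp add: k_def cj_mult xl vx mult.assoc)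
    then have "cm k x = w"
      by (simp add: cm_cj)
    ultimately show False using w by simp
  qed
  have 1: "cov G C 2"
    by (rule covI_power) (rule cover [OF l])
  have 2: "cov C {x \<in> C. cm s x = 1} 2"
  proof (rule cov2 [of _ _ v])
    fix x assume x: "x \<in> C"
    show "x \<in> {x \<in> C. cm s x = 1} \<or> v * x \<in> {x \<in> C. cm s x = 1}"
    proof (cases "cm s x = 1")
      case False
      then have "cm s x = z" using B2 [OF l x] by (simp add: s_def)
      then have "cm s (v * x) = 1"
        using sv cj_z [OF C_G [OF x]] by (simp add: cm_mult_right cj_def)
      then show ?thesis using C_mult v x by blast
    qed (use x in blast)
  qed
  have 3: "cov {x \<in> C. cm s x = 1} {x \<in> C. cm l x = 1} 2"
  proof (rule cov2 [of _ _ h])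
    fix x assume x: "x \<in> {x \<in> C. cm s x = 1}"
    have "cm h l = z" using cj_h [OF l] inv_h by (simp add: cm_cj)
    then have "cm l h = z" using inv_cm inv_z by metis
    then have "cm l (h * x) = cm l x * z"
      using cj_z [of x] C_G x by (simp add: cm_mult_right cj_def)
    moreover have "z * z = 1" using z2 by (simp add: power2_eq_square)
    ultimately show "x \<in> {x \<in> C. cm l x = 1} \<or> h * x \<in> {x \<in> C. cm l x = 1}"
      using B5 [OF l, of x] x C_mult C_mem by (auto simp: s_def)
  qed
  have 4: "cov {x \<in> C. cm l x = 1} Z 2"
    by (rule cov2 [of _ _ s]) (use B6 in blast)
  show ?thesis
    using cov_trans [OF 1 cov_trans [OF 2 cov_trans [OF 3 4]]] by simp
qed

lemma socle_bound_2: "cov G Z 16"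
proof (cases "\<forall>a\<in>C. \<forall>b\<in>C. a * b = b * a")
  case True
  then have "cov G Z (2 ^ 3)"
    using abelian_C by blast
  then show ?thesis
    by (rule cov_mono) auto
next
  case False
  then obtain u v where uv: "u \<in> C" "v \<in> C" "cm u v \<noteq> 1"
    by (auto simp: cm_eq_one_iff)
  show ?thesis
  proof (cases "\<forall>l\<in>G. l \<notin> C \<longrightarrow> z \<in> cyc l")
    case True
    then show ?thesis using bound_containing [OF uv] by blast
  next
    case F: False
    show ?thesis
    \<comment> \<open>An outside involution is taken as \<open>l\<close> whenever there is one,
      since \<open>bound_order_4\<close> asks for \<open>s = 1\<close> or for the absence of such
      involutions.\<close>
    proof (cases "\<exists>x\<in>G. x \<notin> C \<and> x ^ 2 = 1")
      case True
      then obtain x where x: "x \<in> G" "x \<notin> C" "x ^ 2 = 1" by blast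
      have "z \<notin> cyc x"
        using involution_cyc x z(2) C_mem(2) by metis
      then interpret avoiding G n h t x
        using x involution_ZC sgp_one [OF sgp_C] by unfold_locales auto
      show ?thesis
        by (rule bound_order_4 [OF uv]) (use x in \<open>auto simp: s_def\<close>)
    next
      case noinv: False
      obtain l where l: "l \<in> G" "l \<notin> C" "z \<notin> cyc l" "l ^ 2 \<in> ZC"
        using F avoiding_outside by metis
      interpret avoiding G n h t l
        by unfold_locales (use l in auto)
      show ?thesis
        using bound_order_8 [OF uv] bound_order_4 [OF uv] noinv by blast
    qed
  qed
qed

end

section \<open>Minimal counterexamples\<close>

context few_conj begin

lemma noncentral_socle_bound:
  assumes "x \<in> G" "x ^ p = 1" "x \<notin> Z"
  shows "cov G Z (if p = 2 then 16 else p ^ 3)"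
proof -
  obtain h t where ht: "h \<in> G" "h ^ p = 1" "t \<in> G" "cm h t \<in> Z" "cm h t \<noteq> 1"
    using central_commutator assms by blast
  have s: "socle G p n h t"
    by unfold_locales (use ht in auto)
  show ?thesis
  proof (cases "p = 2")
    case True
    then have "socle2 G n h t"
      using s by (simp add: socle2_def)
    then show ?thesis using socle2.socle_bound_2 True by simp
  next
    case False
    then show ?thesis using socle.socle_bound_odd [OF s] by simp
  qed
qed

text \<open>A normal subgroup \<open>N\<close> of maximal order among those for which \<open>G/N\<close> violates the bound
  makes \<open>G/N\<close> a minimal counterexample.\<close>

lemma center_bound: "cov G Z (if p = 2 then 16 else p ^ 3)"
proof (rule ccontr)
  define B where "B = (if p = 2 then 16 else p ^ 3)"
  assume neg: "\<not> cov G Z (if p = 2 then 16 else p ^ 3)"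
  \<comment> \<open>\<open>K N\<close> is the preimage of the centre of \<open>G/N\<close>, so all
    quotients are compared inside the one group \<open>G\<close>.\<close>
  define K where "K N = {g \<in> G. \<forall>x\<in>G. cm g x \<in> N}" for N
  define \<N> where "\<N> = {N. sgp N \<and> N \<subseteq> G \<and> (\<forall>x\<in>G. nz x N) \<and> \<not> cov G (K N) B}"
  have "K {1} = Z"
    by (auto simp: K_def Z_def centr_def cm_eq_one_iff)
  moreover have "sgp {1}" "\<forall>x\<in>G. nz x {1}"
    by (auto simp: sgp_def nz_def)
  ultimately have "{1} \<in> \<N>"
    using neg G_one by (simp add: \<N>_def B_def)
  moreover have "finite \<N>"
    by (rule finite_subset [of _ "Pow G"]) (use fin_G in \<open>auto simp: \<N>_def\<close>)
  ultimately obtain N where N: "N \<in> \<N>" "\<And>M. M \<in> \<N> \<Longrightarrow> N \<subseteq> M \<Longrightarrow> N = M"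
    using finite_has_maximal [of \<N>] by blast
  have Np: "sgp N" "N \<subseteq> G" "\<And>x. x \<in> G \<Longrightarrow> nz x N" "\<not> cov G (K N) B"
    using N(1) by (auto simp: \<N>_def)
  obtain f :: "'a \<Rightarrow> ('a set) Perm.perm"
    where f: "\<And>x y. x \<in> G \<Longrightarrow> y \<in> G \<Longrightarrow> f (x * y) = f x * f y"
      and ker: "\<And>x. x \<in> G \<Longrightarrow> f x = 1 \<longleftrightarrow> x \<in> N"
    using quotient_hom [OF Np(1-3)] by blast
  interpret F: few_conj_hom G p n f
    by unfold_locales (rule f)
  interpret Q: few_conj "f ` G" p n by (rule F.few_conj_image)
  \<comment> \<open>If this failed for \<open>z\<close>, the preimage \<open>M\<close> of
    \<open>cyc z\<close> would be a larger normal subgroup with \<open>K M\<close> inside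
    \<open>K N\<close>; the bound for \<open>G/M\<close>, which holds by maximality, would carry
    over to \<open>G/N\<close>.\<close>
  have D: "\<exists>g\<in>f ` G. g \<notin> Q.Z \<and> (\<forall>x\<in>f ` G. cm g x \<in> cyc z)"
    if z: "z \<in> Q.Z" "z \<noteq> 1" "z ^ p = 1" for z
  proof (rule ccontr)
    assume no: "\<not> (\<exists>g\<in>f ` G. g \<notin> Q.Z \<and> (\<forall>x\<in>f ` G. cm g x \<in> cyc z))"
    define M where "M = {x \<in> G. f x \<in> cyc z}"
    have zG: "z \<in> f ` G" using z Q.Z_G by blast
    have sM: "sgp M"
      unfolding M_def by (rule F.sgp_vimage [OF Q.sgp_cyc_G [OF zG]])
    have MG: "M \<subseteq> G" by (auto simp: M_def)
    have nM: "nz x M" if x: "x \<in> G" for x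
    proof (rule nz_finite)
      fix y assume y: "y \<in> M"
      then have "f y \<in> Q.Z" using Q.cyc_Z [OF z(1)] by (auto simp: M_def)
      then have 1: "cj (f x) (f y) = f y"
        using Q.Z_commute x by (metis cj_eq_self imageI)
      have 2: "y \<in> G" "f y \<in> cyc z" using y by (auto simp: M_def)
      have "f (cj x y) \<in> cyc z" "cj x y \<in> G"
        using 1 2 x by (simp_all add: F.f_cj) (simp add: cj_def G_mult G_inv)
      then show "cj x y \<in> M"
        by (simp add: M_def)
    qed (use MG fin_G finite_subset in blast)
    have NM: "N \<subseteq> M"
    proof
      fix x assume x: "x \<in> N"
      then have "f x = 1" using ker Np(2) by blast
      then show "x \<in> M"
        using x Np(2) sgp_one [OF Q.sgp_cyc_G [OF zG]] by (auto simp: M_def)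
    qed
    obtain z0 where z0: "z0 \<in> G" "z = f z0" using zG by blast
    have "z0 \<in> M" "z0 \<notin> N"
      using z0 z ker cyc_self by (auto simp: M_def)
    then have "M \<notin> \<N>" using N(2) NM by blast
    then have "cov G (K M) B" using sM MG nM by (simp add: \<N>_def)
    moreover have "K M \<subseteq> K N"
    proof
      fix g assume g: "g \<in> K M"
      then have gG: "g \<in> G" by (simp add: K_def)
      have "cm (f g) y \<in> cyc z" if y: "y \<in> f ` G" for y
      proof -
        obtain x where x: "x \<in> G" "y = f x" using y by blast
        then have "cm g x \<in> M" using g by (simp add: K_def)
        then show ?thesis using x gG by (simp add: M_def F.f_cm)
      qed
      then have "f g \<in> Q.Z" using no gG by blast
      then have "f (cm g x) = 1" if "x \<in> G" for x
        using that gG Q.Z_commute [of "f g" "f x"] by (simp add: F.f_cm cm_eq_one_iff)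
      then show "g \<in> K N"
        using gG ker G_cm by (simp add: K_def)
    qed
    ultimately have "cov G (K N) B" using cov_mono by blast
    then show False using Np by blast
  qed
  have "cov (f ` G) Q.Z B"
  proof (cases "\<exists>x\<in>f ` G. x ^ p = 1 \<and> x \<notin> Q.Z")
    case True
    then show ?thesis unfolding B_def using Q.noncentral_socle_bound by blast
  next
    case False
    then show ?thesis unfolding B_def using Q.central_socle_bound D by blast
  qed
  then obtain E where E: "finite E" "card E \<le> B" "\<And>a. a \<in> f ` G \<Longrightarrow> \<exists>e\<in>E. e * a \<in> Q.Z"
    unfolding cov_def by blast
  define r where "r e = (SOME g. g \<in> G \<and> f g = e)" for e
  have r: "r e \<in> G \<and> f (r e) = e" if "e \<in> f ` G" for e
    unfolding r_def by (rule someI_ex) (use that in auto)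
  have "cov G (K N) B"
    unfolding cov_def
  proof (intro exI [of _ "r ` E"] conjI ballI)
    show "finite (r ` E)" using E by simp
    show "card (r ` E) \<le> B" using card_image_le [OF E(1), of r] E(2) by linarith
    fix a assume a: "a \<in> G"
    then obtain e where e: "e \<in> E" "e * f a \<in> Q.Z" using E(3) by blast
    then have "e \<in> f ` G"
      using sgp_mult_right [OF Q.sgp_G] Q.Z_G a by blast
    then have re: "r e \<in> G" "f (r e) = e" using r by auto
    have "f (cm (r e * a) x) = 1" if "x \<in> G" for x
      using that re a e(2) Q.Z_commute [OF e(2), of "f x"] by (simp add: F.f_cm G_mult f cm_eq_one_iff)
    then have "r e * a \<in> K N"
      using re a G_mult ker G_cm by (simp add: K_def)
    then show "\<exists>e\<in>r ` E. e * a \<in> K N" using e by blast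
  qed
  then show False using Np by blast
qed

end

section \<open>Abstract groups\<close>

context pgrp begin

text \<open>An element that moves one of the \<open>p\<close> conjugates has an orbit whose length
  is a power of \<open>p\<close> above 1, so it permutes all of them in a single cycle. The action
  is therefore that of a cyclic group of order dividing \<open>p\<close>, in which
  \<open>p\<close>-th powers and commutators vanish.\<close>

lemma few_conjI:
  assumes conj: "\<And>H. sgp H \<Longrightarrow> H \<subseteq> G \<Longrightarrow> \<exists>x\<in>G. \<not> nz x H \<Longrightarrow> card ((\<lambda>x. cj x ` H) ` G) = p"
  shows "few_conj G p n"
proof -
  have main: "nz (x ^ p) H \<and> nz (cm x y) H \<and> (\<not> nz x H \<longrightarrow> (\<exists>i<p. nz (x ^ i * y) H))"
    if H: "sgp H" "H \<subseteq> G" and xy: "x \<in> G" "y \<in> G" for H x y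
  proof (cases "\<exists>x\<in>G. \<not> nz x H")
    case True
    define a where "a x S = cj x ` S" for x and S :: "'a set"
    define K where "K = (\<lambda>x. a x H) ` G"
    have cK: "card K = p" "finite K"
      using conj [OF H True] fin_G by (simp_all add: K_def a_def)
    have am: "a (u * v) S = a v (a u S)" for u v S
      by (simp add: a_def image_image cj_comp)
    have a1 [simp]: "a 1 S = S" for S
      by (simp add: a_def)
    have ai: "a u S = a u T \<longleftrightarrow> S = T" for u S T
      unfolding a_def by (rule inj_image_eq_iff) (simp add: inj_def)
    have aK: "a u S \<in> K" if u: "u \<in> G" and S: "S \<in> K" for u S
    proof -
      obtain v where v: "v \<in> G" "S = a v H" using S by (auto simp: K_def)
      have "v * u \<in> G" "a u S = a (v * u) H" using v u G_mult am by auto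
      then show ?thesis unfolding K_def by blast
    qed
    have HK: "H \<in> K"
      unfolding K_def by (rule image_eqI [of _ _ 1]) (simp_all add: G_one)
    have finH: "finite H"
      using H fin_G finite_subset by blast
    have nz_iff: "nz u H \<longleftrightarrow> a u H = H" for u
    proof
      assume "nz u H"
      then have "cj u ` H \<subseteq> H" using cj_nz by blast
      then show "a u H = H"
        unfolding a_def using finH by (intro endo_inj_surj) (auto simp: inj_on_def)
    next
      assume "a u H = H"
      then show "nz u H"
        using finH by (intro nz_finite) (auto simp: a_def)
    qed
    have fixpow: "a (u ^ i) S = S" if "a u S = S" for u i S
      using that by (induction i) (simp_all add: am)
    have orb: "(\<lambda>i. a (u ^ i) S) ` {..<p} = K \<and> a (u ^ p) S = S"
      if u: "u \<in> G" and S: "S \<in> K" and moved: "a u S \<noteq> S" for u S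
    proof -
      define d where "d = (LEAST d. 0 < d \<and> a (u ^ d) S = S)"
      have "0 < d \<and> a (u ^ d) S = S"
        unfolding d_def by (rule LeastI [of _ "p ^ n"]) (use pn_pos exp_G u in simp)
      then have d: "0 < d" "a (u ^ d) S = S" by auto
      have min: "d \<le> k" if "0 < k" "a (u ^ k) S = S" for k
        unfolding d_def using that by (intro Least_le) simp
      have "u ^ (d * (p ^ n div d)) * u ^ (p ^ n mod d) = 1"
        using exp_G [OF u] by (simp flip: power_add)
      from this [THEN arg_cong, of "\<lambda>v. a v S"]
      have "a (u ^ (d * (p ^ n div d)) * u ^ (p ^ n mod d)) S = S"
        by (simp only: a1)
      then have "a (u ^ (p ^ n mod d)) (a ((u ^ d) ^ (p ^ n div d)) S) = S"
        unfolding am power_mult .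
      then have "a (u ^ (p ^ n mod d)) S = S"
        using fixpow [OF d(2)] by simp
      then have "p ^ n mod d = 0"
        using min [of "p ^ n mod d"] d(1) by (meson mod_less_divisor not_gr_zero not_le)
      then have "d dvd p ^ n" by auto
      then obtain j where j: "d = p ^ j"
        using divides_primepow_nat [OF prime_p] by blast
      have "d \<noteq> 1" using d(2) moved by (metis power_one_right)
      then have "j \<noteq> 0" using j by (metis power_0)
      then have "p dvd d" using j by simp
      then have pd: "p \<le> d" using d(1) by (rule dvd_imp_le)
      have less: "a (u ^ i) S \<noteq> a (u ^ k) S" if ik: "i < k" "k < d" for i k
      proof
        assume "a (u ^ i) S = a (u ^ k) S"
        moreover have "u ^ k = u ^ (k - i) * u ^ i"
          using ik by (simp flip: power_add)
        ultimately have "a (u ^ (k - i)) S = S"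
          by (simp add: am ai)
        then show False using min [of "k - i"] ik by simp
      qed
      have inj: "inj_on (\<lambda>i. a (u ^ i) S) {..<d}"
        by (rule linorder_inj_onI') (use less in auto)
      have sub: "(\<lambda>i. a (u ^ i) S) ` {..<d} \<subseteq> K"
        using aK S G_power [OF u] by blast
      have "d \<le> p"
        using card_mono [OF cK(2) sub] card_image [OF inj] cK(1) by simp
      then have "d = p" using pd by simp
      moreover have "(\<lambda>i. a (u ^ i) S) ` {..<d} = K"
        by (rule card_subset_eq [OF cK(2) sub]) (use card_image [OF inj] cK \<open>d = p\<close> in simp)
      ultimately show ?thesis using d by simp
    qed
    \<comment> \<open>An element fixing \<open>H\<close> but moving another conjugate would permute
      all conjugates in one cycle, and \<open>H\<close> would lie on it.\<close>
    have fixall: "a u S = S" if "u \<in> G" "a u H = H" "S \<in> K" for u S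
    proof (rule ccontr)
      assume "a u S \<noteq> S"
      then have "H \<in> (\<lambda>i. a (u ^ i) S) ` {..<p}"
        using orb that HK by simp
      then obtain i where "a (u ^ i) S = H" by auto
      then have "a (u ^ i) S = a (u ^ i) H"
        using fixpow [OF that(2)] by simp
      then show False using \<open>a u S \<noteq> S\<close> that(2) by (simp add: ai)
    qed
    have 3: "\<exists>i<p. nz (x ^ i * y) H" if "\<not> nz x H"
    proof -
      have "a (inverse y) H \<in> K"
        using aK HK G_inv xy by blast
      then have "a (inverse y) H \<in> (\<lambda>i. a (x ^ i) H) ` {..<p}"
        using orb [OF xy(1) HK] that nz_iff by blast
      then obtain i where i: "i < p" "a (inverse y) H = a (x ^ i) H"
        by auto
      have "a (x ^ i * y) H = a y (a (inverse y) H)"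
        by (simp only: am i)
      also have "\<dots> = a (inverse y * y) H" by (simp only: am)
      finally have "a (x ^ i * y) H = H" by simp
      then show ?thesis
        using i(1) nz_iff by blast
    qed
    have 1: "nz (x ^ p) H"
      using orb [OF xy(1) HK] fixpow [of x H p] nz_iff by metis
    \<comment> \<open>Some \<open>x ^ i * y\<close> fixes every conjugate, so \<open>y\<close> acts
      like the inverse of a power of \<open>x\<close>.\<close>
    have comm: "a y (a x S) = a x (a y S)" if S: "S \<in> K" for S
    proof (cases "nz x H")
      case True
      then show ?thesis
        using fixall xy(1) S aK xy(2) by (metis nz_iff)
    next
      case False
      then obtain i where i: "nz (x ^ i * y) H" using 3 by blast
      have G': "x ^ i * y \<in> G" using xy G_mult G_power by blast
      define w where "w = inverse (x ^ i)"
      have wG: "w \<in> G" using xy G_inv G_power by (simp add: w_def)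
      have yw: "a y T = a w T" if T: "T \<in> K" for T
      proof -
        have "y = w * (x ^ i * y)" by (simp add: w_def)
        then have "a y T = a (x ^ i * y) (a w T)" using am by metis
        also have "\<dots> = a w T"
          using fixall [OF G'] i nz_iff aK [OF wG T] by blast
        finally show ?thesis .
      qed
      have "x * w = w * x"
        unfolding w_def using commute_inv [of "x ^ i" x] by (simp add: power_commutes)
      then show ?thesis
        using yw [OF S] yw [OF aK [OF xy(1) S]] am by metis
    qed
    have "cm x y = inverse (y * x) * (x * y)"
      by (simp add: cm_def mult.assoc)
    moreover define S where "S = a (inverse (y * x)) H"
    ultimately have "a (cm x y) H = a (x * y) S"
      using am by metis
    also have "\<dots> = a (y * x) S"
    proof -
      have "S \<in> K"
        unfolding S_def using aK [OF _ HK] G_mult G_inv xy by blast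
      then show ?thesis using comm by (simp only: am)
    qed
    also have "\<dots> = a (inverse (y * x) * (y * x)) H"
      unfolding S_def by (simp only: am)
    also have "\<dots> = H"
      by (simp only: left_inv a1)
    finally have "nz (cm x y) H" using nz_iff by blast
    then show ?thesis using 1 3 by blast
  next
    case False
    then have "nz (x ^ p) H" "nz (cm x y) H" "nz x H"
      using xy G_power G_cm by auto
    then show ?thesis by blast
  qed
  show ?thesis
  proof
    fix H x y
    assume "sgp H" "H \<subseteq> G" "x \<in> G"
    note m = main [OF this]
    show "nz (x ^ p) H"
      using m \<open>x \<in> G\<close> by blast
    assume "y \<in> G"
    then show "nz (cm x y) H" "\<not> nz x H \<Longrightarrow> \<exists>i<p. nz (x ^ i * y) H"
      using m by auto
  qed
qed

end

text \<open>The regular representation carries an abstract finite group into a type of class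
  \<open>grp\<close>.\<close>

lemma (in group) cayley:
  assumes "finite (carrier G)"
  obtains \<phi> :: "'a \<Rightarrow> 'a Perm.perm"
  where "\<And>x y. x \<in> carrier G \<Longrightarrow> y \<in> carrier G \<Longrightarrow> \<phi> (x \<otimes> y) = \<phi> x * \<phi> y"
    and "inj_on \<phi> (carrier G)"
proof -
  define \<phi> where "\<phi> g = perm_on (carrier G) ((\<otimes>) g)" for g
  have bij: "bij_betw ((\<otimes>) g) (carrier G) (carrier G)" if "g \<in> carrier G" for g
    by (rule bij_betw_byWitness [of _ "(\<otimes>) (inv g)"]) (use that in \<open>auto simp flip: m_assoc\<close>)
  have "\<phi> (x \<otimes> y) = \<phi> x * \<phi> y" if "x \<in> carrier G" "y \<in> carrier G" for x y
    unfolding \<phi>_def by (rule perm_on_mult [OF assms bij bij]) (use that in \<open>auto simp: m_assoc\<close>)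
  moreover have "inj_on \<phi> (carrier G)"
  proof (rule inj_on_inverseI [of _ "\<lambda>s. Perm.apply s \<one>"])
    fix g assume "g \<in> carrier G"
    then show "Perm.apply (\<phi> g) \<one> = g"
      using apply_perm_on [OF assms bij] by (simp add: \<phi>_def)
  qed
  ultimately show thesis by (rule that)
qed

hide_const (open) Perm.order

theorem theorem1p1:
  fixes G :: "('a, 'b) monoid_scheme" and p :: nat
  assumes "Factorial_Ring.prime p"
    and "group G"
    and "finite (carrier G)"
    and "\<exists>n :: nat. order G = p ^ n"
    and "\<And>H. subgroup H G \<Longrightarrow> \<not> H \<lhd> G \<Longrightarrow> card (conjugates G H) = p"
  shows "card (rcosets\<^bsub>G\<^esub> (center G)) \<le> (if p = 2 then 16 else p ^ 3)"
proof -
  interpret group G by (rule assms(2))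
  obtain n where n: "order G = p ^ n" using assms(4) by blast
  obtain \<phi> :: "'a \<Rightarrow> 'a Perm.perm"
    where hom: "\<And>x y. x \<in> carrier G \<Longrightarrow> y \<in> carrier G \<Longrightarrow> \<phi> (x \<otimes>\<^bsub>G\<^esub> y) = \<phi> x * \<phi> y"
    and inj: "inj_on \<phi> (carrier G)"
    using cayley [OF assms(3)] by blast
  have inj_iff: "\<phi> x = \<phi> y \<longleftrightarrow> x = y" if "x \<in> carrier G" "y \<in> carrier G" for x y
    using inj_on_eq_iff [OF inj that] .
  have one: "\<phi> \<one>\<^bsub>G\<^esub> = 1"
  proof -
    have "\<phi> \<one>\<^bsub>G\<^esub> * \<phi> \<one>\<^bsub>G\<^esub> = \<phi> \<one>\<^bsub>G\<^esub> * 1"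
      using hom [of "\<one>\<^bsub>G\<^esub>" "\<one>\<^bsub>G\<^esub>"] by simp
    then show ?thesis by (simp only: grp_class.left_cancel)
  qed
  have inv: "\<phi> (inv\<^bsub>G\<^esub> x) = inverse (\<phi> x)" if "x \<in> carrier G" for x
  proof -
    have "\<phi> x * \<phi> (inv\<^bsub>G\<^esub> x) = 1"
      using hom [of x "inv\<^bsub>G\<^esub> x"] that one by simp
    then show ?thesis by (simp add: grp_class.inv_unique)
  qed
  have pow: "\<phi> (x [^]\<^bsub>G\<^esub> k) = \<phi> x ^ k" if "x \<in> carrier G" for x and k :: nat
    by (induction k) (simp_all add: one hom that power_commutes)
  define Q where "Q = \<phi> ` carrier G"
  interpret Q: pgrp Q p n
  proof
    show "sgp Q"
      unfolding sgp_def
    proof (intro conjI ballI)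
      show "1 \<in> Q" unfolding Q_def using one by (metis image_eqI one_closed)
      show "x * y \<in> Q" if "x \<in> Q" "y \<in> Q" for x y
        using that hom unfolding Q_def by (metis (no_types, lifting) imageE image_eqI m_closed)
      show "inverse x \<in> Q" if "x \<in> Q" for x
        using that inv unfolding Q_def by (metis (no_types, lifting) imageE image_eqI inv_closed)
    qed
    show "x ^ p ^ n = 1" if "x \<in> Q" for x
      using that pow_order_eq_1 n pow one by (auto simp: Q_def) metis
  qed (use assms in \<open>auto simp: Q_def\<close>)
  \<comment> \<open>\<open>conjugates\<close> puts \<open>g\<close> on the left, whereas
    \<open>cj\<close> is a right action; hence the inverse.\<close>
  have cj: "\<phi> (g \<otimes>\<^bsub>G\<^esub> h \<otimes>\<^bsub>G\<^esub> inv\<^bsub>G\<^esub> g) = cj (inverse (\<phi> g)) (\<phi> h)"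
    if "g \<in> carrier G" "h \<in> carrier G" for g h
    using that by (simp add: hom inv cj_def)
  interpret P: few_conj Q p n
  proof (rule Q.few_conjI)
    fix K assume K: "sgp K" "K \<subseteq> Q" and ex: "\<exists>x\<in>Q. \<not> nz x K"
    define H where "H = {g \<in> carrier G. \<phi> g \<in> K}"
    have im: "\<phi> ` H = K"
      using K(2) by (auto simp: H_def Q_def)
    have HG: "H \<subseteq> carrier G" by (auto simp: H_def)
    have sub: "subgroup H G"
      by unfold_locales
        (auto simp: H_def hom inv one sgp_mult [OF K(1)] sgp_inv [OF K(1)] sgp_one [OF K(1)])
    have nn: "\<not> H \<lhd> G"
    proof
      assume N: "H \<lhd> G"
      have "nz x K" if xQ: "x \<in> Q" for x
      proof (rule nz_finite)
        show "finite K" using K(2) Q.fin_G finite_subset by blast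
        fix r assume r: "r \<in> K"
        obtain h where h: "h \<in> H" "r = \<phi> h" using r im by blast
        obtain g where g: "g \<in> carrier G" "x = \<phi> g" using xQ by (auto simp: Q_def)
        have "inv\<^bsub>G\<^esub> g \<otimes>\<^bsub>G\<^esub> h \<otimes>\<^bsub>G\<^esub> inv\<^bsub>G\<^esub> (inv\<^bsub>G\<^esub> g) \<in> H"
          using normal.inv_op_closed2 [OF N _ h(1)] g(1) by blast
        then show "cj x r \<in> K"
          using cj [of "inv\<^bsub>G\<^esub> g" h] g h HG by (auto simp: H_def inv)
      qed
      then show False using ex by blast
    qed
    have gH: "g <#\<^bsub>G\<^esub> H #>\<^bsub>G\<^esub> inv\<^bsub>G\<^esub> g = (\<lambda>h. g \<otimes>\<^bsub>G\<^esub> h \<otimes>\<^bsub>G\<^esub> inv\<^bsub>G\<^esub> g) ` H" for g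
      by (auto simp: l_coset_def r_coset_def)
    have gH': "\<phi> ` (g <#\<^bsub>G\<^esub> H #>\<^bsub>G\<^esub> inv\<^bsub>G\<^esub> g) = cj (inverse (\<phi> g)) ` K" if "g \<in> carrier G" for g
      unfolding gH im [symmetric] image_image
      by (rule image_cong) (use cj [OF that] HG in auto)
    have "(\<lambda>x. cj x ` K) ` Q = (`) \<phi> ` conjugates G H"
    proof (intro equalityI subsetI)
      fix S assume "S \<in> (\<lambda>x. cj x ` K) ` Q"
      then obtain g where g: "g \<in> carrier G" "S = cj (\<phi> g) ` K" by (auto simp: Q_def)
      then have "S = \<phi> ` (inv\<^bsub>G\<^esub> g <#\<^bsub>G\<^esub> H #>\<^bsub>G\<^esub> inv\<^bsub>G\<^esub> (inv\<^bsub>G\<^esub> g))"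
        using gH' [of "inv\<^bsub>G\<^esub> g"] by (simp add: inv)
      then show "S \<in> (`) \<phi> ` conjugates G H"
        unfolding conjugates_def using g(1) inv_closed by blast
    next
      fix S assume "S \<in> (`) \<phi> ` conjugates G H"
      then obtain g where g: "g \<in> carrier G" "S = cj (inverse (\<phi> g)) ` K"
        using gH' by (auto simp: conjugates_def)
      then show "S \<in> (\<lambda>x. cj x ` K) ` Q"
        unfolding Q_def using inv inv_closed by (metis (no_types, lifting) image_eqI)
    qed
    moreover have "inj_on ((`) \<phi>) (conjugates G H)"
    proof (rule inj_on_subset [OF inj_on_image_Pow [OF inj]])
      show "conjugates G H \<subseteq> Pow (carrier G)"
        using HG by (auto simp: conjugates_def gH)
    qed
    ultimately have "card ((\<lambda>x. cj x ` K) ` Q) = card (conjugates G H)"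
      by (simp add: card_image)
    then show "card ((\<lambda>x. cj x ` K) ` Q) = p"
      using assms(5) [OF sub nn] by simp
  qed
  obtain F where F: "finite F" "card F \<le> (if p = 2 then 16 else p ^ 3)"
    "\<And>a. a \<in> Q \<Longrightarrow> \<exists>f\<in>F. f * a \<in> Q.Z"
    using P.center_bound unfolding cov_def by blast
  \<comment> \<open>If \<open>f * \<phi> a\<close> is central, the coset of \<open>a\<close> is that
    of the inverse of the preimage of \<open>f\<close>, so the cover bounds the number of cosets.
    Such an \<open>f\<close> lies in \<open>Q\<close>, where \<open>inv_into\<close> returns the
    true preimage.\<close>
  define \<psi> where "\<psi> = inv_into (carrier G) \<phi>"
  have "rcosets\<^bsub>G\<^esub> (center G) \<subseteq> (\<lambda>f. center G #>\<^bsub>G\<^esub> inv\<^bsub>G\<^esub> (\<psi> f)) ` F"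
  proof
    fix S assume "S \<in> rcosets\<^bsub>G\<^esub> (center G)"
    then obtain a where a: "a \<in> carrier G" "S = center G #>\<^bsub>G\<^esub> a"
      by (auto simp: RCOSETS_def)
    then obtain f where f: "f \<in> F" "f * \<phi> a \<in> Q.Z"
      using F(3) by (auto simp: Q_def)
    then have "f \<in> Q"
      using sgp_mult_right [OF Q.sgp_G] Q.Z_G a(1) Q_def by blast
    then obtain b where b: "b \<in> carrier G" "f = \<phi> b" by (auto simp: Q_def)
    define c where "c = b \<otimes>\<^bsub>G\<^esub> a"
    have c: "c \<in> carrier G" "\<phi> c \<in> Q.Z"
      using a b f by (auto simp: c_def hom)
    have center_iff: "x \<in> center G \<longleftrightarrow> \<phi> x \<in> Q.Z" if x: "x \<in> carrier G" for x
    proof -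
      have "\<phi> x * \<phi> y = \<phi> y * \<phi> x \<longleftrightarrow> x \<otimes>\<^bsub>G\<^esub> y = y \<otimes>\<^bsub>G\<^esub> x" if "y \<in> carrier G" for y
        using inj_iff [of "x \<otimes>\<^bsub>G\<^esub> y" "y \<otimes>\<^bsub>G\<^esub> x"] x that by (simp add: hom)
      then show ?thesis
        using x unfolding center_def Q.Z_def centr_def by (auto simp: Q_def)
    qed
    have center_G: "center G \<subseteq> carrier G" by (auto simp: center_def)
    have cc: "c \<in> center G" using c center_iff by blast
    have sub: "subgroup (center G) G"
    proof (rule subgroupI)
      show "center G \<subseteq> carrier G" "center G \<noteq> {}"
        using cc center_G by auto
      show "inv\<^bsub>G\<^esub> x \<in> center G" if "x \<in> center G" for x
      proof -
        have G: "x \<in> carrier G" using that center_G by auto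
        then have "inverse (\<phi> x) \<in> Q.Z"
          using that center_iff sgp_inv [OF Q.sgp_Z] by blast
        then show ?thesis
          using center_iff [of "inv\<^bsub>G\<^esub> x"] G by (simp add: inv)
      qed
      show "x \<otimes>\<^bsub>G\<^esub> y \<in> center G" if "x \<in> center G" "y \<in> center G" for x y
      proof -
        have G: "x \<in> carrier G" "y \<in> carrier G" using that center_G by auto
        then have "\<phi> x * \<phi> y \<in> Q.Z"
          using that center_iff sgp_mult [OF Q.sgp_Z] by blast
        then show ?thesis
          using center_iff [of "x \<otimes>\<^bsub>G\<^esub> y"] G by (simp add: hom)
      qed
    qed
    have comm: "c \<otimes>\<^bsub>G\<^esub> x = x \<otimes>\<^bsub>G\<^esub> c" if "x \<in> carrier G" for x
      using cc that by (simp add: center_def)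
    have "a = c \<otimes>\<^bsub>G\<^esub> inv\<^bsub>G\<^esub> b"
      using comm [of "inv\<^bsub>G\<^esub> b"] a b by (simp add: c_def flip: m_assoc)
    then have "S = (center G #>\<^bsub>G\<^esub> c) #>\<^bsub>G\<^esub> inv\<^bsub>G\<^esub> b"
      using a(2) c(1) b(1) subgroup.subset [OF sub] by (simp add: coset_mult_assoc)
    also have "center G #>\<^bsub>G\<^esub> c = center G"
      using coset_join2 [OF c(1) sub cc] .
    finally have S: "S = center G #>\<^bsub>G\<^esub> inv\<^bsub>G\<^esub> b" .
    show "S \<in> (\<lambda>f. center G #>\<^bsub>G\<^esub> inv\<^bsub>G\<^esub> (\<psi> f)) ` F"
    proof (rule image_eqI)
      show "S = center G #>\<^bsub>G\<^esub> inv\<^bsub>G\<^esub> (\<psi> f)"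
        using b inj by (simp only: S \<psi>_def inv_into_f_f)
    qed (rule f(1))
  qed
  then have "card (rcosets\<^bsub>G\<^esub> (center G)) \<le> card F"
    using surj_card_le [OF F(1)] by blast
  then show ?thesis using F(2) by linarith
qed

end
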